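(* Let $n\ge1$. (1) For any $\lambda\in\mathbb C^n$ and any simple $\mathfrak m_{\mathbf 1,\mathbf 0}\Delta$-module $V$, the module $T(A_n(\lambda),V)$ is a simple $(A_n,\mathfrak g_n)$-module. (2) For any simple cuspidal $(A_n,\mathfrak g_n)$-module $M$, there are $\lambda\in\mathbb C^n$ and a finite-dimensional simple $\mathfrak{gl}_n$-module $V$ such that $M\cong T(A_n(\lambda),V)$ as $(A_n,\mathfrak g_n)$-modules.
   Context: All vector spaces and algebras are over $\mathbb C$, and $\otimes=\otimes_{\mathbb C}$. For a positive integer $n$, $A_n=\mathbb C[t_1^{\pm1},\ldots,t_n^{\pm1},x_1,\ldots,x_n]$, $d_i=t_i\frac{\partial}{\partial t_i}+\frac{\partial}{\partial x_i}$, $\Delta=\mathrm{span}\{d_1,\ldots,d_n\}$, and $\mathfrak g_n=\bigoplus_{i=1}^nA_nd_i$, a Lie subalgebra of $\mathrm{Der}(A_n)$. We write $t^{\mathbf a}=\prod t_j^{a_j}$, $x^{\mathbf m}=\prod x_j^{m_j}$, $\binom{\mathbf m}{\mathbf r}=\prod_j\binom{m_j}{r_j}$. An $(A_n,\mathfrak g_n)$-module is a $\mathfrak g_n$-module $M$ that is also a module over the associative algebra $A_n$ with $X(fv)-f(Xv)=X(f)v$ for $X\in\mathfrak g_n$, $f\in A_n$, $v\in M$; equivalently, a module over the smash product $A_n\#U(\mathfrak g_n)$. For a $\mathfrak g_n$-module $M$ and $\lambda\in\mathbb C^n$ let $M(\lambda)=\{v\in M\mid \text{for every } i,\ (d_i-\lambda_i)^Nv=0\text{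 for some }N>0\}$ and $M_\lambda=\{v\in M\mid d_iv=\lambda_iv\ \text{for every } i\}$. $M$ is a generalized weight module if $M=\bigoplus_{\lambda}M(\lambda)$; $\mathrm{supp}(M)=\{\lambda\mid M(\lambda)\ne0\}$. It is cuspidal if moreover there is $r\in\mathbb Z_{\ge1}$ with $\dim M_\lambda\le r$ for all $\lambda\in\mathrm{supp}(M)$. An $(A_n,\mathfrak g_n)$-module is cuspidal if it is cuspidal as a $\mathfrak g_n$-module. $D_n$ is the associative algebra generated by the commutative algebra $A_n$ and commuting elements $d_1,\ldots,d_n$ subject to $d_if-fd_i=d_i(f)$. For $\lambda\in\mathbb C^n$, $A_n(\lambda)=t^\lambda A_n$ is the $D_n$-module with basis $t^{\lambda+\mathbf a}x^{\mathbf m}$, on which $A_n$ acts by multiplication and $d_it^{\lambda+\mathbf a}x^{\mathbf m}=(\lambda_i+a_i)t^{\lambda+\mathbf a}x^{\mathbf m}+m_it^{\lambda+\mathbf a}x^{\mathbf m-e_i}$. $\mathfrak m_{\mathbf 1,\mathbf 0}$ is the ideal of $A_n$ generated by $t_1-1,\ldots,t_n-1,x_1,\ldots,x_n$, and $\mathfrak m_{\mathbf 1,\mathbf 0}\Delta=\bigoplus_i\mathfrak m_{\mathbf 1,\mathbf 0}d_i$, a Lie subalgebra of $\mathfrak g_n$. For a $D_n$-module $P$ and an $\mathfrak m_{\mathbf 1,\mathbf 0}\Delta$-module $V$, $T(P,V)=P\otimes V$ is the $(A_n,\mathfrak g_n)$-module with $f(p\otimes v)=fp\otimes v$ for $f\in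 A_n$ and $$(t^{\mathbf a}x^{\mathbf m}d_i)(p\otimes v)=(t^{\mathbf a}x^{\mathbf m}d_ip)\otimes v+\sum_{\mathbf 0\le\mathbf r\le\mathbf m}\binom{\mathbf m}{\mathbf r}t^{\mathbf a}x^{\mathbf m-\mathbf r}p\otimes(t^{\mathbf a}x^{\mathbf r}d_i-\delta_{\mathbf r,\mathbf 0}d_i)v.$$ A $\mathfrak{gl}_n$-module $V$ is viewed as an $\mathfrak m_{\mathbf 1,\mathbf 0}\Delta$-module through the surjective Lie algebra homomorphism $\mathfrak m_{\mathbf 1,\mathbf 0}\Delta\to\mathfrak{gl}_n$ that kills $\mathfrak m_{\mathbf 1,\mathbf 0}^2\Delta$ and sends $x_kd_i$ and $(t_k-1)d_i$ to the matrix unit $E_{k,i}$; then the action becomes $(fd_j)(p\otimes v)=(fd_jp)\otimes v+\sum_{i=1}^nd_i(f)p\otimes E_{i,j}v$ for $f\in A_n$. *)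

theory Defs
  imports "HOL-Analysis.Analysis" "HOL-Library.Poly_Mapping"
begin

section \<open>The algebra $A_n$ and its derivations\<close>

text \<open>
  The number $n \ge 1$ is the cardinality of the finite index type \<open>'n\<close>.
  $A_n$ is the monoid algebra of ${\bf Z}^n \times {\bf N}^n$: the exponent \<open>(a, m)\<close> stands for the
  monomial $t^a x^m$, and the product of \<open>'n An\<close> is the convolution product of \<open>poly_mapping\<close>.
\<close>

type_synonym 'n An = "(int, 'n) vec \<times> (nat, 'n) vec \<Rightarrow>\<^sub>0 complex"

definition mon :: "int^'n \<Rightarrow> nat^'n \<Rightarrow> 'n An" where
  "mon a m = Poly_Mapping.single (a, m) 1"

definition const :: "complex \<Rightarrow> 'n::finite An" where
  "const c = Poly_Mapping.single 0 c"

definition tvar :: "'n::finite \<Rightarrow> 'n An" where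
  "tvar i = mon (axis i 1) 0"

definition xvar :: "'n::finite \<Rightarrow> 'n An" where
  "xvar i = mon 0 (axis i 1)"

text \<open>\<open>t_euler i\<close> is $t_i \partial/\partial t_i$. In \<open>x_deriv\<close> the truncated subtraction is harmless:
  the coefficient vanishes when the exponent of $x_i$ is 0.\<close>

definition t_euler :: "'n \<Rightarrow> 'n::finite An \<Rightarrow> 'n An" where
  "t_euler i f = (\<Sum>(a, m) \<in> Poly_Mapping.keys f.
     Poly_Mapping.single (a, m) (of_int (a $ i) * Poly_Mapping.lookup f (a, m)))"

definition x_deriv :: "'n \<Rightarrow> 'n::finite An \<Rightarrow> 'n An" where
  "x_deriv i f = (\<Sum>(a, m) \<in> Poly_Mapping.keys f.
     Poly_Mapping.single (a, m - axis i 1) (of_nat (m $ i) * Poly_Mapping.lookup f (a, m)))"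

definition der :: "'n \<Rightarrow> 'n::finite An \<Rightarrow> 'n An" where
  "der i f = t_euler i f + x_deriv i f"

lemma An_induct [case_names mon add]:
  fixes f :: "'n::finite An"
  assumes "\<And>c a m. P (const c * mon a m)" "\<And>f g. P f \<Longrightarrow> P g \<Longrightarrow> P (f + g)"
  shows "P f"
proof -
  have s: "P (Poly_Mapping.single u c)" for u c
    using assms(1)[of c "fst u" "snd u"] by (simp add: const_def mon_def mult_single)
  show ?thesis
  proof (induction f rule: update_induct)
    case const
    show ?case using s[of 0 0] by simp
  next
    case (update f u c)
    have "Poly_Mapping.update u c f = f + Poly_Mapping.single u c"
      using update(1)
      by (intro poly_mapping_eqI) (auto simp: lookup_update lookup_add lookup_single in_keys_iff when_def)
    then show ?case using assms(2)[OF update(3) s] by simp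
  qed
qed

lemma sum_keys_superset:
  assumes "finite S" "Poly_Mapping.keys f \<subseteq> S" "\<And>u. h u 0 = 0"
  shows "(\<Sum>u\<in>Poly_Mapping.keys f. h u (Poly_Mapping.lookup f u)) = (\<Sum>u\<in>S. h u (Poly_Mapping.lookup f u))"
  using assms by (intro sum.mono_neutral_left) (auto simp: in_keys_iff)

lemma sum_keys_add:
  fixes f g :: "'a \<Rightarrow>\<^sub>0 'b::ab_group_add"
  assumes "\<And>u. h u 0 = 0"
    and "\<And>u. h u (Poly_Mapping.lookup f u + Poly_Mapping.lookup g u) =
      h u (Poly_Mapping.lookup f u) + h u (Poly_Mapping.lookup g u)"
  shows "(\<Sum>u\<in>Poly_Mapping.keys (f + g). h u (Poly_Mapping.lookup (f + g) u)) =
    (\<Sum>u\<in>Poly_Mapping.keys f. h u (Poly_Mapping.lookup f u)) + (\<Sum>u\<in>Poly_Mapping.keys g. h u (Poly_Mapping.lookup g u))"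
proof -
  let ?S = "Poly_Mapping.keys f \<union> Poly_Mapping.keys g"
  have "Poly_Mapping.keys (f + g) \<subseteq> ?S" by (rule keys_add)
  then show ?thesis
    using sum_keys_superset[of ?S f h] sum_keys_superset[of ?S g h] sum_keys_superset[of ?S "f + g" h] assms
    by (simp add: lookup_add sum.distrib)
qed

lemma const_0 [simp]: "const 0 = 0" and const_1 [simp]: "const 1 = 1"
  and const_add: "const (b + c) = const b + const c"
  and const_mult: "const (b * c) = const b * const c"
  and const_minus: "const (- c) = - const c"
  by (simp_all add: const_def single_add mult_single single_uminus)

lemma mon_0 [simp]: "mon 0 0 = 1"
  by (simp add: mon_def flip: zero_prod_def)

lemma mon_mult: "mon a m * mon b k = mon (a + b) (m + k)"
  by (simp add: mon_def mult_single)

lemma cmon_mult: "const b * mon a m * (const c * mon e k) = const (b * c) * mon (a + e) (m + k)"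
  by (simp add: const_def mon_def mult_single)

lemma der_add: "der i (f + g) = der i f + der i g"
proof -
  have "t_euler i (f + g) = t_euler i f + t_euler i g"
    unfolding t_euler_def split_def prod.collapse
    by (rule sum_keys_add) (simp_all add: ring_distribs single_add)
  moreover have "x_deriv i (f + g) = x_deriv i f + x_deriv i g"
    unfolding x_deriv_def split_def prod.collapse
    by (rule sum_keys_add) (simp_all add: ring_distribs single_add)
  ultimately show ?thesis by (simp add: der_def)
qed

lemma der_mon:
  "der i (const c * mon a m) =
     const c * (const (of_int (a $ i)) * mon a m + const (of_nat (m $ i)) * mon a (m - axis i 1))"
  by (cases "c = 0") (simp_all add: der_def t_euler_def x_deriv_def const_def mon_def mult_single ring_distribs mult.commute
      del: single_of_int single_of_nat)

lemma der_0 [simp]: "der i 0 = 0"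
  using der_add[of i 0 0] by simp

lemma der_const_mult: "der i (const c * f) = const c * der i f"
proof (induction f rule: An_induct)
  case (mon b a m)
  show ?case using der_mon[of i "c * b" a m] der_mon[of i b a m] by (simp add: const_mult mult.assoc)
qed (simp_all add: der_add ring_distribs)

lemma der_const [simp]: "der i (const c) = 0"
  using der_mon[of i c 0 0] by simp

lemma mon_shift: "const (of_nat (m $ i)) * (mon a (m - axis i 1) * mon b k) = const (of_nat (m $ i)) * mon (a + b) (m + k - axis i 1)"
proof (cases "m $ i = 0")
  case False
  then have "m - axis i 1 + k = m + k - axis i 1"
    by (auto simp: vec_eq_iff axis_def)
  then show ?thesis by (simp add: mon_mult)
qed simp

lemma der_mult: "der i (f * g) = der i f * g + f * der i g"
proof (induction f rule: An_induct)
  case (mon b a m)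
  show ?case
  proof (induction g rule: An_induct)
    case (mon c e k)
    have 1: "const (of_nat (m $ i)) * mon (a + e) (m + k - axis i 1)
        = const (of_nat (m $ i)) * (mon a (m - axis i 1) * mon e k)"
      by (rule mon_shift[symmetric])
    have 2: "const (of_nat (k $ i)) * mon (a + e) (m + k - axis i 1)
        = const (of_nat (k $ i)) * (mon e (k - axis i 1) * mon a m)"
      using mon_shift[of k i e a m] by (simp add: add.commute)
    have "der i (const b * mon a m * (const c * mon e k)) = const (b * c) *
        (const (of_int (a $ i)) * (mon a m * mon e k) + const (of_int (e $ i)) * (mon a m * mon e k)
         + const (of_nat (m $ i)) * mon (a + e) (m + k - axis i 1)
         + const (of_nat (k $ i)) * mon (a + e) (m + k - axis i 1))"
      unfolding cmon_mult der_mon by (simp add: const_add mon_mult ring_distribs)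
    also have "\<dots> = der i (const b * mon a m) * (const c * mon e k) + const b * mon a m * der i (const c * mon e k)"
      unfolding 1 2 der_mon by (simp add: const_mult algebra_simps)
    finally show ?case .
  qed (simp_all add: der_add ring_distribs)
qed (simp_all add: der_add ring_distribs)

lemma der_mon_1: "der i (mon a m) = const (of_int (a $ i)) * mon a m + const (of_nat (m $ i)) * mon a (m - axis i 1)"
  using der_mon[of i 1 a m] by simp

lemma der_commute: "der i (der j f) = der j (der i f)"
proof (induction f rule: An_induct)
  case (mon c a m)
  have s: "m - axis i 1 - axis j 1 = m - axis j 1 - axis i 1" by (simp add: vec_eq_iff add.commute)
  have n: "of_nat (m $ i) * of_nat ((m - axis i 1) $ j) = (of_nat (m $ j) * of_nat ((m - axis j 1) $ i) :: complex)"
    by (cases "i = j") (simp_all add: axis_def)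
  have n': "const (of_nat (m $ i)) * const (of_nat ((m - axis i 1) $ j)) =
      const (of_nat (m $ j)) * const (of_nat ((m - axis j 1) $ i))"
    using arg_cong[OF n, of const] by (simp only: const_mult)
  have "der i (der j (const c * mon a m)) = const c * (
      const (of_int (a $ i)) * const (of_int (a $ j)) * mon a m
      + const (of_int (a $ i)) * const (of_nat (m $ j)) * mon a (m - axis j 1)
      + const (of_int (a $ j)) * const (of_nat (m $ i)) * mon a (m - axis i 1)
      + (const (of_nat (m $ j)) * const (of_nat ((m - axis j 1) $ i))) * mon a (m - axis j 1 - axis i 1))" for i j
    unfolding der_const_mult der_add der_mon_1 by (simp add: ring_distribs mult_ac add_ac)
  from this[of i j] this[of j i] show ?case
    unfolding s n' by (simp add: algebra_simps)
qed (simp add: der_add)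


section \<open>The Lie algebra $g_n$\<close>

text \<open>
  $g_n$ is free over $A_n$ on $d_1,\dots,d_n$, so a vector field $\sum_i X_i d_i$ is represented by its
  vector of coefficients, and $d_i$ by \<open>axis i 1\<close>. The lemmas \<open>vf_act_inj\<close> and \<open>vf_act_bracket\<close>
  identify this with the Lie subalgebra $\bigoplus_i A_n d_i$ of ${\rm Der}(A_n)$ under the commutator.
\<close>

type_synonym 'n vf = "('n An, 'n) vec"

definition vf_act :: "'n::finite vf \<Rightarrow> 'n An \<Rightarrow> 'n An" where
  "vf_act X f = (\<Sum>i\<in>UNIV. X $ i * der i f)"

definition vf_scale :: "complex \<Rightarrow> 'n::finite vf \<Rightarrow> 'n vf" where
  "vf_scale c X = const c *s X"

definition vf_bracket :: "'n::finite vf \<Rightarrow> 'n vf \<Rightarrow> 'n vf" where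
  "vf_bracket X Y = (\<chi> j. vf_act X (Y $ j) - vf_act Y (X $ j))"

lemma vf_act_derivation:
  "vf_act X (f + g) = vf_act X f + vf_act X g"
  "vf_act X (const c * f) = const c * vf_act X f"
  "vf_act X (f * g) = vf_act X f * g + f * vf_act X g"
  by (simp_all add: vf_act_def der_add der_const_mult der_mult ring_distribs sum.distrib
      sum_distrib_left sum_distrib_right mult_ac)

lemma der_sum: "der i (sum f S) = (\<Sum>s\<in>S. der i (f s))"
  by (induction S rule: infinite_finite_induct) (simp_all add: der_add)

lemma vf_act_bracket: "vf_act (vf_bracket X Y) f = vf_act X (vf_act Y f) - vf_act Y (vf_act X f)"
proof -
  have e: "vf_act X (vf_act Y f) = (\<Sum>j\<in>UNIV. vf_act X (Y $ j) * der j f)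
      + (\<Sum>j\<in>UNIV. \<Sum>i\<in>UNIV. X $ i * Y $ j * der i (der j f))" for X Y
  proof -
    have "vf_act X (vf_act Y f) = (\<Sum>i\<in>UNIV. \<Sum>j\<in>UNIV. X $ i * der i (Y $ j) * der j f + X $ i * Y $ j * der i (der j f))"
      by (simp add: vf_act_def der_sum der_mult sum_distrib_left ring_distribs mult.assoc)
    also have "\<dots> = (\<Sum>j\<in>UNIV. \<Sum>i\<in>UNIV. X $ i * der i (Y $ j) * der j f + X $ i * Y $ j * der i (der j f))"
      by (rule sum.swap)
    finally show ?thesis by (simp add: vf_act_def sum.distrib sum_distrib_right)
  qed
  have s: "(\<Sum>j\<in>UNIV. \<Sum>i\<in>UNIV. X $ i * Y $ j * der i (der j f)) =
      (\<Sum>j\<in>UNIV. \<Sum>i\<in>UNIV. Y $ i * X $ j * der i (der j f))"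
    by (subst sum.swap) (simp add: der_commute mult_ac)
  show ?thesis unfolding e[of X Y] e[of Y X] s
    by (simp add: vf_bracket_def vf_act_def[of "\<chi> j. _ j"] ring_distribs sum_subtractf)
qed

lemma der_tvar: "der i (tvar k) = (if i = k then tvar k else 0)"
  using der_mon[of i 1 "axis k 1" 0] by (simp add: tvar_def axis_def)

lemma der_xvar: "der i (xvar k) = (if i = k then 1 else 0)"
  using der_mon[of i 1 0 "axis k 1"] by (auto simp: xvar_def axis_def)

lemma vf_act_inj: "(\<forall>f. vf_act X f = vf_act Y f) \<longleftrightarrow> X = Y"
proof
  assume "\<forall>f. vf_act X f = vf_act Y f"
  then have "vf_act X (xvar k) = vf_act Y (xvar k)" for k by blast
  then show "X = Y" by (simp add: vf_act_def der_xvar vec_eq_iff if_distrib cong: if_cong)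
qed simp


section \<open>Modules over Lie algebras and $(A_n, g_n)$-modules\<close>

text \<open>
  A complex vector space is a linear subspace \<open>V\<close> of some type carrying a \<open>vector_space\<close>
  structure \<open>smul\<close>; actions only matter on \<open>V\<close>. Carrier sets are used because a type cannot be
  existentially quantified.
\<close>

locale lie_module = vector_space smul
  for smul :: "complex \<Rightarrow> 'v::ab_group_add \<Rightarrow> 'v" +
  fixes scaleL :: "complex \<Rightarrow> 'g::ab_group_add \<Rightarrow> 'g" and bracket :: "'g \<Rightarrow> 'g \<Rightarrow> 'g" and L :: "'g set"
    and V :: "'v set" and act :: "'g \<Rightarrow> 'v \<Rightarrow> 'v"
  assumes subspace_V: "subspace V"
    and act_closed: "X \<in> L \<Longrightarrow> v \<in> V \<Longrightarrow> act X v \<in> V"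
    and act_add_left: "X \<in> L \<Longrightarrow> Y \<in> L \<Longrightarrow> v \<in> V \<Longrightarrow> act (X + Y) v = act X v + act Y v"
    and act_scale_left: "X \<in> L \<Longrightarrow> v \<in> V \<Longrightarrow> act (scaleL c X) v = smul c (act X v)"
    and act_add_right: "X \<in> L \<Longrightarrow> v \<in> V \<Longrightarrow> w \<in> V \<Longrightarrow> act X (v + w) = act X v + act X w"
    and act_scale_right: "X \<in> L \<Longrightarrow> v \<in> V \<Longrightarrow> act X (smul c v) = smul c (act X v)"
    and act_bracket: "X \<in> L \<Longrightarrow> Y \<in> L \<Longrightarrow> v \<in> V \<Longrightarrow>
      act (bracket X Y) v = act X (act Y v) - act Y (act X v)"

definition simple_lie_module where
  "simple_lie_module smul scaleL bracket L V act \<longleftrightarrow>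
     lie_module smul scaleL bracket L V act \<and> V \<noteq> {0} \<and>
     (\<forall>W. W \<subseteq> V \<longrightarrow> module.subspace smul W \<longrightarrow> (\<forall>X\<in>L. \<forall>w\<in>W. act X w \<in> W) \<longrightarrow> W = {0} \<or> W = V)"

locale AG_module =
  lie_module smul vf_scale vf_bracket "UNIV :: 'n::finite vf set" M gact
  for smul :: "complex \<Rightarrow> 'v::ab_group_add \<Rightarrow> 'v" and M :: "'v set"
    and aact :: "'n::finite An \<Rightarrow> 'v \<Rightarrow> 'v" and gact :: "'n::finite vf \<Rightarrow> 'v \<Rightarrow> 'v" +
  assumes aact_closed: "v \<in> M \<Longrightarrow> aact f v \<in> M"
    and aact_add_left: "v \<in> M \<Longrightarrow> aact (f + g) v = aact f v + aact g v"
    and aact_add_right: "v \<in> M \<Longrightarrow> w \<in> M \<Longrightarrow> aact f (v + w) = aact f v + aact f w"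
    and aact_const: "v \<in> M \<Longrightarrow> aact (const c) v = smul c v"
    and aact_mult: "v \<in> M \<Longrightarrow> aact (f * g) v = aact f (aact g v)"
    and compat: "v \<in> M \<Longrightarrow> gact X (aact f v) - aact f (gact X v) = aact (vf_act X f) v"

definition simple_AG_module where
  "simple_AG_module smul M aact gact \<longleftrightarrow>
     AG_module smul M aact gact \<and> M \<noteq> {0} \<and>
     (\<forall>W. W \<subseteq> M \<longrightarrow> module.subspace smul W \<longrightarrow> (\<forall>f. \<forall>w\<in>W. aact f w \<in> W) \<longrightarrow>
        (\<forall>X. \<forall>w\<in>W. gact X w \<in> W) \<longrightarrow> W = {0} \<or> W = M)"

definition AG_isomorphic where
  "AG_isomorphic scaleM M aactM gactM scaleN N aactN gactN \<longleftrightarrow>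
     (\<exists>\<phi>. bij_betw \<phi> M N \<and>
       (\<forall>u\<in>M. \<forall>v\<in>M. \<phi> (u + v) = \<phi> u + \<phi> v) \<and>
       (\<forall>c. \<forall>v\<in>M. \<phi> (scaleM c v) = scaleN c (\<phi> v)) \<and>
       (\<forall>f. \<forall>v\<in>M. \<phi> (aactM f v) = aactN f (\<phi> v)) \<and>
       (\<forall>X. \<forall>v\<in>M. \<phi> (gactM X v) = gactN X (\<phi> v)))"


section \<open>Weights and cuspidal modules\<close>

definition gen_weight_space ::
  "(complex \<Rightarrow> 'v::ab_group_add \<Rightarrow> 'v) \<Rightarrow> 'v set \<Rightarrow> ('n::finite vf \<Rightarrow> 'v \<Rightarrow> 'v) \<Rightarrow> complex^'n \<Rightarrow> 'v set" where
  "gen_weight_space smul M gact lam =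
     {v \<in> M. \<forall>i. \<exists>N>0. ((\<lambda>w. gact (axis i 1) w - smul (lam $ i) w) ^^ N) v = 0}"

definition weight_space ::
  "(complex \<Rightarrow> 'v::ab_group_add \<Rightarrow> 'v) \<Rightarrow> 'v set \<Rightarrow> ('n::finite vf \<Rightarrow> 'v \<Rightarrow> 'v) \<Rightarrow> complex^'n \<Rightarrow> 'v set" where
  "weight_space smul M gact lam = {v \<in> M. \<forall>i. gact (axis i 1) v = smul (lam $ i) v}"

definition supp ::
  "(complex \<Rightarrow> 'v::ab_group_add \<Rightarrow> 'v) \<Rightarrow> 'v set \<Rightarrow> ('n::finite vf \<Rightarrow> 'v \<Rightarrow> 'v) \<Rightarrow> (complex^'n) set" where
  "supp smul M gact = {lam. gen_weight_space smul M gact lam \<noteq> {0}}"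

text \<open>The direct sum decomposition: every element is, in exactly one way, the sum of a finitely
  supported family of elements of the generalized weight spaces.\<close>

definition gen_weight_module ::
  "(complex \<Rightarrow> 'v::ab_group_add \<Rightarrow> 'v) \<Rightarrow> 'v set \<Rightarrow> ('n::finite vf \<Rightarrow> 'v \<Rightarrow> 'v) \<Rightarrow> bool" where
  "gen_weight_module smul M gact \<longleftrightarrow>
     lie_module smul vf_scale vf_bracket UNIV M gact \<and>
     (\<forall>v\<in>M. \<exists>!w :: complex^'n \<Rightarrow>\<^sub>0 'v.
        (\<forall>lam. Poly_Mapping.lookup w lam \<in> gen_weight_space smul M gact lam) \<and>
        v = (\<Sum>lam \<in> Poly_Mapping.keys w. Poly_Mapping.lookup w lam))"

text \<open>The library \<open>dim\<close> is 0 on infinite-dimensional subspaces, so finiteness is stated separately.\<close>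

definition fin_dim :: "(complex \<Rightarrow> 'v::ab_group_add \<Rightarrow> 'v) \<Rightarrow> 'v set \<Rightarrow> bool" where
  "fin_dim smul S \<longleftrightarrow> (\<exists>B. finite B \<and> S \<subseteq> module.span smul B)"

definition cuspidal ::
  "(complex \<Rightarrow> 'v::ab_group_add \<Rightarrow> 'v) \<Rightarrow> 'v set \<Rightarrow> ('n::finite vf \<Rightarrow> 'v \<Rightarrow> 'v) \<Rightarrow> bool" where
  "cuspidal smul M gact \<longleftrightarrow>
     gen_weight_module smul M gact \<and>
     (\<exists>r\<ge>1. \<forall>lam \<in> supp smul M gact.
        fin_dim smul (weight_space smul M gact lam) \<and>
        vector_space.dim smul (weight_space smul M gact lam) \<le> r)"


section \<open>The modules $A_n(\lambda)$ over the Weyl-type algebra $D_n$\<close>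

text \<open>By the presentation of $D_n$, a $D_n$-module is an $A_n$-module with commuting operators $d_i$
  such that $d_i f - f d_i = d_i(f)$.\<close>

locale Dn_module = vector_space smul
  for smul :: "complex \<Rightarrow> 'p::ab_group_add \<Rightarrow> 'p" and aact :: "'n::finite An \<Rightarrow> 'p \<Rightarrow> 'p" and dact :: "'n \<Rightarrow> 'p \<Rightarrow> 'p" +
  assumes aact_add_left: "aact (f + g) p = aact f p + aact g p"
    and aact_add_right: "aact f (p + q) = aact f p + aact f q"
    and aact_const: "aact (const c) p = smul c p"
    and aact_mult: "aact (f * g) p = aact f (aact g p)"
    and dact_add: "dact i (p + q) = dact i p + dact i q"
    and dact_scale: "dact i (smul c p) = smul c (dact i p)"
    and dact_commute: "dact i (dact j p) = dact j (dact i p)"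
    and dact_aact: "dact i (aact f p) - aact f (dact i p) = aact (der i f) p"

text \<open>The basis vector $t^{\lambda+a}x^m$ of $A_n(\lambda)$ is represented by the basis vector
  \<open>mon a m\<close> of \<open>'n An\<close>; the action of $A_n$ is then the multiplication of \<open>'n An\<close>.\<close>

definition pm_scale :: "complex \<Rightarrow> ('b \<Rightarrow>\<^sub>0 complex) \<Rightarrow> ('b \<Rightarrow>\<^sub>0 complex)" where
  "pm_scale c = Poly_Mapping.map ((*) c)"

definition Alam_d :: "complex^'n \<Rightarrow> 'n \<Rightarrow> 'n::finite An \<Rightarrow> 'n An" where
  "Alam_d lam i p = pm_scale (lam $ i) p + der i p"

lemma lookup_pm_scale [simp]: "Poly_Mapping.lookup (pm_scale c p) b = c * Poly_Mapping.lookup p b"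
  by (simp add: pm_scale_def Poly_Mapping.map.rep_eq when_def)

lemma vector_space_pm_scale: "vector_space pm_scale"
  by unfold_locales (auto intro!: poly_mapping_eqI simp: lookup_add algebra_simps)

lemma pm_scale_const: "pm_scale c f = const c * f"
  unfolding pm_scale_def const_def by (rule mult_map_scale_conv_mult)

lemma Alam_d_mon:
  "Alam_d lam i (mon a m) =
     pm_scale (lam $ i + of_int (a $ i)) (mon a m) + pm_scale (of_nat (m $ i)) (mon a (m - axis i 1))"
  using der_mon[of i 1 a m] by (simp add: Alam_d_def pm_scale_const const_add ring_distribs)

lemma Dn_module_Alam: "Dn_module pm_scale (*) (Alam_d lam)"
proof -
  interpret vector_space pm_scale by (rule vector_space_pm_scale)
  show ?thesis
    by unfold_locales
      (simp_all add: Alam_d_def der_add der_const_mult der_mult der_commute pm_scale_const algebra_simps)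
qed


section \<open>The Lie algebra $m_{1,0}\Delta$ and the projection to $gl_n$\<close>

text \<open>A span over the ring itself is an ideal.\<close>

definition m10 :: "'n::finite An set" where
  "m10 = module.span (*) (range (\<lambda>i. tvar i - 1) \<union> range xvar)"

definition mDelta :: "'n::finite vf set" where
  "mDelta = {X. \<forall>i. X $ i \<in> m10}"

interpretation An: module "(*) :: 'n::finite An \<Rightarrow> 'n An \<Rightarrow> 'n An"
  by unfold_locales (simp_all add: algebra_simps)

lemma vf_act_m10:
  assumes "X \<in> mDelta"
  shows "vf_act X f \<in> m10"
  unfolding vf_act_def m10_def
proof (rule An.subspace_sum[OF An.subspace_span])
  fix i
  have "X $ i \<in> An.span (range (\<lambda>i. tvar i - 1) \<union> range xvar)" using assms by (simp add: mDelta_def m10_def)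
  from An.span_scale[OF this, of "der i f"]
  show "X $ i * der i f \<in> An.span (range (\<lambda>i. tvar i - 1) \<union> range xvar)" by (simp add: mult.commute)
qed

lemma mDelta_subalgebra:
  "0 \<in> mDelta" "X \<in> mDelta \<Longrightarrow> Y \<in> mDelta \<Longrightarrow> X + Y \<in> mDelta"
  "X \<in> mDelta \<Longrightarrow> vf_scale c X \<in> mDelta"
  "X \<in> mDelta \<Longrightarrow> Y \<in> mDelta \<Longrightarrow> vf_bracket X Y \<in> mDelta"
  using vf_act_m10[of X] vf_act_m10[of Y]
  by (auto simp: mDelta_def vf_scale_def vf_bracket_def m10_def An.span_zero
      intro: An.span_add An.span_scale An.span_diff)

lemma tvar_m10: "tvar i - 1 \<in> m10" and xvar_m10: "xvar i \<in> m10"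
  unfolding m10_def by (auto intro: An.span_base)

lemma m10_mult: "f \<in> m10 \<Longrightarrow> g * f \<in> m10" and m10_add: "f \<in> m10 \<Longrightarrow> g \<in> m10 \<Longrightarrow> f + g \<in> m10"
  and m10_diff: "f \<in> m10 \<Longrightarrow> g \<in> m10 \<Longrightarrow> f - g \<in> m10" and m10_0: "0 \<in> m10"
  unfolding m10_def by (auto intro: An.span_add An.span_scale An.span_diff An.span_zero)

lemma mon_t_m10:
  fixes a :: "int^'n"
  shows "mon a 0 - 1 \<in> m10"
proof -
  have add: "mon (b + c) 0 - 1 \<in> m10" if "mon b 0 - 1 \<in> m10" "mon c 0 - 1 \<in> m10" for b c :: "int^'n"
  proof -
    have e: "mon (b + c) 0 - 1 = mon b 0 * (mon c 0 - 1) + (mon b 0 - 1)"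
      using mon_mult[of b 0 c 0] by (simp add: algebra_simps)
    show ?thesis unfolding e by (rule m10_add[OF m10_mult[OF that(2)] that(1)])
  qed
  have neg: "mon (- b) 0 - 1 \<in> m10" if "mon b 0 - 1 \<in> m10" for b :: "int^'n"
  proof -
    have e: "mon (- b) 0 - 1 = (- mon (- b) 0) * (mon b 0 - 1)"
      using mon_mult[of "- b" 0 b 0] by (simp add: algebra_simps)
    show ?thesis unfolding e by (rule m10_mult[OF that])
  qed
  have ax: "mon (axis i k) 0 - 1 \<in> m10" for i :: 'n and k
  proof (induction k rule: int_induct[where k = 0])
    case base
    have "axis i (0::int) = 0" by (simp add: vec_eq_iff axis_def)
    then have "mon (axis i (0::int)) 0 - 1 = (0 :: 'n An)" by (simp only: mon_0 diff_self)
    then show ?case by (simp only: m10_0)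
  next
    case (step1 k)
    have "axis i (k + 1) = axis i k + axis i 1" by (simp add: vec_eq_iff axis_def)
    then show ?case using add[OF step1(2) tvar_m10[of i, unfolded tvar_def]] by simp
  next
    case (step2 k)
    have "axis i (k - 1) = axis i k + - axis i 1" by (simp add: vec_eq_iff axis_def)
    then show ?case using add[OF step2(2) neg[OF tvar_m10[of i, unfolded tvar_def]]] by simp
  qed
  have "mon (\<Sum>i\<in>S. axis i (a $ i)) 0 - 1 \<in> m10" for S
    by (induction S rule: infinite_finite_induct) (simp_all add: m10_0 add ax)
  moreover have "(\<Sum>i\<in>UNIV. axis i (a $ i)) = a"
    by (simp add: vec_eq_iff axis_def)
  ultimately show ?thesis by metis
qed

lemma mon_x_m10:
  assumes "m \<noteq> 0"
  shows "mon a m \<in> m10"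
proof -
  obtain k where "m $ k \<noteq> 0" using assms by (auto simp: vec_eq_iff)
  then have "m = m - axis k 1 + axis k 1" by (auto simp: vec_eq_iff axis_def)
  then have "mon a m = mon a (m - axis k 1) * xvar k" by (simp add: xvar_def mon_mult)
  then show ?thesis by (simp add: m10_mult xvar_m10)
qed

lemma mon_m10: "mon a r - (if r = 0 then 1 else 0) \<in> m10"
  using mon_t_m10[of a] mon_x_m10[of r a] by auto

text \<open>Evaluation at $t = (1,\dots,1)$, $x = 0$.\<close>

definition eval10 :: "'n::finite An \<Rightarrow> complex" where
  "eval10 f = (\<Sum>(a, m) \<in> Poly_Mapping.keys f. if m = 0 then Poly_Mapping.lookup f (a, m) else 0)"

text \<open>
  The surjection $m_{1,0}\Delta \to gl_n$, in coordinates: the coefficient of $E_{k,i}$ is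
  $d_k(X_i)$ evaluated at $(1,0)$. The lemmas below show that on $m_{1,0}\Delta$ it is the unique linear map
  which kills $m_{1,0}^2\Delta$ and sends $x_k d_i$ and $(t_k-1)d_i$ to $E_{k,i}$, and that it is a
  homomorphism of Lie algebras.
\<close>

definition gl_proj :: "'n::finite vf \<Rightarrow> complex^'n^'n" where
  "gl_proj X = (\<chi> k i. eval10 (der k (X $ i)))"

definition gl_scale :: "complex \<Rightarrow> complex^'n^'n \<Rightarrow> complex^'n::finite^'n" where
  "gl_scale c E = (\<chi> k i. c * E $ k $ i)"

definition gl_bracket :: "complex^'n^'n \<Rightarrow> complex^'n^'n \<Rightarrow> complex^'n::finite^'n" where
  "gl_bracket E F = E ** F - F ** E"

definition mat_unit :: "'n \<Rightarrow> 'n \<Rightarrow> complex^'n::finite^'n" where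
  "mat_unit k i = (\<chi> k' i'. if k' = k \<and> i' = i then 1 else 0)"

definition m10_sq :: "'n::finite An set" where
  "m10_sq = module.span (*) {f * g | f g. f \<in> m10 \<and> g \<in> m10}"

lemma eval10_add: "eval10 (f + g) = eval10 f + eval10 g"
  unfolding eval10_def split_def prod.collapse
  using sum_keys_add[of "\<lambda>u c. if snd u = 0 then c else 0" f g] by simp

lemma eval10_0 [simp]: "eval10 0 = 0" by (simp add: eval10_def)

lemma eval10_mon: "eval10 (const c * mon a m) = (if m = 0 then c else 0)"
  by (cases "c = 0") (simp_all add: eval10_def const_def mon_def mult_single)

lemma eval10_mult: "eval10 (f * g) = eval10 f * eval10 g"
proof (induction f rule: An_induct)
  case (mon b a m)
  show ?case
  proof (induction g rule: An_induct)
    case (mon c e k)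
    have e: "m + k = 0 \<longleftrightarrow> m = 0 \<and> k = 0" by (auto simp: vec_eq_iff)
    show ?case unfolding cmon_mult eval10_mon e by simp
  qed (simp_all add: eval10_add ring_distribs)
qed (simp_all add: eval10_add ring_distribs)

lemma eval10_const: "eval10 (const c) = c"
proof -
  have "eval10 (const c * mon 0 0) = c" by (subst eval10_mon) simp
  then show ?thesis unfolding mon_0 mult_1_right .
qed

lemma eval10_1 [simp]: "eval10 1 = 1"
  using eval10_const[of 1] unfolding const_1 .

lemma eval10_diff: "eval10 (f - g) = eval10 f - eval10 g"
  using eval10_add[of "f - g" g] unfolding diff_add_cancel by (simp only: add_diff_cancel)

lemma eval10_sum: "eval10 (sum f S) = (\<Sum>s\<in>S. eval10 (f s))"
  by (induction S rule: infinite_finite_induct) (simp_all add: eval10_add)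

lemma eval10_tvar: "eval10 (tvar i) = 1" and eval10_xvar: "eval10 (xvar i) = 0"
proof -
  show "eval10 (tvar i) = 1"
    using eval10_mon[of 1 "axis i 1" 0] unfolding tvar_def const_1 mult_1_left by simp
  have "axis i 1 \<noteq> (0 :: nat^'a)" by (simp add: axis_eq_0_iff)
  then show "eval10 (xvar i) = 0"
    using eval10_mon[of 1 0 "axis i 1"] unfolding xvar_def const_1 mult_1_left by (simp only: if_False)
qed

lemma m10_eq: "(m10 :: 'n::finite An set) = {f. eval10 f = 0}"
proof (intro equalityI subsetI)
  fix f :: "'n An" assume "f \<in> m10"
  then show "f \<in> {f. eval10 f = 0}" unfolding m10_def
  proof (rule An.span_induct[where P = "\<lambda>f. f \<in> {f. eval10 f = 0}"])
    show "An.subspace {f. f \<in> {f :: 'n An. eval10 f = 0}}"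
      by (rule An.subspaceI) (simp_all add: eval10_add eval10_mult)
  qed (auto simp: eval10_diff eval10_tvar eval10_xvar)
next
  fix f :: "'n An" assume "f \<in> {f. eval10 f = 0}"
  moreover have "f - const (eval10 f) \<in> m10"
  proof (induction f rule: An_induct)
    case (mon c a m)
    have "const c * mon a m - const (eval10 (const c * mon a m)) = const c * (mon a m - (if m = 0 then 1 else 0))"
      by (simp add: eval10_mon algebra_simps)
    then show ?case by (simp add: m10_mult mon_m10 del: right_diff_distrib)
  next
    case (add f g)
    have e: "f + g - const (eval10 (f + g)) = (f - const (eval10 f)) + (g - const (eval10 g))"
      by (simp add: eval10_add const_add)
    show ?case unfolding e by (rule m10_add[OF add])
  qed
  ultimately show "f \<in> m10" by simp
qed

lemma gl_proj_linear: "gl_proj (X + Y) = gl_proj X + gl_proj Y" "gl_proj (vf_scale c X) = gl_scale c (gl_proj X)"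
  by (simp_all add: gl_proj_def gl_scale_def vf_scale_def vec_eq_iff der_add eval10_add der_const_mult eval10_mult eval10_const)

lemma der_1 [simp]: "der i 1 = 0"
  using der_const[of i 1] by simp

lemma der_diff: "der i (f - g) = der i f - der i g"
  using der_add[of i "f - g" g] by (simp add: algebra_simps)

lemma gl_proj_generators:
  "gl_proj (axis i (xvar k)) = mat_unit k i" "gl_proj (axis i (tvar k - 1)) = mat_unit k i"
  by (auto simp: gl_proj_def mat_unit_def vec_eq_iff axis_def der_xvar der_diff der_tvar eval10_tvar)

lemma gl_proj_sq:
  fixes X :: "'n::finite vf"
  assumes "\<And>i. X $ i \<in> m10_sq"
  shows "gl_proj X = 0"
proof -
  have "eval10 f = 0 \<and> (\<forall>k. eval10 (der k f) = 0)" if "f \<in> m10_sq" for f :: "'n An"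
    using that unfolding m10_sq_def
  proof (rule An.span_induct[where P = "\<lambda>f. eval10 f = 0 \<and> (\<forall>k. eval10 (der k f) = 0)"])
    show "An.subspace {f :: 'n An. eval10 f = 0 \<and> (\<forall>k. eval10 (der k f) = 0)}"
      by (rule An.subspaceI) (simp_all add: eval10_add der_add eval10_mult der_mult)
  qed (auto simp: m10_eq eval10_mult der_mult eval10_add)
  with assms show ?thesis by (simp add: gl_proj_def vec_eq_iff)
qed

lemma gl_proj_bracket:
  fixes X Y :: "'n::finite vf"
  assumes "X \<in> mDelta" "Y \<in> mDelta"
  shows "gl_proj (vf_bracket X Y) = gl_bracket (gl_proj X) (gl_proj Y)"
proof -
  have e: "eval10 (der k (vf_act X f)) = (\<Sum>i\<in>UNIV. eval10 (der k (X $ i)) * eval10 (der i f))"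
    if "X \<in> mDelta" for X :: "'n vf" and k f
    using that by (simp add: vf_act_def der_sum eval10_sum der_mult eval10_add eval10_mult mDelta_def m10_eq)
  show ?thesis
    by (simp add: gl_proj_def gl_bracket_def vf_bracket_def vec_eq_iff matrix_matrix_mult_def der_diff eval10_diff
        e[OF assms(1)] e[OF assms(2)])
qed

lemma gl_proj_unique:
  fixes \<pi> :: "'n::finite vf \<Rightarrow> complex^'n^'n"
  assumes add: "\<And>X Y. X \<in> mDelta \<Longrightarrow> Y \<in> mDelta \<Longrightarrow> \<pi> (X + Y) = \<pi> X + \<pi> Y"
    and scale: "\<And>c X. X \<in> mDelta \<Longrightarrow> \<pi> (vf_scale c X) = gl_scale c (\<pi> X)"
    and sq: "\<And>X. (\<And>i. X $ i \<in> m10_sq) \<Longrightarrow> \<pi> X = 0"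
    and gen: "\<And>k i. \<pi> (axis i (xvar k)) = mat_unit k i" "\<And>k i. \<pi> (axis i (tvar k - 1)) = mat_unit k i"
    and X: "X \<in> mDelta"
  shows "\<pi> X = gl_proj X"
proof -
  have ax: "axis i f \<in> mDelta" if "f \<in> m10" for i and f :: "'n An"
    using that by (simp add: mDelta_def axis_def m10_0)
  have axadd: "axis i (f + g) = axis i f + axis i g" for i and f g :: "'n An"
    by (simp add: vec_eq_iff axis_def)
  define P where "P i f \<longleftrightarrow> f \<in> m10 \<and> \<pi> (axis i f) = gl_proj (axis i f)" for i and f :: "'n An"
  have Padd: "P i (f + g)" if "P i f" "P i g" for i f g
    using that by (auto simp: P_def m10_add axadd add ax gl_proj_linear)
  have Psq: "P i (h * f)" if "h \<in> m10" "f \<in> m10" for i h f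
  proof -
    have "h * f \<in> m10_sq" unfolding m10_sq_def using that by (auto intro!: An.span_base)
    then have *: "\<And>j. axis i (h * f) $ j \<in> m10_sq"
      by (simp add: axis_def m10_sq_def An.span_zero)
    show ?thesis using that sq[OF *] gl_proj_sq[OF *] by (simp add: P_def m10_mult)
  qed
  have Pc: "P i (const c * f)" if "P i f" for i c f
  proof -
    have "axis i (const c * f) = vf_scale c (axis i f)" by (simp add: vec_eq_iff axis_def vf_scale_def)
    then show ?thesis using that by (auto simp: P_def m10_mult scale ax gl_proj_linear)
  qed
  have Pmul: "P i (h * f)" if "P i f" for i h f
  proof -
    have "h - const (eval10 h) \<in> m10" by (simp add: m10_eq eval10_diff eval10_const)
    then have "P i ((h - const (eval10 h)) * f)" using that Psq by (simp add: P_def)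
    from Padd[OF this Pc[OF that]] have "P i ((h - const (eval10 h)) * f + const (eval10 h) * f)" .
    moreover have "(h - const (eval10 h)) * f + const (eval10 h) * f = h * f" by (simp add: algebra_simps)
    ultimately show ?thesis by metis
  qed
  have P0: "P i 0" for i
    using Psq[of 0 0 i] by (simp add: m10_0)
  have Pm: "P i f" if "f \<in> m10" for i f
    using that unfolding m10_def
  proof (rule An.span_induct[where P = "P i"])
    show "An.subspace {f. P i f}" by (rule An.subspaceI) (simp_all add: P0 Padd Pmul)
  qed (auto simp: P_def gen gl_proj_generators tvar_m10 xvar_m10)
  have z: "\<pi> 0 = 0" using sq[of 0] by (simp add: m10_sq_def An.span_zero)
  have "(\<Sum>i\<in>S. axis i (X $ i)) \<in> mDelta \<and> \<pi> (\<Sum>i\<in>S. axis i (X $ i)) = gl_proj (\<Sum>i\<in>S. axis i (X $ i))" for S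
  proof (induction S rule: infinite_finite_induct)
    case (insert i S)
    have "X $ i \<in> m10" using X by (simp add: mDelta_def)
    then show ?case using insert Pm[of "X $ i" i]
      by (auto simp: add ax mDelta_subalgebra gl_proj_linear P_def)
  qed (simp_all add: mDelta_subalgebra z gl_proj_def vec_eq_iff)
  moreover have "(\<Sum>i\<in>UNIV. axis i (X $ i)) = X" by (simp add: vec_eq_iff axis_def)
  ultimately show ?thesis by metis
qed

definition gl_action :: "(complex^'n^'n \<Rightarrow> 'v \<Rightarrow> 'v) \<Rightarrow> 'n::finite vf \<Rightarrow> 'v \<Rightarrow> 'v" where
  "gl_action rho X = rho (gl_proj X)"


section \<open>The tensor modules $T(P, V)$\<close>

text \<open>
  A vector space \<open>P\<close> with a basis indexed by \<open>'b\<close> is \<open>'b \<Rightarrow>\<^sub>0 complex\<close>, and its tensor product with \<open>V\<close>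
  consists of the finitely supported families in \<open>V\<close> indexed by \<open>'b\<close>. The lemmas \<open>tensor_bilinear\<close>
  and \<open>tensor_universal\<close> give its universal property. The action is defined on the elements
  $b \otimes v$ with $b$ in the basis and extended linearly; \<open>T_fun_tensor\<close> and \<open>T_vf_tensor\<close> give
  it on all $p \otimes v$.
\<close>

definition tensor :: "(complex \<Rightarrow> 'v \<Rightarrow> 'v) \<Rightarrow> ('b \<Rightarrow>\<^sub>0 complex) \<Rightarrow> 'v \<Rightarrow> ('b \<Rightarrow>\<^sub>0 'v::ab_group_add)" where
  "tensor scaleV p v = Poly_Mapping.map (\<lambda>c. scaleV c v) p"

definition T_space :: "'v::ab_group_add set \<Rightarrow> ('b \<Rightarrow>\<^sub>0 'v) set" where
  "T_space V = {z. \<forall>b. Poly_Mapping.lookup z b \<in> V}"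

definition T_scale :: "(complex \<Rightarrow> 'v \<Rightarrow> 'v) \<Rightarrow> complex \<Rightarrow> ('b \<Rightarrow>\<^sub>0 'v) \<Rightarrow> ('b \<Rightarrow>\<^sub>0 'v::ab_group_add)" where
  "T_scale scaleV c = Poly_Mapping.map (scaleV c)"

definition T_fun :: "(complex \<Rightarrow> 'v \<Rightarrow> 'v) \<Rightarrow> ('n::finite An \<Rightarrow> ('b \<Rightarrow>\<^sub>0 complex) \<Rightarrow> ('b \<Rightarrow>\<^sub>0 complex)) \<Rightarrow>
    'n An \<Rightarrow> ('b \<Rightarrow>\<^sub>0 'v::ab_group_add) \<Rightarrow> ('b \<Rightarrow>\<^sub>0 'v)" where
  "T_fun scaleV aactP f z =
     (\<Sum>b\<in>Poly_Mapping.keys z. tensor scaleV (aactP f (Poly_Mapping.single b 1)) (Poly_Mapping.lookup z b))"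

text \<open>\<open>T_mon \<dots> a m i p v\<close> is $(t^a x^m d_i)(p \otimes v)$.\<close>

definition T_mon :: "(complex \<Rightarrow> 'v \<Rightarrow> 'v) \<Rightarrow> ('n::finite An \<Rightarrow> ('b \<Rightarrow>\<^sub>0 complex) \<Rightarrow> ('b \<Rightarrow>\<^sub>0 complex)) \<Rightarrow>
    ('n \<Rightarrow> ('b \<Rightarrow>\<^sub>0 complex) \<Rightarrow> ('b \<Rightarrow>\<^sub>0 complex)) \<Rightarrow> ('n vf \<Rightarrow> 'v \<Rightarrow> 'v) \<Rightarrow>
    int^'n \<Rightarrow> nat^'n \<Rightarrow> 'n \<Rightarrow> ('b \<Rightarrow>\<^sub>0 complex) \<Rightarrow> 'v \<Rightarrow> ('b \<Rightarrow>\<^sub>0 'v::ab_group_add)" where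
  "T_mon scaleV aactP dactP rho a m i p v =
     tensor scaleV (aactP (mon a m) (dactP i p)) v +
     (\<Sum>r | r \<le> m. T_scale scaleV (of_nat (\<Prod>j\<in>UNIV. (m $ j) choose (r $ j)))
        (tensor scaleV (aactP (mon a (m - r)) p) (rho (axis i (mon a r - (if r = 0 then 1 else 0))) v)))"

definition T_vf :: "(complex \<Rightarrow> 'v \<Rightarrow> 'v) \<Rightarrow> ('n::finite An \<Rightarrow> ('b \<Rightarrow>\<^sub>0 complex) \<Rightarrow> ('b \<Rightarrow>\<^sub>0 complex)) \<Rightarrow>
    ('n \<Rightarrow> ('b \<Rightarrow>\<^sub>0 complex) \<Rightarrow> ('b \<Rightarrow>\<^sub>0 complex)) \<Rightarrow> ('n vf \<Rightarrow> 'v \<Rightarrow> 'v) \<Rightarrow>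
    'n vf \<Rightarrow> ('b \<Rightarrow>\<^sub>0 'v::ab_group_add) \<Rightarrow> ('b \<Rightarrow>\<^sub>0 'v)" where
  "T_vf scaleV aactP dactP rho X z =
     (\<Sum>i\<in>UNIV. \<Sum>(a, m)\<in>Poly_Mapping.keys (X $ i). \<Sum>b\<in>Poly_Mapping.keys z.
        T_scale scaleV (Poly_Mapping.lookup (X $ i) (a, m))
          (T_mon scaleV aactP dactP rho a m i (Poly_Mapping.single b 1) (Poly_Mapping.lookup z b)))"

locale complex_vector_space = vector_space scale
  for scale :: "complex \<Rightarrow> 'v::ab_group_add \<Rightarrow> 'v"
begin

lemma lookup_tensor [simp]: "Poly_Mapping.lookup (tensor scale p v) b = scale (Poly_Mapping.lookup p b) v"
  by (simp add: tensor_def Poly_Mapping.map.rep_eq when_def)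

lemma lookup_T_scale [simp]: "Poly_Mapping.lookup (T_scale scale c z) b = scale c (Poly_Mapping.lookup z b)"
  by (simp add: T_scale_def Poly_Mapping.map.rep_eq when_def)

lemma tensor_bilinear:
  "tensor scale (p + q) v = tensor scale p v + tensor scale q v"
  "tensor scale p (v + w) = tensor scale p v + tensor scale p w"
  "tensor scale (pm_scale c p) v = T_scale scale c (tensor scale p v)"
  "tensor scale p (scale c v) = T_scale scale c (tensor scale p v)"
  by (auto intro!: poly_mapping_eqI simp: lookup_add algebra_simps)

lemma vector_space_T_scale: "vector_space (T_scale scale)"
  by unfold_locales (auto intro!: poly_mapping_eqI simp: lookup_add algebra_simps)

lemma tensor_expand:
  "z = (\<Sum>b\<in>Poly_Mapping.keys z. tensor scale (Poly_Mapping.single b 1) (Poly_Mapping.lookup z b))"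
  by (rule poly_mapping_eqI)
    (simp add: lookup_sum lookup_single when_def if_distrib[of "\<lambda>c. scale c _"] in_keys_iff cong: if_cong)

lemma tensor_family_eq:
  fixes h :: "('b \<Rightarrow>\<^sub>0 complex) \<Rightarrow> 'v \<Rightarrow> 'w::ab_group_add"
  assumes add: "\<And>p q. h (p + q) v = h p v + h q v" and scale: "\<And>c p. h p (scale c v) = h (pm_scale c p) v"
  shows "(\<Sum>b\<in>Poly_Mapping.keys (tensor scale p v).
      h (Poly_Mapping.single b 1) (Poly_Mapping.lookup (tensor scale p v) b)) = h p v"
proof -
  interpret h: additive "\<lambda>p. h p v" by (rule additive.intro) (rule add)
  interpret C: vector_space "pm_scale :: complex \<Rightarrow> ('b \<Rightarrow>\<^sub>0 complex) \<Rightarrow> _" by (rule vector_space_pm_scale)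
  have h0: "h q 0 = 0" for q
    using scale[of q 0] h.zero by simp
  have p: "(\<Sum>b\<in>Poly_Mapping.keys p. pm_scale (Poly_Mapping.lookup p b) (Poly_Mapping.single b 1)) = p"
    by (rule poly_mapping_eqI)
      (simp add: lookup_sum lookup_single when_def if_distrib[of "\<lambda>c. _ * c"] in_keys_iff cong: if_cong)
  have "(\<Sum>b\<in>Poly_Mapping.keys (tensor scale p v).
      h (Poly_Mapping.single b 1) (Poly_Mapping.lookup (tensor scale p v) b)) =
    (\<Sum>b\<in>Poly_Mapping.keys p. h (Poly_Mapping.single b 1) (Poly_Mapping.lookup (tensor scale p v) b))"
    by (intro sum.mono_neutral_left) (auto simp: in_keys_iff h0)
  also have "\<dots> = h (\<Sum>b\<in>Poly_Mapping.keys p. pm_scale (Poly_Mapping.lookup p b) (Poly_Mapping.single b 1)) v"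
    by (simp add: scale h.sum)
  finally show ?thesis by (simp only: p)
qed

lemma T_fun_tensor:
  assumes "Dn_module pm_scale aactP dactP"
  shows "T_fun scale aactP f (tensor scale p v) = tensor scale (aactP f p) v"
proof -
  interpret P: Dn_module pm_scale aactP dactP by (rule assms)
  have s: "aactP f (pm_scale c p) = pm_scale c (aactP f p)" for c p
    by (metis P.aact_const P.aact_mult mult.commute)
  show ?thesis unfolding T_fun_def
    by (rule tensor_family_eq[where h = "\<lambda>p v. tensor scale (aactP f p) v"])
      (simp_all add: P.aact_add_right tensor_bilinear s)
qed

lemma T_vf_tensor:
  assumes "Dn_module pm_scale aactP dactP" "lie_module scale vf_scale vf_bracket mDelta V rho" "v \<in> V"
  shows "T_vf scale aactP dactP rho (axis i (mon a m)) (tensor scale p v) = T_mon scale aactP dactP rho a m i p v"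
proof -
  interpret P: Dn_module pm_scale aactP dactP by (rule assms)
  interpret V: lie_module scale vf_scale vf_bracket mDelta V rho by (rule assms)
  interpret T: vector_space "T_scale scale :: complex \<Rightarrow> ('a \<Rightarrow>\<^sub>0 'v) \<Rightarrow> _" by (rule vector_space_T_scale)
  have s: "aactP f (pm_scale c p) = pm_scale c (aactP f p)" for c f p
    by (metis P.aact_const P.aact_mult mult.commute)
  have L: "axis i (mon a r - (if r = 0 then 1 else 0)) \<in> mDelta" for r
    using mon_m10[of a r] by (auto simp: mDelta_def axis_def m10_0)
  have r: "rho (axis i (mon a r - (if r = 0 then 1 else 0))) (scale c v) =
      scale c (rho (axis i (mon a r - (if r = 0 then 1 else 0))) v)" for r c
    by (rule V.act_scale_right[OF L assms(3)])
  have "T_vf scale aactP dactP rho (axis i (mon a m)) (tensor scale p v) =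
      (\<Sum>j\<in>UNIV. if j = i then \<Sum>b\<in>Poly_Mapping.keys (tensor scale p v).
        T_mon scale aactP dactP rho a m i (Poly_Mapping.single b 1) (Poly_Mapping.lookup (tensor scale p v) b) else 0)"
    unfolding T_vf_def by (rule sum.cong) (auto simp: axis_def mon_def)
  also have "\<dots> = T_mon scale aactP dactP rho a m i p v"
    by (simp only: sum.delta finite UNIV_I if_True, rule tensor_family_eq)
      (simp_all only: T_mon_def P.aact_add_right P.dact_add P.dact_scale s r tensor_bilinear
        T.scale_right_distrib sum.distrib add_ac)
  finally show ?thesis .
qed

lemma tensor_universal:
  fixes scaleW :: "complex \<Rightarrow> 'w::ab_group_add \<Rightarrow> 'w" and \<beta> :: "('b \<Rightarrow>\<^sub>0 complex) \<Rightarrow> 'v \<Rightarrow> 'w"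
  assumes W: "vector_space scaleW" and V: "subspace V"
    and bilin: "\<And>p q v. v \<in> V \<Longrightarrow> \<beta> (p + q) v = \<beta> p v + \<beta> q v"
      "\<And>p v w. v \<in> V \<Longrightarrow> w \<in> V \<Longrightarrow> \<beta> p (v + w) = \<beta> p v + \<beta> p w"
      "\<And>c p v. v \<in> V \<Longrightarrow> \<beta> (pm_scale c p) v = scaleW c (\<beta> p v)"
      "\<And>c p v. v \<in> V \<Longrightarrow> \<beta> p (scale c v) = scaleW c (\<beta> p v)"
  shows "\<exists>!\<phi>. \<phi> \<in> extensional (T_space V) \<and>
     (\<forall>y\<in>T_space V. \<forall>z\<in>T_space V. \<phi> (y + z) = \<phi> y + \<phi> z) \<and>
     (\<forall>c. \<forall>z\<in>T_space V. \<phi> (T_scale scale c z) = scaleW c (\<phi> z)) \<and>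
     (\<forall>p. \<forall>v\<in>V. \<phi> (tensor scale p v) = \<beta> p v)" (is "\<exists>!\<phi>. ?Q \<phi>")
proof -
  interpret W: vector_space scaleW by (rule W)
  define \<psi> where "\<psi> z = (\<Sum>b\<in>Poly_Mapping.keys z. \<beta> (Poly_Mapping.single b 1) (Poly_Mapping.lookup z b))" for z
  have V0: "0 \<in> V" and Vadd: "\<And>x y. x \<in> V \<Longrightarrow> y \<in> V \<Longrightarrow> x + y \<in> V" and Vsc: "\<And>c x. x \<in> V \<Longrightarrow> scale c x \<in> V"
    using V by (auto simp: subspace_def)
  have b0: "\<beta> p 0 = 0" for p using bilin(4)[OF V0, of p 0] by simp
  have T0: "0 \<in> T_space V" and Tadd: "\<And>y z. y \<in> T_space V \<Longrightarrow> z \<in> T_space V \<Longrightarrow> y + z \<in> T_space V"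
    and Tsc: "\<And>c z. z \<in> T_space V \<Longrightarrow> T_scale scale c z \<in> T_space V"
    and Tt: "\<And>p v. v \<in> V \<Longrightarrow> tensor scale p v \<in> T_space V"
    by (auto simp: T_space_def lookup_add V0 Vadd Vsc)
  have \<psi>add: "\<psi> (y + z) = \<psi> y + \<psi> z" if "y \<in> T_space V" "z \<in> T_space V" for y z
    unfolding \<psi>_def using that
    by (intro sum_keys_add[where h = "\<lambda>b. \<beta> (Poly_Mapping.single b 1)"]) (auto simp: b0 T_space_def bilin)
  have \<psi>sc: "\<psi> (T_scale scale c z) = scaleW c (\<psi> z)" if "z \<in> T_space V" for c z
  proof -
    have "\<psi> (T_scale scale c z) = (\<Sum>b\<in>Poly_Mapping.keys z. \<beta> (Poly_Mapping.single b 1) (Poly_Mapping.lookup (T_scale scale c z) b))"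
      unfolding \<psi>_def by (rule sum.mono_neutral_left) (auto simp: b0 in_keys_iff)
    then show ?thesis using that by (simp add: \<psi>_def W.scale_sum_right bilin T_space_def)
  qed
  have \<psi>t: "\<psi> (tensor scale p v) = \<beta> p v" if "v \<in> V" for p v
    unfolding \<psi>_def using that by (intro tensor_family_eq) (auto simp: bilin)
  show ?thesis
  proof (rule ex1I[of _ "restrict \<psi> (T_space V)"])
    show "?Q (restrict \<psi> (T_space V))"
      by (auto simp: Tadd Tsc Tt \<psi>add \<psi>sc \<psi>t)
  next
    fix \<phi> assume Q: "?Q \<phi>"
    have z0: "\<phi> 0 = 0" using Q T0 by (metis add_cancel_left_left)
    show "\<phi> = restrict \<psi> (T_space V)"
    proof (rule extensionalityI[of _ "T_space V"])
      fix z :: "'b \<Rightarrow>\<^sub>0 'v" assume z: "z \<in> T_space V"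
      then have zb: "Poly_Mapping.lookup z b \<in> V" for b by (simp add: T_space_def)
      have "(\<Sum>b\<in>S. tensor scale (Poly_Mapping.single b 1) (Poly_Mapping.lookup z b)) \<in> T_space V \<and>
        \<phi> (\<Sum>b\<in>S. tensor scale (Poly_Mapping.single b 1) (Poly_Mapping.lookup z b)) =
        (\<Sum>b\<in>S. \<beta> (Poly_Mapping.single b 1) (Poly_Mapping.lookup z b))" for S
      proof (induction S rule: infinite_finite_induct)
        case (insert b S)
        then show ?case using Q zb[of b] by (simp add: Tadd Tt)
      qed (simp_all add: T0 z0)
      from this[of "Poly_Mapping.keys z"] show "\<phi> z = restrict \<psi> (T_space V) z"
        using z by (simp add: \<psi>_def flip: tensor_expand)
    qed (use Q in auto)
  qed
qed

end

end

theory Submission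
  imports Defs "HOL-Computational_Algebra.Polynomial"
begin

text \<open>
  $A_n$ is the coordinate ring of the commutative group $({\bf C}^* \times {\bf C})^n$, hence a Hopf
  algebra, and the $d_i$ are invariant derivations of it. Write $f_1 \otimes f_2$ for the comultiplication of
  $f$ (summation understood), $S$ for the antipode and $\varepsilon$ for the evaluation at the neutral
  element $(1,0)$. In an $(A_n, g_n)$-module the operators
  $\theta(f d_i) = S(f_1) (f_2 d_i) - \varepsilon(f) d_i$ commute with $A_n$ and with the $d_j$, they
  represent the Lie algebra $m_{1,0}\Delta$, and $f d_i$ is recovered as $f \cdot d_i + f_1 \theta(f_2 d_i)$.
  So an $(A_n, g_n)$-module is the same thing as a $D_n$-module with a commuting action of
  $m_{1,0}\Delta$ (\<open>Dn_mDelta_module_th\<close>, \<open>gop_eq_gact\<close>, \<open>AG_module_gop\<close>), and in these terms $T(P,V)$ is just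
  $P \otimes V$ with $D_n$ acting on the first factor and $m_{1,0}\Delta$ on the second
  (\<open>T_vf_eq_gop\<close>).

  First part. A submodule $W$ of $A_n(\lambda) \otimes V$ is stable under $A_n$ and the $d_i$. Since $d_i$ has
  generalized eigenvalue $\lambda_i + a_i$ on $t^{\lambda+a}x^m$ and lowers the exponent of $x_i$, the coefficients of the
  elements of $W$ can be isolated one at a time, so $W = A_n(\lambda) \otimes U$ for a subspace $U$ of $V$
  (\<open>coefficient_in_U\<close>). The explicit action shows that $U$ is a submodule of $V$ (\<open>U_stable\<close>), hence $0$ or $V$.

  Second part. A simple cuspidal module $M$ has a weight $\lambda$ with $M_\lambda \ne 0$, and $M_\lambda$ is
  finite-dimensional. It is stable under the operators $\theta$, so it contains a minimal
  $m_{1,0}\Delta$-submodule $V$. The multiplication map $A_n(\lambda) \otimes V \to M$ is a nonzero homomorphism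
  between simple modules, hence an isomorphism (\<open>isomorphic_tensor_module\<close>).

  It remains to see that a finite-dimensional simple $m_{1,0}\Delta$-module $V$ comes from $gl_n$
  (\<open>gl_proj_kernel_acts_trivially\<close>). Let $I$ be the largest ideal of $A_n$ for which $I\Delta$ annihilates $V$. The
  tool is that an ideal $J$ of a Lie algebra $L$ that acts on $V$ by commuting operators satisfies
  $[L,J]V = 0$ (\<open>abelian_ideal_commutators_vanish\<close>, from Jacobson's lemma on commutators). Finite dimension
  of $V$ and surjectivity of the $d_i$ on $A_n$ put powers of $x_i$ and of $t_i - 1$ into $I$, so
  $m_{1,0}^N \subseteq I$ for some $N$. Two kinds of ideals $J$ are then used. As $A_n$ has $2n$ variables but
  only $n$ derivations, there are functions whose derivatives are all negligible: the truncations $y_i$ of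
  $\log t_i - x_i$. The tool, applied to the ideals generated by powers of $y_i$, gives $y_i \in I$, that is,
  $t_i - 1$ and $x_i$ agree modulo $I + m_{1,0}^2$. Applied to $m_{1,0}^k\Delta$ with $k \ge 2$, it shows that
  $f d_i$ and $[\sum_j x_j d_j, f d_i] + f d_i$ act alike for $f \in m_{1,0}^k$ as soon as
  $m_{1,0}^{k+1} \subseteq I$. By the Euler identity the latter acts as $k f d_i$, so $m_{1,0}^k \subseteq I$; hence
  $m_{1,0}^2 \subseteq I$, and the functions whose value and first derivatives vanish at $(1,0)$ lie in $I$.
\<close>

text \<open>This rule reassociates products to the left and loops with \<open>mult_ac\<close>.\<close>

declare An.scale_scale [simp del]

type_synonym 'n exponent = "(int, 'n) vec \<times> (nat, 'n) vec"

abbreviation lookup where "lookup \<equiv> Poly_Mapping.lookup"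
abbreviation keys where "keys \<equiv> Poly_Mapping.keys"
abbreviation single where "single \<equiv> Poly_Mapping.single"

section \<open>Operators on finite-dimensional spaces\<close>

context complex_vector_space
begin

definition endo_on :: "'v set \<Rightarrow> ('v \<Rightarrow> 'v) \<Rightarrow> bool" where
  "endo_on V T \<longleftrightarrow> (\<forall>v\<in>V. T v \<in> V) \<and> (\<forall>u\<in>V. \<forall>v\<in>V. T (u + v) = T u + T v) \<and>
     (\<forall>c. \<forall>v\<in>V. T (scale c v) = scale c (T v))"

lemma endo_onD:
  assumes "endo_on V T"
  shows "v \<in> V \<Longrightarrow> T v \<in> V" "u \<in> V \<Longrightarrow> v \<in> V \<Longrightarrow> T (u + v) = T u + T v"
    "v \<in> V \<Longrightarrow> T (scale c v) = scale c (T v)"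
  using assms by (auto simp: endo_on_def)

lemma endo_on_0: "endo_on V T \<Longrightarrow> subspace V \<Longrightarrow> T 0 = 0"
  using endo_onD(2)[of V T 0 0] subspace_0 by fastforce

lemma endo_on_sum:
  assumes "endo_on V T" "subspace V" "\<And>k. k \<in> S \<Longrightarrow> f k \<in> V"
  shows "T (sum f S) = (\<Sum>k\<in>S. T (f k))"
  using assms(3)
proof (induction S rule: infinite_finite_induct)
  case (insert k S)
  then show ?case using subspace_sum[OF assms(2), of S f] by (simp add: endo_onD(2)[OF assms(1)])
qed (use endo_on_0[OF assms(1,2)] in simp_all)

lemma endo_on_funpow: "endo_on V T \<Longrightarrow> endo_on V (T ^^ k)"
  by (induction k) (auto simp: endo_on_def)

lemma dim_strict_mono_subspace:
  assumes "finite B" "W \<subseteq> span B" "subspace W'" "W' \<subset> W"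
  shows "dim W' < dim W"
proof -
  obtain B' where B': "B' \<subseteq> W'" "independent B'" "W' \<subseteq> span B'" "card B' = dim W'"
    using basis_exists[of W'] by metis
  obtain C where C: "B' \<subseteq> C" "C \<subseteq> W" "independent C" "W \<subseteq> span C"
    using maximal_independent_subset_extend[of B' W] B' assms by blast
  have fC: "finite C" using independent_span_bound[OF assms(1) C(3)] C(2) assms(2) by blast
  have "span B' \<subseteq> W'" using span_minimal[OF B'(1) assms(3)] .
  then have "B' \<noteq> C" using C(4) assms(4) by blast
  then have "card B' < card C" using C(1) fC by (meson psubsetI psubset_card_mono)
  then show ?thesis using B'(4) basis_card_eq_dim[OF C(2,4,3)] by simp
qed

text \<open>A proper subspace has smaller dimension, so a subspace of least dimension with property \<open>P\<close> is minimal.\<close>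

lemma minimal_subspace_exists:
  assumes "finite B" "W0 \<subseteq> span B" "P W0" "\<And>W. P W \<Longrightarrow> subspace W"
  shows "\<exists>W\<subseteq>W0. P W \<and> (\<forall>W'\<subseteq>W. P W' \<longrightarrow> W' = W)"
proof -
  obtain W where W: "P W \<and> W \<subseteq> W0" "\<And>W'. P W' \<and> W' \<subseteq> W0 \<Longrightarrow> dim W \<le> dim W'"
    using ex_has_least_nat[of "\<lambda>W. P W \<and> W \<subseteq> W0" W0 dim] assms(3) by blast
  have "W' = W" if "W' \<subseteq> W" "P W'" for W'
  proof (rule ccontr)
    assume "W' \<noteq> W"
    then have "dim W' < dim W"
      using dim_strict_mono_subspace[OF assms(1), of W W'] W(1) assms(2,4) that by auto
    then show False using W(2)[of W'] W(1) that by auto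
  qed
  then show ?thesis using W(1) by blast
qed

text \<open>The operators on a finite-dimensional space form a finite-dimensional space, so every sequence of
  operators satisfies a nontrivial linear relation. An operator is encoded by the finitely supported family of its
  values on a basis.\<close>

lemma operator_relation:
  assumes "finite B" "V \<subseteq> span B" "subspace V" and T: "\<And>k::nat. endo_on V (T k)"
  shows "\<exists>N c. (\<exists>k\<le>N. c k \<noteq> 0) \<and> (\<forall>v\<in>V. (\<Sum>k\<le>N. scale (c k) (T k v)) = 0)"
proof -
  interpret PM: vector_space "T_scale scale :: complex \<Rightarrow> ('v \<Rightarrow>\<^sub>0 'v) \<Rightarrow> _" by (rule vector_space_T_scale)
  obtain C where C: "C \<subseteq> V" "independent C" "V \<subseteq> span C"
    using basis_exists[of V] by metis
  have fC: "finite C" using independent_span_bound[OF assms(1) C(2)] C(1) assms(2) by blast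
  \<comment> \<open>the matrix units\<close>
  define G where "G = (\<lambda>(b, b'). single b b') ` (C \<times> C)"
  have fG: "finite G" using fC by (simp add: G_def)
  have sG: "single b v \<in> PM.span G" if "b \<in> C" "v \<in> span C" for b v
    using that(2)
  proof (rule span_induct)
    show "single b x \<in> PM.span G" if "x \<in> C" for x
      using that \<open>b \<in> C\<close> by (intro PM.span_base) (auto simp: G_def)
    have s: "single b (scale c v) = T_scale scale c (single b v)" for c v
      by (rule poly_mapping_eqI) (simp add: lookup_single when_def)
    show "subspace {v. single b v \<in> PM.span G}"
      by (rule subspaceI) (simp_all add: single_add s PM.span_add PM.span_scale PM.span_zero)
  qed
  define g where "g k = (\<Sum>b\<in>C. single b (T k b))" for k
  have gG: "g k \<in> PM.span G" for k
    unfolding g_def using C(1,3) endo_onD(1)[OF T] by (intro PM.span_sum sG) auto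
  have lg: "lookup (g k) b = T k b" if "b \<in> C" for k b
    using that fC by (simp add: g_def lookup_sum lookup_single when_def)
  define N where "N = card G"
  have "\<exists>c. (\<exists>k\<le>N. c k \<noteq> 0) \<and> (\<Sum>k\<le>N. T_scale scale (c k) (g k)) = 0"
  proof (cases "inj_on g {..N}")
    case True
    have "PM.dependent (g ` {..N})"
    proof (rule ccontr)
      assume "\<not> ?thesis"
      with PM.independent_span_bound[OF fG this] gG have "card (g ` {..N}) \<le> N" by (auto simp: N_def)
      then show False using card_image[OF True] by simp
    qed
    then obtain u where u: "\<exists>v\<in>g ` {..N}. u v \<noteq> 0" "(\<Sum>v\<in>g ` {..N}. T_scale scale (u v) v) = 0"
      by (subst (asm) PM.dependent_finite) auto
    then have "(\<Sum>k\<le>N. T_scale scale (u (g k)) (g k)) = 0"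
      by (simp add: sum.reindex[OF True])
    then show ?thesis using u(1) by (intro exI[of _ "\<lambda>k. u (g k)"]) auto
  next
    case False
    then obtain k l where kl: "k \<le> N" "l \<le> N" "k \<noteq> l" "g k = g l" by (auto simp: inj_on_def)
    define c where "c j = (if j = k then 1 else if j = l then -1 else 0 :: complex)" for j
    have "(\<Sum>j\<le>N. T_scale scale (c j) (g j)) = (\<Sum>j\<in>{k,l}. T_scale scale (c j) (g j))"
      using kl by (intro sum.mono_neutral_right) (auto simp: c_def)
    also have "\<dots> = 0" using kl by (simp add: c_def)
    finally show ?thesis using kl by (intro exI[of _ c]) (auto simp: c_def)
  qed
  then obtain c where c: "\<exists>k\<le>N. c k \<noteq> 0" "(\<Sum>k\<le>N. T_scale scale (c k) (g k)) = 0" by blast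
  define S where "S v = (\<Sum>k\<le>N. scale (c k) (T k v))" for v
  have SC: "S b = 0" if "b \<in> C" for b
    using arg_cong[OF c(2), of "\<lambda>z. lookup z b"] that
    by (simp add: lookup_sum lg S_def)
  have sub: "subspace {v \<in> V. S v = 0}"
  proof (rule subspaceI)
    show "0 \<in> {v \<in> V. S v = 0}"
      using subspace_0[OF assms(3)] endo_on_0[OF T assms(3)] by (simp add: S_def)
    show "x + y \<in> {v \<in> V. S v = 0}" if "x \<in> {v \<in> V. S v = 0}" "y \<in> {v \<in> V. S v = 0}" for x y
      using that subspace_add[OF assms(3)]
      by (simp add: S_def endo_onD(2)[OF T] scale_right_distrib sum.distrib)
    show "scale a x \<in> {v \<in> V. S v = 0}" if "x \<in> {v \<in> V. S v = 0}" for a x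
    proof -
      have xV: "x \<in> V" using that by simp
      have "S (scale a x) = scale a (S x)"
        using xV by (simp add: S_def endo_onD(3)[OF T] scale_sum_right mult.commute)
      then show ?thesis using that subspace_scale[OF assms(3)] by simp
    qed
  qed
  have "span C \<subseteq> {v \<in> V. S v = 0}" by (rule span_minimal[OF _ sub]) (use C(1) SC in auto)
  then show ?thesis using C(3) c(1) unfolding S_def by blast
qed

text \<open>Jacobson's lemma. Let $p(X) = 0$ with $p \ne 0$. As $C = [Y,X]$ commutes with $X$, taking the commutator with $Y$
  replaces $p(X)$ by $p'(X) C$. Repeating this until the derivative of $p$ is a nonzero constant leaves a power of $C$ that
  vanishes.\<close>

lemma commutator_nilpotent:
  assumes fd: "finite B" "V \<subseteq> span B" "subspace V"
    and X: "endo_on V X" and Y: "endo_on V Y" and C: "endo_on V C"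
    and comm: "\<And>v. v \<in> V \<Longrightarrow> Y (X v) = X (Y v) + C v"
    and CX: "\<And>v. v \<in> V \<Longrightarrow> C (X v) = X (C v)"
  shows "\<exists>m. \<forall>v\<in>V. (C ^^ m) v = 0"
proof -
  note cl = endo_onD(1)[OF X] endo_onD(1)[OF Y] endo_onD(1)[OF C]
    endo_onD(1)[OF endo_on_funpow[OF X]] endo_onD(1)[OF endo_on_funpow[OF C]]
  have CXk: "C ((X ^^ k) v) = (X ^^ k) (C v)" if "v \<in> V" for k v
    using that by (induction k arbitrary: v) (simp_all add: CX cl)
  have CmXk: "(C ^^ m) ((X ^^ k) v) = (X ^^ k) ((C ^^ m) v)" if "v \<in> V" for m k v
    using that by (induction m arbitrary: v) (simp_all add: CXk cl)
  have YXk: "Y ((X ^^ k) v) = (X ^^ k) (Y v) + scale (of_nat k) ((X ^^ (k - 1)) (C v))" if "v \<in> V" for k v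
    using that
  proof (induction k arbitrary: v)
    case (Suc k)
    have "Y ((X ^^ Suc k) v) = X (Y ((X ^^ k) v)) + (X ^^ k) (C v)"
      using Suc.prems by (simp add: comm cl CXk)
    also have "X (Y ((X ^^ k) v)) = (X ^^ Suc k) (Y v) + scale (of_nat k) (X ((X ^^ (k - 1)) (C v)))"
      using Suc by (simp add: endo_onD(2,3)[OF X] cl subspace_scale[OF fd(3)])
    also have "scale (of_nat k) (X ((X ^^ (k - 1)) (C v))) = scale (of_nat k) ((X ^^ k) (C v))"
      by (cases k) simp_all
    finally show ?case by (simp add: algebra_simps)
  qed simp
  \<comment> \<open>the polynomial in \<open>X\<close> with coefficients \<open>c 0, ..., c N\<close>\<close>
  define S where "S c N v = (\<Sum>k\<le>N. scale (c k) ((X ^^ k) v))" for c and N :: nat and v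
  have S_cl: "S c N v \<in> V" if "v \<in> V" for c N v
    unfolding S_def using that by (intro subspace_sum[OF fd(3)] subspace_scale[OF fd(3)] cl)
  have S_comm: "(C ^^ m) (S c N v) = S c N ((C ^^ m) v)" if "v \<in> V" for c N v m
    unfolding S_def using that
    by (simp add: endo_on_sum[OF endo_on_funpow[OF C] fd(3)] endo_onD(3)[OF endo_on_funpow[OF C]]
        subspace_scale[OF fd(3)] cl CmXk)
  have YS: "Y (S c (Suc N) v) = S c (Suc N) (Y v) + S (\<lambda>k. of_nat (Suc k) * c (Suc k)) N (C v)" if "v \<in> V" for c N v
  proof -
    have "Y (S c (Suc N) v) = (\<Sum>k\<le>Suc N. scale (c k) ((X ^^ k) (Y v))) +
        (\<Sum>k\<le>Suc N. scale (of_nat k * c k) ((X ^^ (k - 1)) (C v)))"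
      unfolding S_def using that
      by (simp add: endo_on_sum[OF Y fd(3)] endo_onD(3)[OF Y] subspace_scale[OF fd(3)] cl YXk
          scale_right_distrib sum.distrib mult.commute del: sum.atMost_Suc)
    also have "(\<Sum>k\<le>Suc N. scale (of_nat k * c k) ((X ^^ (k - 1)) (C v))) =
        S (\<lambda>k. of_nat (Suc k) * c (Suc k)) N (C v)"
      by (subst sum.atMost_Suc_shift) (simp add: S_def)
    finally show ?thesis by (simp add: S_def)
  qed
  have main: "\<exists>m. \<forall>v\<in>V. (C ^^ m) v = 0"
    if "\<exists>k\<le>N. c k \<noteq> 0" "\<forall>v\<in>V. S c N ((C ^^ m) v) = 0" for N c m
    using that
  proof (induction N arbitrary: c m)
    case 0
    then show ?case by (auto simp: S_def)
  next
    case (Suc N)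
    show ?case
    proof (cases "\<exists>k\<le>N. c (Suc k) \<noteq> 0")
      case True
      define c' where "c' = (\<lambda>k. of_nat (Suc k) * c (Suc k))"
      have "S c' N ((C ^^ (m + Suc m)) v) = 0" if v: "v \<in> V" for v
      proof -
        have "S c (Suc N) ((C ^^ m) v) = 0" "S c (Suc N) ((C ^^ m) (Y v)) = 0" using Suc.prems(2) v cl by auto
        moreover have "S c (Suc N) (Y ((C ^^ m) v)) + S c' N (C ((C ^^ m) v)) = Y (S c (Suc N) ((C ^^ m) v))"
          using YS[of "(C ^^ m) v" c N] v cl by (simp add: c'_def)
        ultimately have e: "S c (Suc N) (Y ((C ^^ m) v)) + S c' N ((C ^^ Suc m) v) = 0"
          using endo_on_0[OF Y fd(3)] by simp
        \<comment> \<open>A second factor \<open>C ^^ m\<close> removes the term in which \<open>Y\<close> is applied first.\<close>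
        have "(C ^^ m) (S c (Suc N) (Y ((C ^^ m) v)) + S c' N ((C ^^ Suc m) v)) = 0"
          unfolding e using endo_on_0[OF endo_on_funpow[OF C] fd(3)] .
        then have "S c (Suc N) ((C ^^ m) (Y ((C ^^ m) v))) + S c' N ((C ^^ m) ((C ^^ Suc m) v)) = 0"
          using v cl by (simp add: endo_onD(2)[OF endo_on_funpow[OF C]] S_cl S_comm del: funpow.simps)
        moreover have "S c (Suc N) ((C ^^ m) (Y ((C ^^ m) v))) = 0" using Suc.prems(2) v cl by blast
        ultimately show ?thesis by (simp add: funpow_add funpow_swap1)
      qed
      moreover have "\<exists>k\<le>N. c' k \<noteq> 0" using True by (auto simp: c'_def simp del: of_nat_Suc)
      ultimately show ?thesis using Suc.IH by blast
    next
      case False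
      then have "c k = 0" if "k \<le> Suc N" "k \<noteq> 0" for k using that by (cases k) auto
      moreover from this Suc.prems(1) have "c 0 \<noteq> 0" by auto
      moreover have "S c (Suc N) v = (\<Sum>k\<in>{0}. scale (c k) ((X ^^ k) v))" for v
        unfolding S_def using calculation by (intro sum.mono_neutral_right) auto
      ultimately have "\<forall>v\<in>V. (C ^^ m) v = 0" using Suc.prems(2) by simp
      then show ?thesis by blast
    qed
  qed
  obtain N c where "\<exists>k\<le>N. c k \<noteq> 0" "\<forall>v\<in>V. S c N v = 0"
    using operator_relation[OF fd, of "\<lambda>k. X ^^ k"] endo_on_funpow[OF X] unfolding S_def by blast
  then show ?thesis using main[of N c 0] by simp
qed

text \<open>On a minimal nonzero invariant subspace the kernel of each operator is nonzero and invariant, hence everything.\<close>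

lemma commuting_nilpotent_common_kernel:
  assumes fd: "finite B" "V \<subseteq> span B" "subspace V" "V \<noteq> {0}"
    and endo: "\<And>C. C \<in> F \<Longrightarrow> endo_on V C"
    and nil: "\<And>C. C \<in> F \<Longrightarrow> \<exists>m. \<forall>v\<in>V. (C ^^ m) v = 0"
    and comm: "\<And>C D v. C \<in> F \<Longrightarrow> D \<in> F \<Longrightarrow> v \<in> V \<Longrightarrow> C (D v) = D (C v)"
  shows "\<exists>v\<in>V. v \<noteq> 0 \<and> (\<forall>C\<in>F. C v = 0)"
proof -
  define P where "P W \<longleftrightarrow> subspace W \<and> W \<subseteq> V \<and> W \<noteq> {0} \<and> (\<forall>C\<in>F. \<forall>w\<in>W. C w \<in> W)" for W
  have "P V" using fd endo by (auto simp: P_def endo_onD(1))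
  then obtain W where W: "P W" "\<And>W'. W' \<subseteq> W \<Longrightarrow> P W' \<Longrightarrow> W' = W"
    using minimal_subspace_exists[OF fd(1,2), of P] by (auto simp: P_def)
  have sW: "subspace W" and WV: "W \<subseteq> V" using W(1) by (auto simp: P_def)
  obtain w where w: "w \<in> W" "w \<noteq> 0" using W(1) subspace_0[OF sW] by (auto simp: P_def)
  have "C u = 0" if C: "C \<in> F" and u: "u \<in> W" for C u
  proof -
    let ?K = "{x \<in> W. C x = 0}"
    have sK: "subspace ?K"
      using sW endo_onD(2,3)[OF endo[OF C] subsetD[OF WV]] endo_on_0[OF endo[OF C] fd(3)] WV
      by (intro subspaceI) (auto simp: subspace_0 subspace_add subspace_scale subset_iff)
    have Cm: "(C ^^ m) w \<in> W" for m
      using W(1) C w(1) by (induction m) (auto simp: P_def)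
    obtain m where "(C ^^ m) w = 0" using nil[OF C] w(1) WV by blast
    then obtain m where m: "(C ^^ m) w \<noteq> 0" "(C ^^ Suc m) w = 0"
      using w(2) ex_least_nat_less[of "\<lambda>m. (C ^^ m) w = 0" m] by auto
    then have "(C ^^ m) w \<in> ?K" using Cm by simp
    then have "?K \<noteq> {0}" using m(1) by blast
    moreover have "D x \<in> ?K" if "D \<in> F" "x \<in> ?K" for D x
      using that W(1) WV comm[OF C that(1), of x] endo_on_0[OF endo[OF that(1)] fd(3)]
      by (auto simp: P_def)
    ultimately have "P ?K" using sK WV by (auto simp: P_def)
    from W(2)[OF _ this] u show ?thesis by blast
  qed
  then show ?thesis using w WV by blast
qed

end

section \<open>Abelian ideals acting on simple modules\<close>

sublocale lie_module \<subseteq> complex_vector_space smul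
  by unfold_locales

context lie_module
begin

lemma endo_act: "X \<in> L \<Longrightarrow> endo_on V (act X)"
  by (simp add: endo_on_def act_closed act_add_right act_scale_right)

lemma act_zero_right: "X \<in> L \<Longrightarrow> act X 0 = 0"
  using endo_on_0[OF endo_act subspace_V] .

text \<open>For \<open>X\<close> in \<open>J\<close> the commutator $[Y,X]$ lies in \<open>J\<close>, so it commutes with \<open>X\<close> and is nilpotent by
  Jacobson's lemma. These commutators also commute with each other, so they have a common kernel, which is a
  submodule because \<open>J\<close> is an ideal.\<close>

lemma abelian_ideal_commutators_vanish:
  assumes fd: "fin_dim smul V"
    and simple: "simple_lie_module smul scaleL bracket L V act"
    and J: "J \<subseteq> L" "\<And>X Y. X \<in> J \<Longrightarrow> Y \<in> L \<Longrightarrow> bracket Y X \<in> J"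
    and ab: "\<And>X Y v. X \<in> J \<Longrightarrow> Y \<in> J \<Longrightarrow> v \<in> V \<Longrightarrow> act X (act Y v) = act Y (act X v)"
    and XY: "X \<in> J" "Y \<in> L" and v: "v \<in> V"
  shows "act (bracket Y X) v = 0"
proof -
  obtain B where B: "finite B" "V \<subseteq> span B" using fd by (auto simp: fin_dim_def)
  have V0: "V \<noteq> {0}" using simple by (simp add: simple_lie_module_def)
  let ?F = "{act (bracket Y X) |X Y. X \<in> J \<and> Y \<in> L}"
  have JL: "X \<in> L" if "X \<in> J" for X using that J(1) by blast
  have nil: "\<exists>m. \<forall>v\<in>V. (C ^^ m) v = 0" if "C \<in> ?F" for C
  proof -
    from that obtain X Y where C: "C = act (bracket Y X)" and XY: "X \<in> J" "Y \<in> L" by blast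
    show ?thesis
      unfolding C
    proof (rule commutator_nilpotent[OF B subspace_V, where X = "act X" and Y = "act Y"])
      show "act Y (act X v) = act X (act Y v) + act (bracket Y X) v" if "v \<in> V" for v
        using act_bracket[OF XY(2) JL[OF XY(1)] that] by simp
      show "act (bracket Y X) (act X v) = act X (act (bracket Y X) v)" if "v \<in> V" for v
        by (rule ab[OF J(2)[OF XY] XY(1) that])
    qed (use XY J(2)[OF XY] JL in \<open>auto simp: endo_act\<close>)
  qed
  obtain w where w: "w \<in> V" "w \<noteq> 0" "\<And>X Y. X \<in> J \<Longrightarrow> Y \<in> L \<Longrightarrow> act (bracket Y X) w = 0"
  proof -
    have endoF: "endo_on V C" if "C \<in> ?F" for C
    proof -
      from that obtain X Y where C: "C = act (bracket Y X)" "X \<in> J" "Y \<in> L" by blast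
      show ?thesis unfolding C(1) by (rule endo_act[OF JL[OF J(2)[OF C(2,3)]]])
    qed
    have commF: "C (D v) = D (C v)" if "C \<in> ?F" "D \<in> ?F" "v \<in> V" for C D v
    proof -
      from that(1,2) obtain X Y X' Y' where C: "C = act (bracket Y X)" "X \<in> J" "Y \<in> L"
        and D: "D = act (bracket Y' X')" "X' \<in> J" "Y' \<in> L"
        by blast
      show ?thesis unfolding C(1) D(1) by (rule ab[OF J(2)[OF C(2,3)] J(2)[OF D(2,3)] that(3)])
    qed
    have "\<exists>v\<in>V. v \<noteq> 0 \<and> (\<forall>C\<in>?F. C v = 0)"
      by (rule commuting_nilpotent_common_kernel[OF B subspace_V V0]) (fact endoF nil commF)+
    then obtain w where w: "w \<in> V" "w \<noteq> 0" "\<forall>C\<in>?F. C w = 0" by blast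
    show thesis
    proof (rule that[OF w(1,2)])
      fix X Y assume "X \<in> J" "Y \<in> L"
      then have "act (bracket Y X) \<in> ?F" by blast
      with w(3) show "act (bracket Y X) w = 0" by blast
    qed
  qed
  let ?W = "{w \<in> V. \<forall>X\<in>J. \<forall>Y\<in>L. act (bracket Y X) w = 0}"
  have bL: "bracket Y X \<in> L" if "X \<in> J" "Y \<in> L" for X Y using J(2)[OF that] JL by blast
  have sub: "subspace ?W"
    using subspace_0[OF subspace_V] subspace_add[OF subspace_V] subspace_scale[OF subspace_V]
    by (intro subspaceI) (simp_all add: act_zero_right act_add_right act_scale_right bL)
  have stable: "act Z u \<in> ?W" if "Z \<in> L" "u \<in> ?W" for Z u
  proof -
    have uV: "u \<in> V" and u0: "\<And>X Y. X \<in> J \<Longrightarrow> Y \<in> L \<Longrightarrow> act (bracket Y X) u = 0"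
      using that(2) by simp_all
    have "act (bracket Y X) (act Z u) = 0" if XY: "X \<in> J" "Y \<in> L" for X Y
    proof -
      have "act (bracket Z (bracket Y X)) u = act Z (act (bracket Y X) u) - act (bracket Y X) (act Z u)"
        by (rule act_bracket[OF \<open>Z \<in> L\<close> bL[OF XY] uV])
      moreover have "act (bracket Z (bracket Y X)) u = 0" "act (bracket Y X) u = 0"
        by (rule u0[OF J(2)[OF XY] \<open>Z \<in> L\<close>], rule u0[OF XY])
      ultimately show ?thesis using act_zero_right[OF \<open>Z \<in> L\<close>] by simp
    qed
    then show ?thesis using act_closed[OF \<open>Z \<in> L\<close> uV] by simp
  qed
  have "w \<in> ?W" using w by simp
  then have "?W \<noteq> {0}" using w(2) by blast
  moreover have "?W = {0} \<or> ?W = V"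
    using simple sub stable unfolding simple_lie_module_def by (metis (no_types, lifting) mem_Collect_eq subsetI)
  ultimately have "v \<in> ?W" using v by argo
  then show ?thesis using XY by simp
qed

end

section \<open>The comultiplication of $A_n$\<close>

lemma finite_vec_le: "finite {r :: nat^'n::finite. r \<le> m}"
proof (rule finite_subset)
  show "{r. r \<le> m} \<subseteq> (\<lambda>g. \<chi> i. g i) ` PiE UNIV (\<lambda>i. {..m $ i})"
  proof
    fix r assume "r \<in> {r. r \<le> m}"
    then show "r \<in> (\<lambda>g. \<chi> i. g i) ` PiE UNIV (\<lambda>i. {..m $ i})"
      by (intro image_eqI[where x = "\<lambda>i. r $ i"]) (auto simp: less_eq_vec_def)
  qed
qed (auto intro!: finite_imageI finite_PiE)

definition vec_binomial :: "nat^'n \<Rightarrow> nat^'n::finite \<Rightarrow> nat" where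
  "vec_binomial m r = (\<Prod>j\<in>UNIV. (m $ j) choose (r $ j))"

lemma vec_binomial_outside: "\<not> r \<le> m \<Longrightarrow> vec_binomial m r = 0"
  by (auto simp: vec_binomial_def less_eq_vec_def not_le intro!: prod_zero binomial_eq_0)

lemma vec_binomial_0 [simp]: "vec_binomial m 0 = 1"
  by (simp add: vec_binomial_def)

text \<open>Pascal's rule in the \<open>k\<close>-th coordinate.\<close>

lemma vec_binomial_Suc:
  "vec_binomial (m + axis k 1) r = vec_binomial m r + (if r $ k = 0 then 0 else vec_binomial m (r - axis k 1))"
proof -
  let ?P = "\<lambda>f. (\<Prod>j\<in>UNIV - {k}. f j)"
  have split: "(\<Prod>j\<in>UNIV. f j) = f k * ?P f" for f :: "'a \<Rightarrow> nat"
    by (subst prod.remove[of _ k]) simp_all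
  have "?P (\<lambda>j. ((m + axis k 1) $ j) choose (r $ j)) = ?P (\<lambda>j. (m $ j) choose (r $ j))"
    by (rule prod.cong) (auto simp: axis_def)
  moreover have "?P (\<lambda>j. (m $ j) choose ((r - axis k 1) $ j)) = ?P (\<lambda>j. (m $ j) choose (r $ j))"
    by (rule prod.cong) (auto simp: axis_def)
  moreover have "(Suc (m $ k)) choose (r $ k) = (m $ k choose (r $ k)) + (if r $ k = 0 then 0 else (m $ k) choose (r $ k - 1))"
    by (cases "r $ k") simp_all
  ultimately show ?thesis
    unfolding vec_binomial_def split by (simp add: ring_distribs axis_def)
qed

lemma const_mult_mon_xvar: "xvar k * (const c * mon a m) = const c * mon a (m + axis k 1)"
  by (simp add: xvar_def mon_mult mult.left_commute add.commute)

text \<open>The monomials $t^a$ and the $x_k$ generate $A_n$, so an identity that is linear in \<open>f\<close> need only be propagated along multiplication by $x_k$.\<close>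

lemma An_generators_induct [case_names t x add]:
  fixes f :: "'n::finite An"
  assumes t: "\<And>c a. P (const c * mon a 0)" and x: "\<And>k f. P f \<Longrightarrow> P (xvar k * f)"
    and add: "\<And>f g. P f \<Longrightarrow> P g \<Longrightarrow> P (f + g)"
  shows "P f"
proof (induction f rule: An_induct)
  case (mon c a m)
  show ?case
  proof (induction "\<Sum>j\<in>UNIV. m $ j" arbitrary: m)
    case 0
    then have "m = 0" by (simp add: vec_eq_iff)
    then show ?case using t by simp
  next
    case (Suc s)
    then obtain k where k: "m $ k \<noteq> 0" by (metis Zero_neq_Suc sum.neutral)
    define m' where "m' = m - axis k 1"
    have m: "m = m' + axis k 1" using k by (auto simp: vec_eq_iff axis_def m'_def)
    have "(\<Sum>j\<in>UNIV. m $ j) = (\<Sum>j\<in>UNIV. m' $ j) + 1"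
      unfolding m by (simp add: sum.distrib axis_def)
    then have "P (const c * mon a m')" using Suc by simp
    from x[OF this, of k] show ?case by (simp add: const_mult_mon_xvar m)
  qed
qed (rule add)

text \<open>In the Hopf algebra $A_n$ the $t_j$ are group-like and the $x_j$ primitive, so the comultiplication sends $t^a x^m$ to
  $\sum_r {m \choose r} t^a x^{m-r} \otimes t^a x^r$. It is used only through the sums
  $\sum \beta(f_1, f_2)$ for bilinear maps $\beta$, and these are what is defined here; \<open>balanced\<close> expresses
  that $\beta$ factors over the tensor product.\<close>

definition coprod_sum :: "'n::finite An \<Rightarrow> ('n An \<Rightarrow> 'n An \<Rightarrow> 'w::ab_group_add) \<Rightarrow> 'w" where
  "coprod_sum f \<beta> = (\<Sum>(a, m)\<in>keys f. \<Sum>r | r \<le> m.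
     \<beta> (const (lookup f (a, m) * of_nat (vec_binomial m r)) * mon a (m - r)) (mon a r))"

definition balanced :: "('n::finite An \<Rightarrow> 'n An \<Rightarrow> 'w::ab_group_add) \<Rightarrow> bool" where
  "balanced \<beta> \<longleftrightarrow> (\<forall>x x' y. \<beta> (x + x') y = \<beta> x y + \<beta> x' y) \<and>
     (\<forall>x y y'. \<beta> x (y + y') = \<beta> x y + \<beta> x y') \<and> (\<forall>c x y. \<beta> (const c * x) y = \<beta> x (const c * y))"

lemma balancedI:
  assumes "\<And>x x' y. \<beta> (x + x') y = \<beta> x y + \<beta> x' y" "\<And>x y y'. \<beta> x (y + y') = \<beta> x y + \<beta> x y'"
    "\<And>c x y. \<beta> (const c * x) y = \<beta> x (const c * y)"
  shows "balanced \<beta>"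
  using assms by (simp add: balanced_def)

lemma balancedD:
  assumes "balanced \<beta>"
  shows "\<beta> (x + x') y = \<beta> x y + \<beta> x' y" "\<beta> x (y + y') = \<beta> x y + \<beta> x y'"
    "\<beta> (const c * x) y = \<beta> x (const c * y)" "\<beta> 0 y = 0" "\<beta> x 0 = 0"
proof -
  show "\<beta> (x + x') y = \<beta> x y + \<beta> x' y" "\<beta> x (y + y') = \<beta> x y + \<beta> x y'" "\<beta> (const c * x) y = \<beta> x (const c * y)"
    for x x' y y' c
    using assms by (auto simp: balanced_def)
  from this(1)[of 0 0] this(2)[of _ 0 0] show "\<beta> 0 y = 0" "\<beta> x 0 = 0" by simp_all
qed

lemma balanced_compose:
  assumes "balanced \<beta>"
  shows "balanced (\<lambda>x y. \<beta> (g * x) y)" "balanced (\<lambda>x y. \<beta> x (g * y))" "balanced (\<lambda>x y. \<beta> (x * g) y)"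
    "balanced (\<lambda>x y. \<beta> x (y * g))"
    "balanced (\<lambda>x y. \<beta> (der i x) y)" "balanced (\<lambda>x y. \<beta> x (der i y))" "balanced (\<lambda>x y. \<beta> (g * x) (h * y))"
  by (auto intro!: balancedI simp: balancedD[OF assms] ring_distribs der_add der_const_mult mult.left_commute[of g]
      mult.left_commute[of h] mult.assoc)

lemma coprod_sum_add_right: "coprod_sum f (\<lambda>x y. \<beta> x y + \<gamma> x y) = coprod_sum f \<beta> + coprod_sum f \<gamma>"
  by (simp add: coprod_sum_def sum.distrib split_def)

lemma coprod_sum_diff_right: "coprod_sum f (\<lambda>x y. \<beta> x y - \<gamma> x y) = coprod_sum f \<beta> - coprod_sum f \<gamma>"
  by (simp add: coprod_sum_def sum_subtractf split_def)

lemma coprod_sum_minus_right: "coprod_sum f (\<lambda>x y. - \<beta> x y) = - coprod_sum f \<beta>"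
  by (simp add: coprod_sum_def sum_negf split_def)

lemma coprod_sum_zero_right [simp]: "coprod_sum f (\<lambda>x y. 0) = 0"
  by (simp add: coprod_sum_def split_def)

lemma coprod_sum_sum_right: "coprod_sum f (\<lambda>x y. \<Sum>s\<in>S. \<beta> s x y) = (\<Sum>s\<in>S. coprod_sum f (\<beta> s))"
  by (induction S rule: infinite_finite_induct) (simp_all add: coprod_sum_add_right)

lemma coprod_sum_swap: "coprod_sum f (\<lambda>x y. coprod_sum g (\<lambda>z w. \<beta> x y z w)) = coprod_sum g (\<lambda>z w. coprod_sum f (\<lambda>x y. \<beta> x y z w))"
  unfolding coprod_sum_def[of g] coprod_sum_sum_right split_def ..

lemma coprod_sum_closed:
  fixes f :: "'n::finite An"
  assumes "0 \<in> N" "\<And>u v. u \<in> N \<Longrightarrow> v \<in> N \<Longrightarrow> u + v \<in> N" "\<And>x y. \<beta> x y \<in> N"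
  shows "coprod_sum f \<beta> \<in> N"
proof -
  have s: "sum h S \<in> N" if "\<And>s. h s \<in> N" for h and S :: "(nat^'n) set"
    using that by (induction S rule: infinite_finite_induct) (simp_all add: assms(1,2))
  have "sum h S \<in> N" if "\<And>s. h s \<in> N" for h and S :: "'n exponent set"
    using that by (induction S rule: infinite_finite_induct) (simp_all add: assms(1,2))
  then show ?thesis
    unfolding coprod_sum_def split_def using s assms(3) by simp
qed

lemma coprod_sum_add:
  assumes "balanced \<beta>"
  shows "coprod_sum (f + g) \<beta> = coprod_sum f \<beta> + coprod_sum g \<beta>"
proof -
  let ?h = "\<lambda>u c. \<Sum>r | r \<le> snd u. \<beta> (const (c * of_nat (vec_binomial (snd u) r)) * mon (fst u) (snd u - r)) (mon (fst u) r)"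
  show ?thesis
    using sum_keys_add[of ?h f g]
    by (simp add: coprod_sum_def split_def ring_distribs const_add balancedD[OF assms] sum.distrib)
qed

lemma coprod_sum_0 [simp]: "coprod_sum 0 \<beta> = 0"
  by (simp add: coprod_sum_def)

lemma coprod_sum_mon:
  assumes "balanced \<beta>"
  shows "coprod_sum (const c * mon a m) \<beta> = (\<Sum>r | r \<le> m. \<beta> (const (c * of_nat (vec_binomial m r)) * mon a (m - r)) (mon a r))"
  by (cases "c = 0") (simp_all add: coprod_sum_def const_def[of c] mon_def[of a m] mult_single balancedD[OF assms])

lemma coprod_sum_t: "balanced \<beta> \<Longrightarrow> coprod_sum (const c * mon a 0) \<beta> = \<beta> (const c * mon a 0) (mon a 0)"
proof -
  have "{r. r \<le> (0 :: nat^'a)} = {0}" by (auto simp: less_eq_vec_def vec_eq_iff)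
  then show "balanced \<beta> \<Longrightarrow> coprod_sum (const c * mon a 0) \<beta> = \<beta> (const c * mon a 0) (mon a 0)"
    by (simp add: coprod_sum_mon)
qed

lemma coprod_sum_const_mult:
  assumes "balanced \<beta>"
  shows "coprod_sum (const c * f) \<beta> = coprod_sum f (\<lambda>x y. \<beta> (const c * x) y)"
proof (induction f rule: An_induct)
  case (mon b a m)
  have e: "const c * (const b * mon a m) = const (c * b) * mon a m" by (simp add: const_mult mult.assoc)
  show ?case
    unfolding e coprod_sum_mon[OF assms] coprod_sum_mon[OF balanced_compose(1)[OF assms]]
    by (simp add: const_mult mult.assoc)
next
  case (add f g)
  then show ?case by (simp add: ring_distribs coprod_sum_add assms balanced_compose)
qed

text \<open>This is the primitivity of $x_k$; it amounts to Pascal's rule.\<close>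

lemma coprod_sum_x:
  assumes "balanced \<beta>"
  shows "coprod_sum (xvar k * f) \<beta> = coprod_sum f (\<lambda>x y. \<beta> (xvar k * x) y) + coprod_sum f (\<lambda>x y. \<beta> x (xvar k * y))"
proof (induction f rule: An_induct)
  case (mon c a m)
  let ?e = "axis k 1 :: nat^'a"
  have le: "r \<le> m + ?e" if "r \<le> m" for r using that by (auto simp: less_eq_vec_def intro: le_add1 order_trans)
  have sh: "m + ?e - r = ?e + (m - r)" if "r \<le> m" for r using that by (auto simp: less_eq_vec_def vec_eq_iff)
  have "coprod_sum (xvar k * (const c * mon a m)) \<beta> =
      (\<Sum>r | r \<le> m + ?e. \<beta> (const (c * of_nat (vec_binomial m r)) * mon a (m + ?e - r)) (mon a r)) +
      (\<Sum>r | r \<le> m + ?e. \<beta> (const (c * of_nat (if r $ k = 0 then 0 else vec_binomial m (r - ?e))) * mon a (m + ?e - r)) (mon a r))"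
    unfolding const_mult_mon_xvar coprod_sum_mon[OF assms] vec_binomial_Suc
    by (simp only: of_nat_add ring_distribs const_add balancedD[OF assms] sum.distrib)
  also have "(\<Sum>r | r \<le> m + ?e. \<beta> (const (c * of_nat (vec_binomial m r)) * mon a (m + ?e - r)) (mon a r)) =
      (\<Sum>r | r \<le> m. \<beta> (const (c * of_nat (vec_binomial m r)) * mon a (m + ?e - r)) (mon a r))"
    using le by (intro sum.mono_neutral_right finite_vec_le) (auto simp: vec_binomial_outside balancedD[OF assms])
  also have "\<dots> = coprod_sum (const c * mon a m) (\<lambda>x y. \<beta> (xvar k * x) y)"
    unfolding coprod_sum_mon[OF balanced_compose(1)[OF assms]] const_mult_mon_xvar
    by (rule sum.cong) (auto simp: sh[simplified] add.commute)
  also have "(\<Sum>r | r \<le> m + ?e. \<beta> (const (c * of_nat (if r $ k = 0 then 0 else vec_binomial m (r - ?e))) * mon a (m + ?e - r)) (mon a r)) =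
      (\<Sum>r\<in>(\<lambda>r. r + ?e) ` {r. r \<le> m}. \<beta> (const (c * of_nat (vec_binomial m (r - ?e))) * mon a (m + ?e - r)) (mon a r))"
  proof (rule sum.mono_neutral_cong_right)
    show "(\<lambda>r. r + ?e) ` {r. r \<le> m} \<subseteq> {r. r \<le> m + ?e}" by (auto simp: less_eq_vec_def)
    have "r \<in> (\<lambda>r. r + ?e) ` {r. r \<le> m}" if "r \<le> m + ?e" "r $ k \<noteq> 0" for r
    proof (rule image_eqI)
      show "r = (r - ?e) + ?e" using that(2) by (auto simp: vec_eq_iff axis_def)
      show "r - ?e \<in> {r. r \<le> m}" using that(1) by (auto simp: less_eq_vec_def axis_def le_diff_conv)
    qed
    then show "\<forall>r\<in>{r. r \<le> m + ?e} - (\<lambda>r. r + ?e) ` {r. r \<le> m}.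
        \<beta> (const (c * of_nat (if r $ k = 0 then 0 else vec_binomial m (r - ?e))) * mon a (m + ?e - r)) (mon a r) = 0"
      by (auto simp: balancedD[OF assms])
  qed (auto simp: finite_vec_le)
  also have "\<dots> = (\<Sum>r | r \<le> m. \<beta> (const (c * of_nat (vec_binomial m r)) * mon a (m - r)) (mon a (r + ?e)))"
    by (subst sum.reindex) (simp_all add: inj_on_def)
  also have "\<dots> = coprod_sum (const c * mon a m) (\<lambda>x y. \<beta> x (xvar k * y))"
    unfolding coprod_sum_mon[OF balanced_compose(2)[OF assms]]
    by (rule sum.cong) (simp_all add: xvar_def mon_mult add.commute)
  finally show ?case .
next
  case (add f g)
  then show ?case by (simp add: ring_distribs coprod_sum_add assms balanced_compose)
qed

text \<open>Multiplicativity of the comultiplication follows from the cases of the generators, without Vandermonde's identity.\<close>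

lemma coprod_sum_mult:
  assumes "balanced \<beta>"
  shows "coprod_sum (f * g) \<beta> = coprod_sum f (\<lambda>x y. coprod_sum g (\<lambda>z w. \<beta> (x * z) (y * w)))"
  using assms
proof (induction f arbitrary: \<beta> rule: An_generators_induct)
  case (t c a)
  have tt: "coprod_sum (mon a 0 * g) \<beta> = coprod_sum g (\<lambda>z w. \<beta> (mon a 0 * z) (mon a 0 * w))" if "balanced \<beta>" for \<beta> :: "'a An \<Rightarrow> 'a An \<Rightarrow> 'b"
    using that
  proof (induction g arbitrary: \<beta> rule: An_generators_induct)
    case (t e b)
    have "mon a 0 * (const e * mon b 0) = const e * mon (a + b) 0" by (simp add: mon_mult mult.left_commute)
    then show ?case using t by (simp add: coprod_sum_t balanced_compose mon_mult)
  next
    case (x k f)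
    have e: "mon a 0 * (xvar k * f) = xvar k * (mon a 0 * f)" for f by (simp add: mult.left_commute)
    show ?case unfolding e
      using x by (simp add: coprod_sum_x balanced_compose) (simp add: mult.left_commute)
  next
    case (add f h)
    then show ?case by (simp add: ring_distribs coprod_sum_add balanced_compose)
  qed
  have bal: "balanced (\<lambda>x y. coprod_sum g (\<lambda>z w. \<beta> (x * z) (y * w)))"
    by (rule balancedI) (simp_all add: ring_distribs balancedD[OF t] coprod_sum_add_right mult.assoc)
  show ?case
    unfolding coprod_sum_t[OF bal] using t
    by (simp add: mult.assoc coprod_sum_const_mult tt balanced_compose)
next
  case (x k f)
  note b = x.prems
  have bal: "balanced (\<lambda>x y. coprod_sum g (\<lambda>z w. \<beta> (x * z) (y * w)))"
    by (rule balancedI) (simp_all add: ring_distribs balancedD[OF b] coprod_sum_add_right mult.assoc)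
  show ?case
    unfolding coprod_sum_x[OF bal] mult.assoc
    using b by (simp add: coprod_sum_x x.IH balanced_compose)
next
  case (add f h)
  note b = add.prems
  have bal: "balanced (\<lambda>x y. coprod_sum g (\<lambda>z w. \<beta> (x * z) (y * w)))"
    by (rule balancedI) (simp_all add: ring_distribs balancedD[OF b] coprod_sum_add_right mult.assoc)
  show ?case by (simp add: ring_distribs coprod_sum_add b bal add.IH)
qed

text \<open>The derivations $d_i$ are invariant under translations of the group.\<close>

lemma coprod_sum_der_left:
  assumes "balanced \<beta>"
  shows "coprod_sum (der i f) \<beta> = coprod_sum f (\<lambda>x y. \<beta> (der i x) y)"
  using assms
proof (induction f arbitrary: \<beta> rule: An_generators_induct)
  case (t c a)
  have d: "der i (const c * mon a 0) = const (c * of_int (a $ i)) * mon a 0" for c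
    by (simp add: der_mon const_mult)
  show ?case using t by (simp add: d coprod_sum_t balanced_compose)
next
  case (x k f)
  have z: "\<beta> 0 = (\<lambda>y. 0)" by (simp add: fun_eq_iff balancedD[OF x.prems])
  have "coprod_sum (der i (xvar k * f)) \<beta> = (if i = k then coprod_sum f \<beta> else 0) + coprod_sum (xvar k * der i f) \<beta>"
    using x.prems by (simp add: der_mult der_xvar coprod_sum_add)
  also have "coprod_sum (xvar k * der i f) \<beta> = coprod_sum f (\<lambda>x y. \<beta> (xvar k * der i x) y) + coprod_sum f (\<lambda>x y. \<beta> (der i x) (xvar k * y))"
    using x.prems by (simp add: coprod_sum_x x.IH balanced_compose)
  also have "(if i = k then coprod_sum f \<beta> else 0) + (coprod_sum f (\<lambda>x y. \<beta> (xvar k * der i x) y) + coprod_sum f (\<lambda>x y. \<beta> (der i x) (xvar k * y))) =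
      coprod_sum (xvar k * f) (\<lambda>x y. \<beta> (der i x) y)"
    using x.prems
    by (simp add: coprod_sum_x balanced_compose der_mult der_xvar balancedD[OF x.prems] z coprod_sum_add_right)
  finally show ?case .
qed (simp add: der_add coprod_sum_add balanced_compose)

lemma balanced_flip: "balanced \<beta> \<Longrightarrow> balanced (\<lambda>x y. \<beta> y x)"
  by (simp add: balanced_def)

text \<open>The group is commutative.\<close>

lemma coprod_sum_flip:
  assumes "balanced \<beta>"
  shows "coprod_sum f (\<lambda>x y. \<beta> y x) = coprod_sum f \<beta>"
  using assms
proof (induction f arbitrary: \<beta> rule: An_generators_induct)
  case (t c a)
  then show ?case by (simp add: coprod_sum_t balanced_flip balancedD(3)[OF t])
next
  case (x k f)
  have "coprod_sum f (\<lambda>x y. \<beta> (xvar k * y) x) = coprod_sum f (\<lambda>x y. \<beta> (xvar k * x) y)"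
    "coprod_sum f (\<lambda>x y. \<beta> y (xvar k * x)) = coprod_sum f (\<lambda>x y. \<beta> x (xvar k * y))"
    using x.IH[OF balanced_compose(1)[OF x.prems]] x.IH[OF balanced_compose(2)[OF x.prems]] .
  then show ?case by (simp add: coprod_sum_x balanced_flip x.prems)
next
  case (add f g)
  show ?case
    using add.IH(1)[OF add.prems] add.IH(2)[OF add.prems]
    by (simp add: coprod_sum_add[OF add.prems] coprod_sum_add[OF balanced_flip[OF add.prems]])
qed

lemma coprod_sum_der_right:
  assumes "balanced \<beta>"
  shows "coprod_sum (der i f) \<beta> = coprod_sum f (\<lambda>x y. \<beta> x (der i y))"
  using coprod_sum_der_left[OF balanced_flip[OF assms], of i f] coprod_sum_flip[OF assms, of "der i f"]
    coprod_sum_flip[OF balanced_compose(6)[OF assms], of f i] by simp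

lemma balanced_counit:
  assumes "\<And>x y. \<gamma> (x + y) = \<gamma> x + (\<gamma> y :: 'w::ab_group_add)"
  shows "balanced (\<lambda>x y. \<gamma> (const (eval10 y) * x))"
  by (rule balancedI)
    (simp_all add: assms ring_distribs eval10_add eval10_mult eval10_const const_add const_mult mult_ac)

lemma coprod_sum_counit_right:
  assumes "\<And>x y. \<gamma> (x + y) = \<gamma> x + (\<gamma> y :: 'w::ab_group_add)"
  shows "coprod_sum f (\<lambda>x y. \<gamma> (const (eval10 y) * x)) = \<gamma> f"
  using assms
proof (induction f arbitrary: \<gamma> rule: An_generators_induct)
  case (t c a)
  have "eval10 (mon a 0) = 1" using eval10_mon[of 1 a 0] unfolding const_1 mult_1_left by simp
  then show ?case by (simp add: coprod_sum_t[OF balanced_counit] t)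
next
  case (x k f)
  have "\<gamma> 0 = 0" using x.prems[of 0 0] by simp
  moreover have "coprod_sum f (\<lambda>x y. \<gamma> (xvar k * (const (eval10 y) * x))) = \<gamma> (xvar k * f)"
    by (rule x.IH) (simp add: x.prems ring_distribs)
  ultimately show ?case
    by (simp add: coprod_sum_x[OF balanced_counit] x.prems eval10_mult eval10_xvar mult.left_commute)
next
  case (add f g)
  then show ?case by (simp add: coprod_sum_add[OF balanced_counit])
qed

lemma coprod_sum_counit_left:
  assumes "\<And>x y. \<gamma> (x + y) = \<gamma> x + (\<gamma> y :: 'w::ab_group_add)"
  shows "coprod_sum f (\<lambda>x y. \<gamma> (const (eval10 x) * y)) = \<gamma> f"
  using coprod_sum_flip[OF balanced_counit[where \<gamma> = \<gamma>, OF assms], of f] coprod_sum_counit_right[of \<gamma> f, OF assms]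
  by simp

text \<open>Both sides are the sum of \<open>\<tau>\<close> over the twofold comultiplication $f_1 \otimes f_2 \otimes f_3$.\<close>

lemma coprod_sum_coassoc:
  assumes "\<And>z. balanced (\<lambda>x y. \<tau> x y z)" "\<And>x. balanced (\<lambda>y z. \<tau> x y z)"
  shows "coprod_sum f (\<lambda>x y. coprod_sum x (\<lambda>z w. \<tau> z w y)) = coprod_sum f (\<lambda>x y. coprod_sum y (\<lambda>z w. \<tau> x z w))"
  using assms
proof (induction f arbitrary: \<tau> rule: An_generators_induct)
  case (t c a)
  note d = balancedD[OF t(1)] balancedD[OF t(2)]
  have b1: "balanced (\<lambda>x y. coprod_sum x (\<lambda>z w. \<tau> z w y))" and b2: "balanced (\<lambda>x y. coprod_sum y (\<lambda>z w. \<tau> x z w))"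
    by (rule balancedI; simp add: coprod_sum_add coprod_sum_add_right coprod_sum_const_mult t d)+
  have "coprod_sum (mon a 0) (\<lambda>z w. \<tau> x z w) = \<tau> x (mon a 0) (mon a 0)" for x
    using coprod_sum_t[OF t(2), of 1 a] by simp
  then show ?case by (simp add: coprod_sum_t b1 b2 t)
next
  case (x k f)
  note d = balancedD[OF x.prems(1)] balancedD[OF x.prems(2)]
  have b1: "balanced (\<lambda>x y. coprod_sum x (\<lambda>z w. \<tau> z w y))" and b2: "balanced (\<lambda>x y. coprod_sum y (\<lambda>z w. \<tau> x z w))"
    by (rule balancedI; simp add: coprod_sum_add coprod_sum_add_right coprod_sum_const_mult x.prems d)+
  have 1: "coprod_sum f (\<lambda>x y. coprod_sum x (\<lambda>z w. \<tau> (xvar k * z) w y)) = coprod_sum f (\<lambda>x y. coprod_sum y (\<lambda>z w. \<tau> (xvar k * x) z w))"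
    by (rule x.IH; rule balancedI) (simp_all add: d ring_distribs mult.left_commute[of "xvar k"])
  have 2: "coprod_sum f (\<lambda>x y. coprod_sum x (\<lambda>z w. \<tau> z (xvar k * w) y)) = coprod_sum f (\<lambda>x y. coprod_sum y (\<lambda>z w. \<tau> x (xvar k * z) w))"
    by (rule x.IH; rule balancedI) (simp_all add: d ring_distribs mult.left_commute[of "xvar k"])
  have 3: "coprod_sum f (\<lambda>x y. coprod_sum x (\<lambda>z w. \<tau> z w (xvar k * y))) = coprod_sum f (\<lambda>x y. coprod_sum y (\<lambda>z w. \<tau> x z (xvar k * w)))"
    by (rule x.IH; rule balancedI) (simp_all add: d ring_distribs mult.left_commute[of "xvar k"])
  show ?case
    by (simp add: coprod_sum_x b1 b2 x.prems coprod_sum_add_right 1 2 3)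
next
  case (add f g)
  note d = balancedD[OF add.prems(1)] balancedD[OF add.prems(2)]
  have b1: "balanced (\<lambda>x y. coprod_sum x (\<lambda>z w. \<tau> z w y))" and b2: "balanced (\<lambda>x y. coprod_sum y (\<lambda>z w. \<tau> x z w))"
    by (rule balancedI; simp add: coprod_sum_add coprod_sum_add_right coprod_sum_const_mult add.prems d)+
  show ?case using add.IH[OF add.prems] by (simp add: coprod_sum_add b1 b2)
qed

text \<open>The operators of a module are additive on its carrier only, whence the set \<open>N\<close>.\<close>

lemma coprod_sum_hom:
  fixes f :: "'n::finite An"
  assumes "0 \<in> N" "\<And>u v. u \<in> N \<Longrightarrow> v \<in> N \<Longrightarrow> u + v \<in> N"
    and h: "\<And>u v. u \<in> N \<Longrightarrow> v \<in> N \<Longrightarrow> h (u + v) = h u + h v"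
    and \<beta>: "\<And>x y. \<beta> x y \<in> N"
  shows "h (coprod_sum f \<beta>) = coprod_sum f (\<lambda>x y. h (\<beta> x y))"
proof -
  have h0: "h 0 = 0" using h[of 0 0] assms(1) by simp
  have s1: "sum g S \<in> N \<and> h (sum g S) = (\<Sum>s\<in>S. h (g s))" if "\<And>s. g s \<in> N" for g and S :: "(nat^'n) set"
    using that by (induction S rule: infinite_finite_induct) (simp_all add: assms(1,2) h h0)
  have s2: "h (sum g S) = (\<Sum>s\<in>S. h (g s))" if "\<And>s. g s \<in> N" for g and S :: "'n exponent set"
  proof -
    have "sum g S \<in> N \<and> h (sum g S) = (\<Sum>s\<in>S. h (g s))"
      using that by (induction S rule: infinite_finite_induct) (simp_all add: assms(1,2) h h0)
    then show ?thesis by blast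
  qed
  show ?thesis
    unfolding coprod_sum_def split_def using \<beta> by (simp add: s1 s2)
qed

section \<open>The antipode\<close>

text \<open>The inversion $t \mapsto t^{-1}$, $x \mapsto -x$ of the group.\<close>

definition antipode :: "'n::finite An \<Rightarrow> 'n An" where
  "antipode f = (\<Sum>(a, m)\<in>keys f.
     single (- a, m) ((-1) ^ (\<Sum>j\<in>UNIV. m $ j) * lookup f (a, m)))"

lemma antipode_add: "antipode (f + g) = antipode f + antipode g"
  unfolding antipode_def split_def prod.collapse
  by (rule sum_keys_add) (simp_all add: ring_distribs single_add)

lemma antipode_mon: "antipode (const c * mon a m) = const ((-1) ^ (\<Sum>j\<in>UNIV. m $ j) * c) * mon (- a) m"
  by (cases "c = 0") (simp_all add: antipode_def const_def mon_def mult_single)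

lemma antipode_mult: "antipode (f * g) = antipode f * antipode g"
proof (induction f rule: An_induct)
  case (mon b a m)
  show ?case
  proof (induction g rule: An_induct)
    case (mon c e k)
    have s: "(-1) ^ (\<Sum>j\<in>UNIV. (m + k) $ j) * (b * c) =
        ((-1) ^ (\<Sum>j\<in>UNIV. m $ j) * b) * ((-1) ^ (\<Sum>j\<in>UNIV. k $ j) * (c :: complex))"
      by (simp add: sum.distrib power_add)
    show ?case unfolding cmon_mult antipode_mon s by simp
  qed (simp_all add: antipode_add ring_distribs)
qed (simp_all add: antipode_add ring_distribs)

lemma antipode_const: "antipode (const c) = const c"
  using antipode_mon[of c 0 0] by simp

lemma antipode_1 [simp]: "antipode 1 = 1"
  using antipode_const[of 1] by simp

lemma antipode_t: "antipode (mon a 0) = mon (- a) 0"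
  using antipode_mon[of 1 a 0] by simp

lemma antipode_x: "antipode (xvar k) = - xvar k"
  using antipode_mon[of 1 0 "axis k 1"] by (simp add: xvar_def axis_def const_minus)

lemma antipode_0 [simp]: "antipode 0 = 0"
  by (simp add: antipode_def)

lemma der_minus: "der i (- f) = - der i f"
  using der_diff[of i 0 f] by simp

lemma der_antipode: "der i (antipode f) = - antipode (der i f)"
proof (induction f rule: An_generators_induct)
  case (t c a)
  show ?case
    by (simp add: antipode_mult antipode_const antipode_t der_mon der_const_mult der_mon_1 const_minus)
next
  case (x k f)
  then show ?case
    by (simp add: antipode_mult antipode_x der_mult der_xvar antipode_add der_minus algebra_simps)
qed (simp add: antipode_add der_add)

lemma balanced_antipode:
  assumes "balanced \<beta>"
  shows "balanced (\<lambda>x y. \<beta> (antipode x) y)" "balanced (\<lambda>x y. \<beta> x (antipode y))"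
  by (auto intro!: balancedI simp: balancedD[OF assms] antipode_add antipode_mult antipode_const)

lemma balanced_times: "balanced (\<lambda>x y. x * y)"
  by (rule balancedI) (simp_all add: ring_distribs mult_ac)

lemma coprod_sum_antipode_left: "coprod_sum f (\<lambda>x y. antipode x * y) = const (eval10 f)"
proof (induction f rule: An_generators_induct)
  case (t c a)
  then show ?case
    by (simp add: coprod_sum_t balanced_antipode[OF balanced_times] antipode_mult antipode_const antipode_t
        mult.assoc mon_mult eval10_mon)
next
  case (x k f)
  show ?case
    by (simp add: coprod_sum_x balanced_antipode[OF balanced_times] antipode_mult antipode_x eval10_mult eval10_xvar
        coprod_sum_minus_right mult.left_commute mult.assoc)
qed (simp add: coprod_sum_add balanced_antipode[OF balanced_times] eval10_add const_add)

lemma coprod_sum_antipode_right: "coprod_sum f (\<lambda>x y. x * antipode y) = const (eval10 f)"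
  using coprod_sum_flip[OF balanced_antipode(1)[OF balanced_times], of f] coprod_sum_antipode_left[of f]
  by (simp add: mult.commute)

section \<open>$D_n$-modules with a commuting action of $m_{1,0}\Delta$\<close>

lemma vf_act_axis: "vf_act (axis i f) h = f * der i h"
proof -
  have "vf_act (axis i f) h = (\<Sum>k\<in>UNIV. if k = i then f * der i h else 0)"
    unfolding vf_act_def by (rule sum.cong) (auto simp: axis_def)
  then show ?thesis by simp
qed

lemma vf_bracket_axis:
  "vf_bracket (axis i f) (axis j g) = axis j (f * der i g) - axis i (g * der j f)"
proof -
  have "vf_bracket (axis i f) (axis j g) $ k = f * der i (axis j g $ k) - g * der j (axis i f $ k)" for k
    by (simp add: vf_bracket_def vf_act_axis)
  then show ?thesis by (auto simp: vec_eq_iff axis_def)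
qed

lemma vf_expand: "(\<Sum>i\<in>UNIV. axis i (X $ i)) = X"
  by (simp add: vec_eq_iff axis_def)

lemma axis_linear:
  "axis i (f + g) = axis i f + axis i g" "axis i (f - g) = axis i f - axis i g"
  "axis i (const c * f) = vf_scale c (axis i f)"
  by (simp_all add: vec_eq_iff axis_def vf_scale_def)

text \<open>The projection of $A_n$ to $m_{1,0}$ along the constants.\<close>

abbreviation reduced :: "'n::finite An \<Rightarrow> 'n An" where
  "reduced f \<equiv> f - const (eval10 f)"

locale mDelta_module = lie_module scale vf_scale vf_bracket "mDelta :: 'n::finite vf set" V rho
  for scale :: "complex \<Rightarrow> 'v::ab_group_add \<Rightarrow> 'v" and V and rho :: "'n::finite vf \<Rightarrow> 'v \<Rightarrow> 'v"
begin

lemma axis_mDelta: "f \<in> m10 \<Longrightarrow> axis i f \<in> mDelta"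
  by (simp add: mDelta_def axis_def m10_0)

lemma act_zero_left: "v \<in> V \<Longrightarrow> rho 0 v = 0"
  using act_add_left[of 0 0 v] by (simp add: mDelta_subalgebra)

lemma act_diff_left: "X \<in> mDelta \<Longrightarrow> Y \<in> mDelta \<Longrightarrow> v \<in> V \<Longrightarrow> rho (X - Y) v = rho X v - rho Y v"
  using act_add_left[of "X - Y" Y v] by (simp add: mDelta_def m10_diff)

end

text \<open>A $D_n$-module on the carrier \<open>N\<close> with a commuting action of $m_{1,0}\Delta$. The operator
  \<open>th f i\<close> is the action of $(f - \varepsilon(f)) d_i$; extending it to all $f$ by zero on the constants makes it
  compatible with the comultiplication, and \<open>th_bracket\<close> is the Lie bracket of $m_{1,0}\Delta$ in these terms.\<close>

locale Dn_mDelta_module = vector_space smul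
  for smul :: "complex \<Rightarrow> 'v::ab_group_add \<Rightarrow> 'v" +
  fixes N :: "'v set" and aact :: "'n::finite An \<Rightarrow> 'v \<Rightarrow> 'v" and D :: "'n \<Rightarrow> 'v \<Rightarrow> 'v"
    and th :: "'n An \<Rightarrow> 'n \<Rightarrow> 'v \<Rightarrow> 'v"
  assumes subspace_N: "subspace N"
    and aact_closed: "v \<in> N \<Longrightarrow> aact f v \<in> N"
    and aact_add_left: "v \<in> N \<Longrightarrow> aact (f + g) v = aact f v + aact g v"
    and aact_add_right: "v \<in> N \<Longrightarrow> w \<in> N \<Longrightarrow> aact f (v + w) = aact f v + aact f w"
    and aact_const: "v \<in> N \<Longrightarrow> aact (const c) v = smul c v"
    and aact_mult: "v \<in> N \<Longrightarrow> aact (f * g) v = aact f (aact g v)"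
    and D_closed: "v \<in> N \<Longrightarrow> D i v \<in> N"
    and D_add: "v \<in> N \<Longrightarrow> w \<in> N \<Longrightarrow> D i (v + w) = D i v + D i w"
    and D_commute: "v \<in> N \<Longrightarrow> D i (D j v) = D j (D i v)"
    and D_aact: "v \<in> N \<Longrightarrow> D i (aact f v) = aact f (D i v) + aact (der i f) v"
    and th_closed: "v \<in> N \<Longrightarrow> th f i v \<in> N"
    and th_add_left: "v \<in> N \<Longrightarrow> th (f + g) i v = th f i v + th g i v"
    and th_scale_left: "v \<in> N \<Longrightarrow> th (const c * f) i v = smul c (th f i v)"
    and th_add_right: "v \<in> N \<Longrightarrow> w \<in> N \<Longrightarrow> th f i (v + w) = th f i v + th f i w"
    and th_one: "v \<in> N \<Longrightarrow> th 1 i v = 0"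
    and th_aact: "v \<in> N \<Longrightarrow> th f i (aact g v) = aact g (th f i v)"
    and th_D: "v \<in> N \<Longrightarrow> th f i (D j v) = D j (th f i v)"
    and th_bracket: "v \<in> N \<Longrightarrow> th f i (th g j v) - th g j (th f i v) =
      th ((reduced f) * der i g) j v - th ((reduced g) * der j f) i v"
begin

lemma N_cl: "0 \<in> N" "u \<in> N \<Longrightarrow> v \<in> N \<Longrightarrow> u + v \<in> N" "u \<in> N \<Longrightarrow> v \<in> N \<Longrightarrow> u - v \<in> N" "v \<in> N \<Longrightarrow> smul c v \<in> N"
  using subspace_N by (auto simp: subspace_0 subspace_add subspace_diff subspace_scale)

lemma N_sum: "(\<And>s. s \<in> S \<Longrightarrow> f s \<in> N) \<Longrightarrow> sum f S \<in> N"
  by (rule subspace_sum[OF subspace_N])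

lemma coprod_sum_N: "(\<And>x y. \<beta> x y \<in> N) \<Longrightarrow> coprod_sum f \<beta> \<in> N"
  by (rule coprod_sum_closed[OF N_cl(1,2)])

lemma scale_right:
  assumes "v \<in> N"
  shows "aact f (smul c v) = smul c (aact f v)" "D i (smul c v) = smul c (D i v)" "th f i (smul c v) = smul c (th f i v)"
proof -
  show "aact f (smul c v) = smul c (aact f v)"
    using aact_mult[OF assms, of f "const c"] aact_mult[OF assms, of "const c" f] assms
    by (simp add: mult.commute aact_const aact_closed)
  have "aact 0 w = 0" if "w \<in> N" for w using aact_add_left[OF that, of 0 0] by simp
  then show "D i (smul c v) = smul c (D i v)"
    using D_aact[OF assms, of i "const c"] assms by (simp add: aact_const D_closed)
  show "th f i (smul c v) = smul c (th f i v)"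
    using th_aact[OF assms, of f i "const c"] assms by (simp add: aact_const th_closed)
qed

lemma th_diff_left: "v \<in> N \<Longrightarrow> th (f - g) i v = th f i v - th g i v"
  using th_add_left[of v "f - g" g i] by simp

lemma aact_diff_right: "v \<in> N \<Longrightarrow> w \<in> N \<Longrightarrow> aact f (v - w) = aact f v - aact f w"
  using aact_add_right[of "v - w" w f] N_cl(3)[of v w] by simp

lemma op_zero: "aact f 0 = 0" "D i 0 = 0" "th f i 0 = 0"
  using aact_add_right[of 0 0 f] D_add[of 0 0 i] th_add_right[of 0 0 f i] N_cl(1) by simp_all

lemma zero_left: "v \<in> N \<Longrightarrow> aact 0 v = 0" "v \<in> N \<Longrightarrow> th 0 i v = 0"
  using aact_add_left[of v 0 0] th_add_left[of v 0 0 i] by simp_all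

lemma balanced_action: "v \<in> N \<Longrightarrow> balanced (\<lambda>x y. aact x (th y i v))"
  by (rule balancedI)
    (simp_all add: aact_add_left aact_add_right th_add_left th_scale_left aact_const aact_mult aact_closed th_closed scale_right)

text \<open>The operator by which $f d_i$ acts in the associated $(A_n, g_n)$-module.\<close>

definition op :: "'n An \<Rightarrow> 'n \<Rightarrow> 'v \<Rightarrow> 'v" where
  "op f i v = aact f (D i v) + coprod_sum f (\<lambda>x y. aact x (th y i v))"

definition gop :: "'n vf \<Rightarrow> 'v \<Rightarrow> 'v" where
  "gop X v = (\<Sum>i\<in>UNIV. op (X $ i) i v)"

lemma op_closed: "v \<in> N \<Longrightarrow> op f i v \<in> N"
  by (simp add: op_def N_cl aact_closed D_closed coprod_sum_N th_closed)

lemma op_add_left: "v \<in> N \<Longrightarrow> op (f + g) i v = op f i v + op g i v"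
  by (simp add: op_def aact_add_left D_closed coprod_sum_add balanced_action)

lemma op_diff_left: "v \<in> N \<Longrightarrow> op (f - g) i v = op f i v - op g i v"
  using op_add_left[of v "f - g" g i] by simp

lemma op_add_right: "v \<in> N \<Longrightarrow> w \<in> N \<Longrightarrow> op f i (v + w) = op f i v + op f i w"
  by (simp add: op_def D_add aact_add_right D_closed th_add_right th_closed coprod_sum_add_right)

lemma op_zero_left: "v \<in> N \<Longrightarrow> op 0 i v = 0"
  by (simp add: op_def zero_left D_closed)

lemma op_scale:
  assumes "v \<in> N"
  shows "op (const c * f) i v = smul c (op f i v)" "op f i (smul c v) = smul c (op f i v)"
proof -
  have s: "smul c (coprod_sum f (\<lambda>x y. aact x (th y i v))) = coprod_sum f (\<lambda>x y. smul c (aact x (th y i v)))"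
    by (rule coprod_sum_hom[where N = UNIV]) (simp_all add: scale_right_distrib)
  show "op (const c * f) i v = smul c (op f i v)"
    using assms by (simp add: op_def scale_right_distrib s coprod_sum_const_mult balanced_action aact_mult D_closed
        th_closed aact_const aact_closed)
  show "op f i (smul c v) = smul c (op f i v)"
    using assms by (simp add: op_def scale_right_distrib s scale_right D_closed th_closed)
qed

lemma op_aact:
  assumes "v \<in> N"
  shows "op f i (aact g v) = aact g (op f i v) + aact (f * der i g) v"
proof -
  have "aact g (coprod_sum f (\<lambda>x y. aact x (th y i v))) = coprod_sum f (\<lambda>x y. aact g (aact x (th y i v)))"
    using assms by (intro coprod_sum_hom[OF N_cl(1,2)]) (simp_all add: aact_add_right aact_closed th_closed)
  moreover have "aact x (aact g w) = aact g (aact x w)" if "w \<in> N" for x w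
    using aact_mult[OF that, of x g] aact_mult[OF that, of g x] by (simp add: mult.commute)
  ultimately show ?thesis
    using assms by (simp add: op_def D_aact aact_add_right th_aact D_closed th_closed aact_closed coprod_sum_N aact_mult add_ac)
qed

text \<open>In the product of the two operators the terms with two factors \<open>th\<close> combine to the comultiplication of
  $f d_i(g)$ and $g d_j(f)$, because the comultiplication is multiplicative and the derivations are invariant. The terms
  with $\varepsilon$ in \<open>th_bracket\<close> are contracted by the counit, and they cancel those in which $d_i$ or $d_j$
  differentiates a coefficient function.\<close>

lemma op_bracket:
  assumes v: "v \<in> N"
  shows "op f i (op g j v) - op g j (op f i v) = op (f * der i g) j v - op (g * der j f) i v"
proof -
  note cl = v aact_closed D_closed th_closed coprod_sum_N
  have ac: "aact x (aact y w) = aact (x * y) w" if "w \<in> N" for x y w using that by (simp add: aact_mult)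
  have e: "op f i (op g j v) = aact (f * g) (D i (D j v)) + aact (f * der i g) (D j v)
      + coprod_sum g (\<lambda>z w. aact (f * der i z) (th w j v)) + coprod_sum g (\<lambda>z w. aact (f * z) (th w j (D i v)))
      + coprod_sum f (\<lambda>x y. aact (x * g) (th y i (D j v)))
      + coprod_sum f (\<lambda>x y. coprod_sum g (\<lambda>z w. aact (x * z) (th y i (th w j v))))" for f g i j
  proof -
    let ?s = "coprod_sum g (\<lambda>z w. aact z (th w j v))"
    have 1: "aact f (D i ?s) = coprod_sum g (\<lambda>z w. aact f (D i (aact z (th w j v))))"
      using v by (intro coprod_sum_hom[OF N_cl(1,2)]) (simp_all add: cl D_add aact_add_right)
    have 2: "aact x (th y i ?s) = coprod_sum g (\<lambda>z w. aact x (th y i (aact z (th w j v))))" for x y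
      using v by (intro coprod_sum_hom[OF N_cl(1,2)]) (simp_all add: cl th_add_right aact_add_right)
    have "op f i (op g j v) = aact f (D i (aact g (D j v))) + aact f (D i ?s)
        + coprod_sum f (\<lambda>x y. aact x (th y i (aact g (D j v)))) + coprod_sum f (\<lambda>x y. aact x (th y i ?s))"
      unfolding op_def using v by (simp add: D_add aact_add_right th_add_right coprod_sum_add_right cl)
    also have "\<dots> = aact f (aact g (D i (D j v)) + aact (der i g) (D j v))
        + coprod_sum g (\<lambda>z w. aact f (aact (der i z) (th w j v)) + aact f (aact z (th w j (D i v))))
        + coprod_sum f (\<lambda>x y. aact x (aact g (th y i (D j v))))
        + coprod_sum f (\<lambda>x y. coprod_sum g (\<lambda>z w. aact x (aact z (th y i (th w j v)))))"
      unfolding 1 2 using v by (simp add: D_aact th_aact th_D aact_add_right cl add.commute)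
    finally show ?thesis
      using v by (simp add: ac cl aact_add_right coprod_sum_add_right add_ac)
  qed
  have tb: "coprod_sum f (\<lambda>x y. coprod_sum g (\<lambda>z w. aact (x * z) (th y i (th w j v)))) -
      coprod_sum g (\<lambda>x y. coprod_sum f (\<lambda>z w. aact (x * z) (th y j (th w i v)))) =
      (coprod_sum (f * der i g) (\<lambda>x y. aact x (th y j v)) - coprod_sum g (\<lambda>z w. aact (f * der i z) (th w j v))) -
      (coprod_sum (g * der j f) (\<lambda>x y. aact x (th y i v)) - coprod_sum f (\<lambda>x y. aact (g * der j x) (th y i v)))"
  proof -
    have half: "coprod_sum f (\<lambda>x y. coprod_sum g (\<lambda>z w. aact (x * z) (th ((reduced y) * der i w) j v))) =
       coprod_sum (f * der i g) (\<lambda>x y. aact x (th y j v)) - coprod_sum g (\<lambda>z w. aact (f * der i z) (th w j v))" for f g i j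
    proof -
      have m: "coprod_sum (f * der i g) (\<lambda>x y. aact x (th y j v)) = coprod_sum f (\<lambda>x y. coprod_sum g (\<lambda>z w. aact (x * z) (th (y * der i w) j v)))"
      proof -
        have b: "balanced (\<lambda>z w. aact (x * z) (th (y * w) j v))" for x y
          by (rule balanced_compose(7)[OF balanced_action[OF v]])
        show ?thesis by (simp add: coprod_sum_mult balanced_action v coprod_sum_der_right[OF b])
      qed
      have c: "coprod_sum f (\<lambda>x y. coprod_sum g (\<lambda>z w. aact (x * z) (th (const (eval10 y) * der i w) j v))) =
          coprod_sum g (\<lambda>z w. aact (f * der i z) (th w j v))"
      proof -
        have "coprod_sum f (\<lambda>x y. coprod_sum g (\<lambda>z w. aact (x * z) (th (const (eval10 y) * der i w) j v))) =
          coprod_sum g (\<lambda>z w. coprod_sum f (\<lambda>x y. aact ((const (eval10 y) * x) * z) (th (der i w) j v)))"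
          by (subst coprod_sum_swap) (simp add: balancedD(3)[OF balanced_compose(3)[OF balanced_action[OF v]], symmetric])
        also have "\<dots> = coprod_sum g (\<lambda>z w. aact (f * z) (th (der i w) j v))"
          by (subst coprod_sum_counit_right) (simp_all add: ring_distribs aact_add_left cl)
        also have "\<dots> = coprod_sum g (\<lambda>z w. aact (f * der i z) (th w j v))"
          using coprod_sum_der_right[OF balanced_compose(1)[OF balanced_action[OF v]], of i g f]
            coprod_sum_der_left[OF balanced_compose(1)[OF balanced_action[OF v]], of i g f] by simp
        finally show ?thesis .
      qed
      show ?thesis
        unfolding m c[symmetric] coprod_sum_diff_right[symmetric]
        by (simp add: left_diff_distrib th_diff_left v aact_diff_right cl)
    qed
    have "coprod_sum g (\<lambda>x y. coprod_sum f (\<lambda>z w. aact (x * z) (th y j (th w i v)))) =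
      coprod_sum f (\<lambda>x y. coprod_sum g (\<lambda>z w. aact (x * z) (th w j (th y i v))))"
      by (subst coprod_sum_swap) (simp add: mult.commute)
    then have "coprod_sum f (\<lambda>x y. coprod_sum g (\<lambda>z w. aact (x * z) (th y i (th w j v)))) -
      coprod_sum g (\<lambda>x y. coprod_sum f (\<lambda>z w. aact (x * z) (th y j (th w i v)))) =
      coprod_sum f (\<lambda>x y. coprod_sum g (\<lambda>z w. aact (x * z) (th y i (th w j v) - th w j (th y i v))))"
      by (simp add: coprod_sum_diff_right[symmetric] aact_diff_right cl)
    also have "\<dots> = coprod_sum f (\<lambda>x y. coprod_sum g (\<lambda>z w. aact (x * z) (th ((reduced y) * der i w) j v)))
        - coprod_sum f (\<lambda>x y. coprod_sum g (\<lambda>z w. aact (x * z) (th ((reduced w) * der j y) i v)))"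
      by (simp add: th_bracket aact_diff_right cl coprod_sum_diff_right)
    also have "coprod_sum f (\<lambda>x y. coprod_sum g (\<lambda>z w. aact (x * z) (th ((reduced w) * der j y) i v))) =
        coprod_sum g (\<lambda>x y. coprod_sum f (\<lambda>z w. aact (x * z) (th ((reduced y) * der j w) i v)))"
      by (subst coprod_sum_swap) (simp add: mult.commute)
    finally show ?thesis unfolding half .
  qed
  have sw: "coprod_sum f (\<lambda>x y. aact (x * g) (th y i (D j v))) = coprod_sum f (\<lambda>x y. aact (g * x) (th y i (D j v)))" for f g i j
    by (simp only: mult.commute)
  show ?thesis
    unfolding e op_def[of "f * der i g"] op_def[of "g * der j f"]
    using tb D_commute[OF v, of i j] sw[of f g i j] sw[of g f j i]
    by (simp only: mult.commute[of g f]) (simp add: algebra_simps)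
qed

lemma op_sum_left: "v \<in> N \<Longrightarrow> op (sum f S) i v = (\<Sum>s\<in>S. op (f s) i v)"
  by (induction S rule: infinite_finite_induct) (simp_all add: op_zero_left op_add_left)

lemma op_sum_right: "(\<And>s. s \<in> S \<Longrightarrow> w s \<in> N) \<Longrightarrow> op f i (sum w S) = (\<Sum>s\<in>S. op f i (w s))"
proof (induction S rule: infinite_finite_induct)
  case (insert s S)
  then show ?case by (simp add: op_add_right N_sum)
qed (simp_all add: op_def op_zero)

lemma gop_axis: "v \<in> N \<Longrightarrow> gop (axis i f) v = op f i v"
proof -
  assume v: "v \<in> N"
  have "gop (axis i f) v = (\<Sum>j\<in>UNIV. if j = i then op f i v else 0)"
    unfolding gop_def by (rule sum.cong) (auto simp: axis_def op_zero_left v)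
  then show ?thesis by simp
qed

lemma gop_axis_1: "v \<in> N \<Longrightarrow> gop (axis i 1) v = D i v"
proof -
  assume v: "v \<in> N"
  have "mon 0 0 = (1 :: 'n An)" by simp
  then have "coprod_sum 1 (\<lambda>x y. aact x (th y i v)) = aact 1 (th 1 i v)"
    using coprod_sum_t[OF balanced_action[OF v], of 1 0 i] by simp
  then show ?thesis
    using v aact_const[of _ 1] by (simp add: gop_axis op_def th_one op_zero D_closed)
qed

lemma AG_module_gop: "AG_module smul N aact gop"
proof unfold_locales
  show "gop (X + Y) v = gop X v + gop Y v" if "v \<in> N" for X Y v
    using that by (simp add: gop_def op_add_left sum.distrib)
  show "gop (vf_scale c X) v = smul c (gop X v)" if "v \<in> N" for c X v
    using that by (simp add: gop_def vf_scale_def op_scale scale_sum_right)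
  show "gop X (v + w) = gop X v + gop X w" if "v \<in> N" "w \<in> N" for X v w
    using that by (simp add: gop_def op_add_right sum.distrib)
  show "gop X (smul c v) = smul c (gop X v)" if "v \<in> N" for c X v
    using that by (simp add: gop_def op_scale scale_sum_right)
  show "gop X (aact f v) - aact f (gop X v) = aact (vf_act X f) v" if v: "v \<in> N" for X f v
  proof -
    have s: "aact g (sum w S) = (\<Sum>s\<in>S. aact g (w s))" if "\<And>s. w s \<in> N" for g w and S :: "'n set"
      using that by (induction S rule: infinite_finite_induct) (simp_all add: op_zero aact_add_right N_sum)
    have t: "aact (sum g S) v = (\<Sum>s\<in>S. aact (g s) v)" for g and S :: "'n set"
      by (induction S rule: infinite_finite_induct) (simp_all add: zero_left aact_add_left v)
    show ?thesis using v by (simp add: gop_def op_aact s op_closed vf_act_def t sum.distrib)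
  qed
  show "gop (vf_bracket X Y) v = gop X (gop Y v) - gop Y (gop X v)" if v: "v \<in> N" for X Y v
  proof -
    have e: "gop X (gop Y v) = (\<Sum>i\<in>UNIV. \<Sum>j\<in>UNIV. op (X $ i) i (op (Y $ j) j v))" for X Y
      using v by (simp add: gop_def op_sum_right op_closed)
    have "gop X (gop Y v) - gop Y (gop X v) =
        (\<Sum>i\<in>UNIV. \<Sum>j\<in>UNIV. op (X $ i) i (op (Y $ j) j v) - op (Y $ j) j (op (X $ i) i v))"
      unfolding e[of X Y] e[of Y X] by (subst (2) sum.swap) (simp add: sum_subtractf)
    also have "\<dots> = (\<Sum>i\<in>UNIV. \<Sum>j\<in>UNIV. op (X $ i * der i (Y $ j)) j v) -
        (\<Sum>i\<in>UNIV. \<Sum>j\<in>UNIV. op (Y $ j * der j (X $ i)) i v)"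
      using v by (simp add: op_bracket sum_subtractf)
    also have "(\<Sum>i\<in>UNIV. \<Sum>j\<in>UNIV. op (X $ i * der i (Y $ j)) j v) =
        (\<Sum>j\<in>UNIV. \<Sum>i\<in>UNIV. op (X $ i * der i (Y $ j)) j v)"
      by (rule sum.swap)
    finally show ?thesis
      unfolding gop_def[of "vf_bracket X Y"] using v
      by (simp add: vf_bracket_def vf_act_def op_diff_left op_sum_left sum_subtractf)
  qed
qed (simp_all add: subspace_N gop_def N_sum op_closed aact_closed aact_add_left aact_add_right aact_const aact_mult)

text \<open>The coefficients of a vector field in $m_{1,0}\Delta$ vanish at $(1,0)$, so this is its action.\<close>

definition theta :: "'n vf \<Rightarrow> 'v \<Rightarrow> 'v" where
  "theta X v = (\<Sum>i\<in>UNIV. th (X $ i) i v)"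

lemma th_sum_left: "v \<in> N \<Longrightarrow> th (sum f S) i v = (\<Sum>s\<in>S. th (f s) i v)"
  by (induction S rule: infinite_finite_induct) (simp_all add: zero_left th_add_left)

lemma th_sum_right: "(\<And>s. s \<in> S \<Longrightarrow> w s \<in> N) \<Longrightarrow> th f i (sum w S) = (\<Sum>s\<in>S. th f i (w s))"
proof (induction S rule: infinite_finite_induct)
  case (insert s S)
  then show ?case by (simp add: th_add_right N_sum)
qed (simp_all add: op_zero)

lemma theta_axis: "v \<in> N \<Longrightarrow> theta (axis i f) v = th f i v"
proof -
  assume v: "v \<in> N"
  have "theta (axis i f) v = (\<Sum>j\<in>UNIV. if j = i then th f i v else 0)"
    unfolding theta_def by (rule sum.cong) (auto simp: axis_def zero_left v)
  then show ?thesis by simp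
qed

lemma lie_module_theta:
  assumes W: "subspace W" "W \<subseteq> N" and closed: "\<And>f i w. w \<in> W \<Longrightarrow> th f i w \<in> W"
  shows "lie_module smul vf_scale vf_bracket mDelta W theta"
proof unfold_locales
  have WN: "w \<in> N" if "w \<in> W" for w using that W(2) by blast
  show "theta X v \<in> W" if "v \<in> W" for X v
    unfolding theta_def by (intro subspace_sum[OF W(1)] closed that)
  show "theta (X + Y) v = theta X v + theta Y v" if "v \<in> W" for X Y v
    using WN[OF that] by (simp add: theta_def th_add_left sum.distrib)
  show "theta (vf_scale c X) v = smul c (theta X v)" if "v \<in> W" for c X v
    using WN[OF that] by (simp add: theta_def vf_scale_def th_scale_left scale_sum_right)
  show "theta X (v + w) = theta X v + theta X w" if "v \<in> W" "w \<in> W" for X v w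
    using WN[OF that(1)] WN[OF that(2)] by (simp add: theta_def th_add_right sum.distrib)
  show "theta X (smul c v) = smul c (theta X v)" if "v \<in> W" for c X v
    using WN[OF that] by (simp add: theta_def scale_right scale_sum_right)
  show "theta (vf_bracket X Y) v = theta X (theta Y v) - theta Y (theta X v)"
    if XY: "X \<in> mDelta" "Y \<in> mDelta" and "v \<in> W" for X Y v
  proof -
    have v: "v \<in> N" by (rule WN[OF \<open>v \<in> W\<close>])
    have z: "eval10 (X $ i) = 0" "eval10 (Y $ i) = 0" for i using XY by (simp_all add: mDelta_def m10_eq)
    have e: "theta X (theta Y v) = (\<Sum>i\<in>UNIV. \<Sum>j\<in>UNIV. th (X $ i) i (th (Y $ j) j v))" for X Y
      using v by (simp add: theta_def th_sum_right th_closed)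
    have "theta X (theta Y v) - theta Y (theta X v) =
        (\<Sum>i\<in>UNIV. \<Sum>j\<in>UNIV. th (X $ i) i (th (Y $ j) j v) - th (Y $ j) j (th (X $ i) i v))"
      unfolding e[of X Y] e[of Y X] by (subst (2) sum.swap) (simp add: sum_subtractf)
    also have "\<dots> = (\<Sum>i\<in>UNIV. \<Sum>j\<in>UNIV. th (X $ i * der i (Y $ j)) j v) -
        (\<Sum>i\<in>UNIV. \<Sum>j\<in>UNIV. th (Y $ j * der j (X $ i)) i v)"
      using v by (simp add: th_bracket z sum_subtractf)
    also have "(\<Sum>i\<in>UNIV. \<Sum>j\<in>UNIV. th (X $ i * der i (Y $ j)) j v) =
        (\<Sum>j\<in>UNIV. \<Sum>i\<in>UNIV. th (X $ i * der i (Y $ j)) j v)"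
      by (rule sum.swap)
    finally show ?thesis
      unfolding theta_def[of "vf_bracket X Y"] using v
      by (simp add: vf_bracket_def vf_act_def th_diff_left th_sum_left sum_subtractf)
  qed
qed (rule W(1))

end

section \<open>Splitting off the $m_{1,0}\Delta$-action\<close>

context AG_module
begin

definition ga :: "'n An \<Rightarrow> 'n \<Rightarrow> 'v \<Rightarrow> 'v" where
  "ga f i v = gact (axis i f) v"

text \<open>The convolution $S(f_1) (f_2 d_i)$, which inverts $f \mapsto f_1 \theta(f_2 d_i)$. The normalization \<open>th\<close> makes it
  vanish on constants.\<close>

definition conv :: "'n An \<Rightarrow> 'n \<Rightarrow> 'v \<Rightarrow> 'v" where
  "conv f i v = coprod_sum f (\<lambda>x y. aact (antipode x) (ga y i v))"

definition th :: "'n An \<Rightarrow> 'n \<Rightarrow> 'v \<Rightarrow> 'v" where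
  "th f i v = conv f i v - smul (eval10 f) (ga 1 i v)"

lemma M_cl: "0 \<in> M" "u \<in> M \<Longrightarrow> v \<in> M \<Longrightarrow> u + v \<in> M" "u \<in> M \<Longrightarrow> v \<in> M \<Longrightarrow> u - v \<in> M" "v \<in> M \<Longrightarrow> smul c v \<in> M"
  using subspace_V by (auto simp: subspace_0 subspace_add subspace_diff subspace_scale)

lemma ga_closed: "v \<in> M \<Longrightarrow> ga f i v \<in> M"
  by (simp add: ga_def act_closed)

lemma ga_linear:
  "v \<in> M \<Longrightarrow> ga (f + g) i v = ga f i v + ga g i v"
  "v \<in> M \<Longrightarrow> ga (const c * f) i v = smul c (ga f i v)"
  "v \<in> M \<Longrightarrow> w \<in> M \<Longrightarrow> ga f i (v + w) = ga f i v + ga f i w"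
  "v \<in> M \<Longrightarrow> ga f i (smul c v) = smul c (ga f i v)"
  by (simp_all add: ga_def axis_linear act_add_left act_scale_left act_add_right act_scale_right)

lemma ga_diff:
  "v \<in> M \<Longrightarrow> ga (f - g) i v = ga f i v - ga g i v"
  "v \<in> M \<Longrightarrow> w \<in> M \<Longrightarrow> ga f i (v - w) = ga f i v - ga f i w"
  using ga_linear(1)[of v "f - g" g i] ga_linear(3)[of "v - w" w f i] M_cl(3)[of v w] by simp_all

lemma ga_0: "v \<in> M \<Longrightarrow> ga 0 i v = 0"
  using ga_linear(1)[of v 0 0 i] by simp

lemma aact_diff:
  "v \<in> M \<Longrightarrow> aact (f - g) v = aact f v - aact g v"
  "v \<in> M \<Longrightarrow> w \<in> M \<Longrightarrow> aact f (v - w) = aact f v - aact f w"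
  using aact_add_left[of v "f - g" g] aact_add_right[of "v - w" w f] M_cl(3)[of v w] by simp_all

lemma aact_zero: "v \<in> M \<Longrightarrow> aact 0 v = 0" "aact f 0 = 0"
  using aact_add_left[of v 0 0] aact_add_right[of 0 0 f] M_cl(1) by simp_all

lemma aact_minus: "v \<in> M \<Longrightarrow> aact (- f) v = - aact f v"
  using aact_diff(1)[of v 0 f] by (simp add: aact_zero)

lemma aact_scale: "v \<in> M \<Longrightarrow> aact f (smul c v) = smul c (aact f v)"
  using aact_mult[of v f "const c"] aact_mult[of v "const c" f] by (simp add: mult.commute aact_const aact_closed)

lemma ga_aact: "v \<in> M \<Longrightarrow> ga f i (aact g v) = aact g (ga f i v) + aact (f * der i g) v"
  using compat[of v "axis i f" g] by (simp add: ga_def vf_act_axis algebra_simps)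

lemma ga_ga:
  assumes "v \<in> M"
  shows "ga f i (ga g j v) = ga g j (ga f i v) + ga (f * der i g) j v - ga (g * der j f) i v"
proof -
  have "ga f i (ga g j v) - ga g j (ga f i v) = gact (axis j (f * der i g) - axis i (g * der j f)) v"
    using act_bracket[of "axis i f" "axis j g" v] assms by (simp add: ga_def vf_bracket_axis)
  moreover have "gact (X - Y) v = gact X v - gact Y v" for X Y
    using act_add_left[of "X - Y" Y v] assms by simp
  ultimately show ?thesis by (simp add: ga_def algebra_simps)
qed

lemma balanced_ga: "v \<in> M \<Longrightarrow> balanced (\<lambda>x y. aact x (ga y i v))"
  by (rule balancedI)
    (simp_all add: aact_add_left aact_add_right ga_linear aact_mult aact_const aact_scale ga_closed aact_closed)

lemma balanced_conv: "v \<in> M \<Longrightarrow> balanced (\<lambda>x y. aact (antipode x) (ga y i v))"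
  by (rule balanced_antipode[OF balanced_ga])

lemma coprod_sum_M: "(\<And>x y. \<beta> x y \<in> M) \<Longrightarrow> coprod_sum f \<beta> \<in> M"
  by (rule coprod_sum_closed[OF M_cl(1,2)])

lemma conv_closed: "v \<in> M \<Longrightarrow> conv f i v \<in> M"
  by (simp add: conv_def coprod_sum_M aact_closed ga_closed)

lemma conv_add_left: "v \<in> M \<Longrightarrow> conv (f + g) i v = conv f i v + conv g i v"
  by (simp add: conv_def coprod_sum_add balanced_conv)

lemma conv_scale_left:
  assumes v: "v \<in> M"
  shows "conv (const c * f) i v = smul c (conv f i v)"
proof -
  have "smul c (conv f i v) = coprod_sum f (\<lambda>x y. smul c (aact (antipode x) (ga y i v)))"
    unfolding conv_def by (rule coprod_sum_hom[where N = UNIV]) (simp_all add: scale_right_distrib)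
  then show ?thesis
    using v by (simp add: conv_def coprod_sum_const_mult balanced_conv antipode_mult antipode_const aact_mult aact_const
        ga_closed aact_closed)
qed

lemma conv_add_right: "v \<in> M \<Longrightarrow> w \<in> M \<Longrightarrow> conv f i (v + w) = conv f i v + conv f i w"
  by (simp add: conv_def ga_linear aact_add_right ga_closed coprod_sum_add_right)

lemma conv_diff_left: "v \<in> M \<Longrightarrow> conv (f - g) i v = conv f i v - conv g i v"
  using conv_add_left[of v "f - g" g i] by simp

text \<open>Commuting past \<open>g\<close> produces $S(f_1) f_2 d_i(g) = \varepsilon(f) d_i(g)$, the term that the normalization of \<open>th\<close> removes.\<close>

lemma conv_aact:
  assumes v: "v \<in> M"
  shows "conv f i (aact g v) = aact g (conv f i v) + smul (eval10 f) (aact (der i g) v)"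
proof -
  have 1: "aact g (conv f i v) = coprod_sum f (\<lambda>x y. aact g (aact (antipode x) (ga y i v)))"
    unfolding conv_def using v
    by (intro coprod_sum_hom[OF M_cl(1,2)]) (simp_all add: aact_add_right aact_closed ga_closed)
  have 2: "coprod_sum f (\<lambda>x y. aact (antipode x * y) (aact (der i g) v)) = aact (const (eval10 f)) (aact (der i g) v)"
    unfolding coprod_sum_antipode_left[symmetric] using v
    by (intro coprod_sum_hom[where N = UNIV, symmetric]) (simp_all add: aact_add_left aact_closed)
  have 3: "aact (antipode x) (ga y i (aact g v)) =
      aact g (aact (antipode x) (ga y i v)) + aact (antipode x * y) (aact (der i g) v)" for x y
  proof -
    have "aact (antipode x) (aact g w) = aact g (aact (antipode x) w)" if "w \<in> M" for w
      using aact_mult[OF that, of "antipode x" g] aact_mult[OF that, of g "antipode x"] by (simp add: mult.commute)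
    then show ?thesis using v by (simp add: ga_aact aact_add_right ga_closed aact_closed aact_mult)
  qed
  show ?thesis
    unfolding conv_def[of f i "aact g v"] 3 coprod_sum_add_right 1 2 using v by (simp add: aact_const aact_closed)
qed

text \<open>The two derivatives $S(f_1)(d_j(f_2) d_i)$ and $- S(d_j(f_1))(f_2 d_i)$ cancel, since $d_j$ is invariant.\<close>

lemma conv_D:
  assumes v: "v \<in> M"
  shows "ga 1 j (conv f i v) = conv f i (ga 1 j v)"
proof -
  have pt: "ga 1 j (aact (antipode x) (ga y i v)) = aact (antipode x) (ga y i (ga 1 j v))
      + (aact (antipode x) (ga (der j y) i v) - aact (antipode (der j x)) (ga y i v))" for x y
  proof -
    have "ga 1 j (ga y i v) = ga y i (ga 1 j v) + ga (der j y) i v"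
      using ga_ga[OF v, of 1 j y i] by (simp add: ga_0 v)
    then show ?thesis
      using v by (simp add: ga_aact aact_add_right ga_closed der_antipode aact_minus)
  qed
  have "ga 1 j (conv f i v) = coprod_sum f (\<lambda>x y. ga 1 j (aact (antipode x) (ga y i v)))"
    unfolding conv_def using v
    by (intro coprod_sum_hom[OF M_cl(1,2)]) (simp_all add: ga_linear aact_closed ga_closed)
  also have "\<dots> = coprod_sum f (\<lambda>x y. aact (antipode x) (ga y i (ga 1 j v))
      + (aact (antipode x) (ga (der j y) i v) - aact (antipode (der j x)) (ga y i v)))"
    unfolding pt ..
  also have "coprod_sum f (\<lambda>x y. aact (antipode x) (ga y i (ga 1 j v))
      + (aact (antipode x) (ga (der j y) i v) - aact (antipode (der j x)) (ga y i v))) = conv f i (ga 1 j v)"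
    using coprod_sum_der_right[OF balanced_conv[OF v], of j f i] coprod_sum_der_left[OF balanced_conv[OF v], of j f i]
    by (simp add: coprod_sum_add_right coprod_sum_diff_right conv_def)
  finally show ?thesis .
qed

lemma th_preserves: "v \<in> M \<Longrightarrow> th f i v \<in> M"
  by (simp add: th_def M_cl conv_closed ga_closed)

lemma th_additive: "v \<in> M \<Longrightarrow> w \<in> M \<Longrightarrow> th f i (v + w) = th f i v + th f i w"
  by (simp add: th_def conv_add_right ga_linear algebra_simps)

lemma th_subtractive: "v \<in> M \<Longrightarrow> w \<in> M \<Longrightarrow> th f i (v - w) = th f i v - th f i w"
  using th_additive[of "v - w" w f i] M_cl(3)[of v w] by simp

lemma th_commutes_aact: "v \<in> M \<Longrightarrow> th f i (aact g v) = aact g (th f i v)"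
  by (simp add: th_def conv_aact ga_aact aact_diff aact_scale conv_closed ga_closed M_cl scale_right_distrib)

lemma th_commutes_d: "v \<in> M \<Longrightarrow> th f i (ga 1 j v) = ga 1 j (th f i v)"
  using ga_ga[of v 1 j 1 i] by (simp add: th_def conv_D ga_diff ga_linear ga_0 conv_closed ga_closed M_cl)

text \<open>As \<open>th g j\<close> commutes with $A_n$ and the derivations, its commutator with \<open>th f i\<close> only involves the factors
  $f_2 d_i$, and this commutator is expanded with the bracket of $g_n$.\<close>

lemma th_commutator:
  assumes v: "v \<in> M"
  shows "th f i (th g j v) - th g j (th f i v) =
    th ((reduced f) * der i g) j v - th ((reduced g) * der j f) i v"
proof -
  let ?T = "th g j"
  note cl = v aact_closed ga_closed conv_closed th_preserves M_cl
  have ac: "aact x (aact y w) = aact (x * y) w" if "w \<in> M" for x y w using that by (simp add: aact_mult)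
  have pt: "ga y i (?T v) - ?T (ga y i v) =
      coprod_sum g (\<lambda>z w. aact (y * der i (antipode z)) (ga w j v)) + coprod_sum g (\<lambda>z w. aact (antipode z) (ga (y * der i w) j v))
      - coprod_sum g (\<lambda>z w. aact (antipode z) (ga (w * der j y) i v)) + smul (eval10 g) (ga (der j y) i v)" for y
  proof -
    have "ga y i (conv g j v) - conv g j (ga y i v) =
      coprod_sum g (\<lambda>z w. ga y i (aact (antipode z) (ga w j v)) - aact (antipode z) (ga w j (ga y i v)))"
    proof -
      have "ga y i (conv g j v) = coprod_sum g (\<lambda>z w. ga y i (aact (antipode z) (ga w j v)))"
        unfolding conv_def by (intro coprod_sum_hom[OF M_cl(1,2)]) (simp_all add: cl ga_linear)
      then show ?thesis by (simp add: conv_def coprod_sum_diff_right)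
    qed
    also have "(\<lambda>z w. ga y i (aact (antipode z) (ga w j v)) - aact (antipode z) (ga w j (ga y i v))) =
        (\<lambda>z w. aact (y * der i (antipode z)) (ga w j v) + aact (antipode z) (ga (y * der i w) j v)
          - aact (antipode z) (ga (w * der j y) i v))"
      using ga_ga[OF v, of y i _ j] by (simp add: ga_aact aact_diff aact_add_right cl fun_eq_iff)
    finally have 1: "ga y i (conv g j v) - conv g j (ga y i v) =
      coprod_sum g (\<lambda>z w. aact (y * der i (antipode z)) (ga w j v)) + coprod_sum g (\<lambda>z w. aact (antipode z) (ga (y * der i w) j v))
      - coprod_sum g (\<lambda>z w. aact (antipode z) (ga (w * der j y) i v))"
      by (simp add: coprod_sum_add_right coprod_sum_diff_right)
    have 2: "ga y i (ga 1 j v) = ga 1 j (ga y i v) - ga (der j y) i v"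
      using ga_ga[OF v, of y i 1 j] by (simp add: ga_0 v)
    show ?thesis
      using 1 by (simp add: th_def ga_diff ga_linear cl 2 scale_right_diff_distrib algebra_simps)
  qed
  have "conv f i (?T v) - ?T (conv f i v) = coprod_sum f (\<lambda>x y. aact (antipode x) (ga y i (?T v) - ?T (ga y i v)))"
  proof -
    have "?T (conv f i v) = coprod_sum f (\<lambda>x y. ?T (aact (antipode x) (ga y i v)))"
      unfolding conv_def by (intro coprod_sum_hom[OF M_cl(1,2)]) (simp_all add: cl th_additive)
    then show ?thesis
      by (simp add: conv_def coprod_sum_diff_right[symmetric] th_commutes_aact aact_diff cl)
  qed
  also have "\<dots> = coprod_sum f (\<lambda>x y. aact (antipode x) (coprod_sum g (\<lambda>z w. aact (y * der i (antipode z)) (ga w j v))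
      + coprod_sum g (\<lambda>z w. aact (antipode z) (ga (y * der i w) j v))
      - coprod_sum g (\<lambda>z w. aact (antipode z) (ga (w * der j y) i v)) + smul (eval10 g) (ga (der j y) i v)))"
    unfolding pt ..
  also have "coprod_sum f (\<lambda>x y. aact (antipode x) (coprod_sum g (\<lambda>z w. aact (y * der i (antipode z)) (ga w j v))
      + coprod_sum g (\<lambda>z w. aact (antipode z) (ga (y * der i w) j v))
      - coprod_sum g (\<lambda>z w. aact (antipode z) (ga (w * der j y) i v)) + smul (eval10 g) (ga (der j y) i v))) =
      - smul (eval10 f) (conv (der i g) j v) + conv (f * der i g) j v - conv (g * der j f) i v
      + smul (eval10 g) (conv (der j f) i v)"
  proof -
    have s: "aact u (coprod_sum g \<beta>) = coprod_sum g (\<lambda>z w. aact u (\<beta> z w))" if "\<And>z w. \<beta> z w \<in> M" for u \<beta>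
      using that by (intro coprod_sum_hom[OF M_cl(1,2)]) (simp_all add: aact_add_right)
    have sm: "smul c (coprod_sum h \<beta>) = coprod_sum h (\<lambda>z w. smul c (\<beta> z w))" for c h and \<beta> :: "'n An \<Rightarrow> 'n An \<Rightarrow> 'v"
      by (intro coprod_sum_hom[where N = UNIV]) (simp_all add: scale_right_distrib)
    \<comment> \<open>The antipode contracts \<open>f\<close> to its value at the base point.\<close>
    have t1: "coprod_sum f (\<lambda>x y. coprod_sum g (\<lambda>z w. aact (antipode x) (aact (y * der i (antipode z)) (ga w j v)))) =
        - smul (eval10 f) (conv (der i g) j v)"
    proof -
      have "coprod_sum f (\<lambda>x y. aact (antipode x) (aact (y * u) w)) = smul (eval10 f) (aact u w)" if "w \<in> M" for u w
      proof -
        have "coprod_sum f (\<lambda>x y. aact (antipode x * y) (aact u w)) = aact (const (eval10 f)) (aact u w)"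
          unfolding coprod_sum_antipode_left[symmetric] using that
          by (intro coprod_sum_hom[where N = UNIV, symmetric]) (simp_all add: aact_add_left aact_closed)
        then show ?thesis using that by (simp add: aact_mult aact_const aact_closed)
      qed
      then have "coprod_sum f (\<lambda>x y. coprod_sum g (\<lambda>z w. aact (antipode x) (aact (y * der i (antipode z)) (ga w j v)))) =
          coprod_sum g (\<lambda>z w. smul (eval10 f) (aact (der i (antipode z)) (ga w j v)))"
        by (subst coprod_sum_swap) (simp add: cl)
      also have "\<dots> = - smul (eval10 f) (coprod_sum g (\<lambda>z w. aact (antipode (der i z)) (ga w j v)))"
        by (simp add: sm der_antipode aact_minus cl coprod_sum_minus_right)
      finally show ?thesis
        using coprod_sum_der_left[OF balanced_conv[OF v], of i g j] by (simp add: conv_def)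
    qed
    have t23: "coprod_sum f (\<lambda>x y. coprod_sum g (\<lambda>z w. aact (antipode x) (aact (antipode z) (ga (y * der i w) j v)))) = conv (f * der i g) j v"
      for f g i j
    proof -
      have b: "balanced (\<lambda>z w. aact (antipode (x * z)) (ga (y * w) j v))" for x y
        by (rule balanced_compose(7)[OF balanced_conv[OF v]])
      show ?thesis
        unfolding conv_def coprod_sum_mult[OF balanced_conv[OF v]] coprod_sum_der_right[OF b]
        by (simp add: antipode_mult aact_mult cl)
    qed
    have t3: "coprod_sum f (\<lambda>x y. coprod_sum g (\<lambda>z w. aact (antipode x) (aact (antipode z) (ga (w * der j y) i v)))) = conv (g * der j f) i v"
      unfolding t23[of g f j i, symmetric]
      by (subst coprod_sum_swap) (simp add: ac cl mult.commute)
    have t4: "coprod_sum f (\<lambda>x y. aact (antipode x) (smul (eval10 g) (ga (der j y) i v))) = smul (eval10 g) (conv (der j f) i v)"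
      by (simp add: conv_def coprod_sum_der_right[OF balanced_conv[OF v]] sm aact_scale cl)
    show ?thesis
      by (simp add: aact_add_right aact_diff coprod_sum_M cl s coprod_sum_add_right coprod_sum_diff_right t1 t23 t3 t4)
  qed
  finally have 1: "conv f i (?T v) - ?T (conv f i v) =
      - smul (eval10 f) (conv (der i g) j v) + conv (f * der i g) j v - conv (g * der j f) i v
      + smul (eval10 g) (conv (der j f) i v)" .
  have "th f i (?T v) - ?T (th f i v) = conv f i (?T v) - ?T (conv f i v)"
  proof -
    have "?T (smul c w) = smul c (?T w)" if "w \<in> M" for c w
      using th_commutes_aact[OF that, of g j "const c"] that by (simp add: aact_const th_preserves)
    then show ?thesis
      by (simp add: th_def[of f] th_subtractive cl th_commutes_d)
  qed
  also have "\<dots> = th ((reduced f) * der i g) j v - th ((reduced g) * der j f) i v"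
  proof -
    have "eval10 ((reduced h) * u) = 0" for h u :: "'n An"
      by (simp add: eval10_mult eval10_diff eval10_const)
    then show ?thesis
      unfolding 1 by (simp add: th_def left_diff_distrib conv_diff_left conv_scale_left v)
  qed
  finally show ?thesis .
qed

theorem Dn_mDelta_module_th: "Dn_mDelta_module smul M aact (ga 1) th"
proof unfold_locales
  show "th (f + g) i v = th f i v + th g i v" if "v \<in> M" for f g i v
    using that by (simp add: th_def conv_add_left eval10_add algebra_simps)
  show "th (const c * f) i v = smul c (th f i v)" if "v \<in> M" for c f i v
    using that by (simp add: th_def conv_scale_left eval10_mult eval10_const scale_right_diff_distrib)
  show "th 1 i v = 0" if "v \<in> M" for i v
  proof -
    have "mon 0 0 = (1 :: 'n An)" by simp
    then have "conv 1 i v = ga 1 i v"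
      using coprod_sum_t[OF balanced_conv[OF that], of 1 0 i] aact_const[of "ga 1 i v" 1] that
      by (simp add: conv_def ga_closed)
    then show ?thesis by (simp add: th_def)
  qed
  show "ga 1 i (aact f v) = aact f (ga 1 i v) + aact (der i f) v" if "v \<in> M" for i f v
    using ga_aact[OF that, of 1 i f] by simp
  show "ga 1 i (ga 1 j v) = ga 1 j (ga 1 i v)" if "v \<in> M" for i j v
    using ga_ga[OF that, of 1 i 1 j] that by (simp add: ga_0)
qed (simp_all add: subspace_V aact_closed aact_add_left aact_add_right aact_const aact_mult ga_closed ga_linear
    th_preserves th_additive th_commutes_aact th_commutes_d th_commutator)

text \<open>By coassociativity $f_1 S(f_2) (f_3 d_i) = f d_i$, and the normalization contributes $- f \cdot d_i$.\<close>

lemma gop_eq_gact: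
  assumes v: "v \<in> M"
  shows "Dn_mDelta_module.gop aact (ga 1) th X v = gact X v"
proof -
  interpret D: Dn_mDelta_module smul M aact "ga 1" th by (rule Dn_mDelta_module_th)
  have "D.op f i v = ga f i v" for f i
  proof -
    note cl = v aact_closed ga_closed conv_closed M_cl
    have c: "coprod_sum f (\<lambda>x y. aact x (conv y i v)) = ga f i v"
    proof -
      have b: "balanced (\<lambda>x y. aact z (aact (antipode x) (ga y i v)))" for z
        by (rule balancedI)
          (simp_all add: antipode_add antipode_mult antipode_const ga_linear aact_add_left aact_add_right cl aact_mult aact_const aact_scale)
      have b': "balanced (\<lambda>x y. aact x (aact (antipode y) (ga z i v)))" for z
        by (rule balancedI)
          (simp_all add: antipode_add antipode_mult antipode_const ga_linear aact_add_left aact_add_right cl aact_mult aact_const aact_scale)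
      have "coprod_sum f (\<lambda>x y. aact x (conv y i v)) = coprod_sum f (\<lambda>x y. coprod_sum y (\<lambda>z w. aact x (aact (antipode z) (ga w i v))))"
      proof -
        have "aact x (conv y i v) = coprod_sum y (\<lambda>z w. aact x (aact (antipode z) (ga w i v)))" for x y
          unfolding conv_def by (intro coprod_sum_hom[OF M_cl(1,2)]) (simp_all add: cl aact_add_right)
        then show ?thesis by simp
      qed
      also have "\<dots> = coprod_sum f (\<lambda>x y. coprod_sum x (\<lambda>z w. aact z (aact (antipode w) (ga y i v))))"
        by (rule coprod_sum_coassoc[symmetric]) (rule b b')+
      also have "\<dots> = coprod_sum f (\<lambda>x y. ga (const (eval10 x) * y) i v)"
      proof -
        have "coprod_sum x (\<lambda>z w. aact z (aact (antipode w) u)) = smul (eval10 x) u" if "u \<in> M" for x u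
        proof -
          have "coprod_sum x (\<lambda>z w. aact (z * antipode w) u) = aact (const (eval10 x)) u"
            unfolding coprod_sum_antipode_right[symmetric] using that
            by (intro coprod_sum_hom[where N = UNIV, symmetric]) (simp_all add: aact_add_left)
          then show ?thesis using that by (simp add: aact_mult aact_const)
        qed
        then show ?thesis by (simp add: ga_linear cl)
      qed
      also have "\<dots> = ga f i v"
        by (rule coprod_sum_counit_left) (simp add: ga_linear v)
      finally show ?thesis .
    qed
    have c': "coprod_sum f (\<lambda>x y. aact x (smul (eval10 y) (ga 1 i v))) = aact f (ga 1 i v)"
    proof -
      have "coprod_sum f (\<lambda>x y. aact (const (eval10 y) * x) (ga 1 i v)) = aact f (ga 1 i v)"
        by (rule coprod_sum_counit_right) (simp add: aact_add_left cl)
      then show ?thesis by (simp add: aact_mult aact_const aact_scale cl)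
    qed
    show ?thesis
      by (simp add: D.op_def th_def aact_diff cl coprod_sum_diff_right c c')
  qed
  moreover have "gact X v = (\<Sum>i\<in>UNIV. ga (X $ i) i v)"
  proof -
    have "gact (sum Z S) v = (\<Sum>s\<in>S. gact (Z s) v)" for Z and S :: "'n set"
    proof (induction S rule: infinite_finite_induct)
      case (insert s S)
      then show ?case by (simp add: act_add_left v)
    qed (use act_add_left[of 0 0 v] v in simp_all)
    then show ?thesis using vf_expand[of X] unfolding ga_def by metis
  qed
  ultimately show ?thesis by (simp add: D.gop_def)
qed

end

section \<open>The tensor modules\<close>

lemma An_sum_monomials:
  "(\<Sum>u\<in>keys f. const (lookup f u) * mon (fst u) (snd u)) = f"
  by (rule poly_mapping_eqI)
    (simp add: const_def mon_def mult_single lookup_sum lookup_single when_def in_keys_iff)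

lemma eval10_mon_1: "eval10 (mon a m) = (if m = 0 then 1 else 0)"
  using eval10_mon[of 1 a m] unfolding const_1 mult_1_left .

lemma const_if: "const (if P then 1 else 0) = (if P then 1 else 0)"
  by simp

lemma T_spaceD: "z \<in> T_space V \<Longrightarrow> lookup z b \<in> V"
  unfolding T_space_def by blast

locale tensor_setting = mDelta_module scale V rho
  for scale :: "complex \<Rightarrow> 'v::ab_group_add \<Rightarrow> 'v" and V and rho :: "'n::finite vf \<Rightarrow> 'v \<Rightarrow> 'v" +
  fixes lam :: "complex^'n"
begin

definition lin_ext :: "('b \<Rightarrow> 'v \<Rightarrow> 'w::ab_group_add) \<Rightarrow> ('b \<Rightarrow>\<^sub>0 'v) \<Rightarrow> 'w" where
  "lin_ext h z = (\<Sum>b\<in>keys z. h b (lookup z b))"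

definition T_d :: "'n \<Rightarrow> ('n exponent \<Rightarrow>\<^sub>0 'v) \<Rightarrow> ('n exponent \<Rightarrow>\<^sub>0 'v)" where
  "T_d i = lin_ext (\<lambda>b v. tensor scale (Alam_d lam i (single b 1)) v)"

definition T_th :: "'n An \<Rightarrow> 'n \<Rightarrow> ('n exponent \<Rightarrow>\<^sub>0 'v) \<Rightarrow> ('n exponent \<Rightarrow>\<^sub>0 'v)" where
  "T_th f i = lin_ext (\<lambda>b v. single b (rho (axis i (reduced f)) v))"

lemma V_cl: "0 \<in> V" "u \<in> V \<Longrightarrow> v \<in> V \<Longrightarrow> u + v \<in> V" "v \<in> V \<Longrightarrow> scale c v \<in> V"
  using subspace_V by (auto simp: subspace_0 subspace_add subspace_scale)

lemma T_space_cl: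
  "0 \<in> T_space V" "y \<in> T_space V \<Longrightarrow> z \<in> T_space V \<Longrightarrow> y + z \<in> T_space V"
  "z \<in> T_space V \<Longrightarrow> T_scale scale c z \<in> T_space V" "v \<in> V \<Longrightarrow> tensor scale p v \<in> T_space V"
  "v \<in> V \<Longrightarrow> single b v \<in> T_space V"
  by (auto simp: T_space_def lookup_add V_cl lookup_single when_def)

lemma tensor_0: "tensor scale p 0 = 0"
  by (rule poly_mapping_eqI) simp

lemma T_space_sum: "(\<And>s. s \<in> S \<Longrightarrow> f s \<in> T_space V) \<Longrightarrow> sum f S \<in> T_space V"
  by (induction S rule: infinite_finite_induct) (simp_all add: T_space_cl)

text \<open>The elements $p \otimes v$ generate the tensor product additively.\<close>

lemma T_space_induct [consumes 1, case_names tensor add]: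
  assumes "z \<in> T_space V"
    and t: "\<And>p v. v \<in> V \<Longrightarrow> P (tensor scale p v)"
    and add: "\<And>y z. y \<in> T_space V \<Longrightarrow> z \<in> T_space V \<Longrightarrow> P y \<Longrightarrow> P z \<Longrightarrow> P (y + z)"
  shows "P z"
proof -
  have zb: "lookup z b \<in> V" for b using assms(1) by (rule T_spaceD)
  have P0: "P 0" using t[OF V_cl(1), of 0] by (simp add: tensor_0)
  have "(\<Sum>b\<in>S. tensor scale (single b 1) (lookup z b)) \<in> T_space V \<and>
      P (\<Sum>b\<in>S. tensor scale (single b 1) (lookup z b))" for S
    by (induction S rule: infinite_finite_induct) (simp_all add: T_space_cl P0 zb t add)
  then show ?thesis using tensor_expand[of z] by metis
qed

lemma lin_ext_add:
  assumes h: "\<And>b u v. u \<in> V \<Longrightarrow> v \<in> V \<Longrightarrow> h b (u + v) = h b u + h b v"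
    and "y \<in> T_space V" "z \<in> T_space V"
  shows "lin_ext h (y + z) = lin_ext h y + lin_ext h z"
proof -
  have "h b 0 = 0" for b using h[of 0 0 b] V_cl(1) by simp
  then show ?thesis
    unfolding lin_ext_def using assms(2,3) by (intro sum_keys_add) (auto simp: h T_space_def)
qed

lemma T_fun_eq: "T_fun scale aactP f = lin_ext (\<lambda>b v. tensor scale (aactP f (single b 1)) v)"
  by (simp add: fun_eq_iff T_fun_def lin_ext_def)

lemma T_fun_on_tensor: "T_fun scale (*) f (tensor scale p v) = tensor scale (f * p) v"
  by (rule T_fun_tensor[OF Dn_module_Alam[of undefined]])

lemma T_fun_add: "y \<in> T_space V \<Longrightarrow> z \<in> T_space V \<Longrightarrow> T_fun scale (*) f (y + z) = T_fun scale (*) f y + T_fun scale (*) f z"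
  unfolding T_fun_eq by (rule lin_ext_add) (simp_all add: tensor_bilinear)

lemma T_d_add: "y \<in> T_space V \<Longrightarrow> z \<in> T_space V \<Longrightarrow> T_d i (y + z) = T_d i y + T_d i z"
  unfolding T_d_def by (rule lin_ext_add) (simp_all add: tensor_bilinear)

lemma T_d_on_tensor: "T_d i (tensor scale p v) = tensor scale (Alam_d lam i p) v"
proof -
  interpret P: Dn_module pm_scale "(*)" "Alam_d lam" by (rule Dn_module_Alam)
  show ?thesis unfolding T_d_def lin_ext_def
    by (rule tensor_family_eq[where h = "\<lambda>p v. tensor scale (Alam_d lam i p) v"])
      (simp_all add: P.dact_add P.dact_scale tensor_bilinear)
qed

lemma aug_mDelta: "axis i (reduced f) \<in> mDelta"
  by (simp add: mDelta_def axis_def m10_0 m10_eq eval10_diff eval10_const)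

lemma T_th_add: "y \<in> T_space V \<Longrightarrow> z \<in> T_space V \<Longrightarrow> T_th f i (y + z) = T_th f i y + T_th f i z"
  unfolding T_th_def by (rule lin_ext_add) (simp_all add: single_add act_add_right aug_mDelta)

lemma T_th_on_tensor:
  assumes "v \<in> V"
  shows "T_th f i (tensor scale p v) = tensor scale p (rho (axis i (reduced f)) v)"
proof -
  let ?X = "axis i (reduced f) :: 'n vf"
  have "T_th f i (tensor scale p v) = (\<Sum>b\<in>keys (tensor scale p v).
      single b (scale (lookup p b) (rho ?X v)))"
    using assms by (simp add: T_th_def lin_ext_def act_scale_right aug_mDelta)
  also have "\<dots> = (\<Sum>b\<in>keys p. single b (scale (lookup p b) (rho ?X v)))"
    by (rule sum.mono_neutral_left) (auto simp: in_keys_iff act_zero_right aug_mDelta)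
  also have "\<dots> = tensor scale p (rho ?X v)"
    by (rule poly_mapping_eqI) (simp add: lookup_sum lookup_single when_def in_keys_iff)
  finally show ?thesis .
qed

lemma rho_aug_closed: "v \<in> V \<Longrightarrow> rho (axis i (reduced f)) v \<in> V"
  by (rule act_closed[OF aug_mDelta])

lemma T_ops_closed:
  assumes "z \<in> T_space V"
  shows "T_fun scale (*) f z \<in> T_space V" "T_d i z \<in> T_space V" "T_th f i z \<in> T_space V"
  using assms
  by (induction z rule: T_space_induct)
    (simp_all add: T_fun_on_tensor T_d_on_tensor T_th_on_tensor T_fun_add T_d_add T_th_add T_space_cl rho_aug_closed)

lemma tensor_diff_right: "tensor scale p (u - v) = tensor scale p u - tensor scale p v"
  using tensor_bilinear(2)[of p "u - v" v] by simp

text \<open>All identities are checked on $p \otimes v$, where $D_n$ acts on $p$ and $m_{1,0}\Delta$ on $v$.\<close>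

theorem Dn_mDelta_module_T: "Dn_mDelta_module (T_scale scale) (T_space V) (T_fun scale (*)) T_d T_th"
proof -
  interpret TS: vector_space "T_scale scale :: complex \<Rightarrow> ('n exponent \<Rightarrow>\<^sub>0 'v) \<Rightarrow> _"
    by (rule vector_space_T_scale)
  interpret P: Dn_module pm_scale "(*)" "Alam_d lam" by (rule Dn_module_Alam)
  note tensors = T_fun_on_tensor T_d_on_tensor T_th_on_tensor rho_aug_closed
  note adds = T_fun_add T_d_add T_th_add T_ops_closed
  show ?thesis
  proof unfold_locales
    show "TS.subspace (T_space V)" by (rule TS.subspaceI) (simp_all add: T_space_cl)
    fix z :: "'n exponent \<Rightarrow>\<^sub>0 'v" assume z: "z \<in> T_space V"
    show "T_fun scale (*) (f + g) z = T_fun scale (*) f z + T_fun scale (*) g z" for f g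
      using z by (induction z rule: T_space_induct) (simp_all add: tensors adds ring_distribs tensor_bilinear)
    show "T_fun scale (*) (const c) z = T_scale scale c z" for c
      using z by (induction z rule: T_space_induct)
        (simp_all add: tensors adds pm_scale_const[symmetric] tensor_bilinear TS.scale_right_distrib)
    show "T_fun scale (*) (f * g) z = T_fun scale (*) f (T_fun scale (*) g z)" for f g
      using z by (induction z rule: T_space_induct) (simp_all add: tensors adds mult.assoc)
    show "T_d i (T_d j z) = T_d j (T_d i z)" for i j
      using z by (induction z rule: T_space_induct) (simp_all add: tensors adds P.dact_commute)
    show "T_d i (T_fun scale (*) f z) = T_fun scale (*) f (T_d i z) + T_fun scale (*) (der i f) z" for i f
      using z
    proof (induction z rule: T_space_induct)
      case (tensor p v)
      have "Alam_d lam i (f * p) = f * Alam_d lam i p + der i f * p" using P.dact_aact[of i f p] by (simp add: algebra_simps)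
      then show ?case by (simp add: tensors tensor_bilinear)
    qed (simp add: adds)
    show "T_th (f + g) i z = T_th f i z + T_th g i z" for f g i
      using z
    proof (induction z rule: T_space_induct)
      case (tensor p v)
      have "axis i (f + g - const (eval10 (f + g))) = axis i (reduced f) + axis i (reduced g)"
        by (simp add: vec_eq_iff axis_def eval10_add const_add)
      then show ?case using tensor by (simp add: tensors tensor_bilinear act_add_left aug_mDelta)
    qed (simp add: adds)
    show "T_th (const c * f) i z = T_scale scale c (T_th f i z)" for c f i
      using z
    proof (induction z rule: T_space_induct)
      case (tensor p v)
      have "axis i (const c * f - const (eval10 (const c * f))) = vf_scale c (axis i (reduced f))"
        by (simp add: vec_eq_iff axis_def vf_scale_def eval10_mult eval10_const const_mult right_diff_distrib)
      then show ?case using tensor by (simp add: tensors tensor_bilinear act_scale_left aug_mDelta)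
    qed (simp add: adds TS.scale_right_distrib)
    show "T_th 1 i z = 0" for i
      using z
    proof (induction z rule: T_space_induct)
      case (tensor p v)
      have e: "axis i (reduced 1) = (0 :: 'n vf)" by (simp add: vec_eq_iff axis_def)
      have "T_th 1 i (tensor scale p v) = tensor scale p 0"
        unfolding T_th_on_tensor[OF tensor] e act_zero_left[OF tensor] ..
      also have "\<dots> = 0" by (rule poly_mapping_eqI) simp
      finally show ?case .
    qed (simp add: adds)
    show "T_th f i (T_fun scale (*) g z) = T_fun scale (*) g (T_th f i z)" for f g i
      using z by (induction z rule: T_space_induct) (simp_all add: tensors adds)
    show "T_th f i (T_d j z) = T_d j (T_th f i z)" for f i j
      using z by (induction z rule: T_space_induct) (simp_all add: tensors adds)
    show "T_th f i (T_th g j z) - T_th g j (T_th f i z) =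
       T_th ((reduced f) * der i g) j z - T_th ((reduced g) * der j f) i z" for f i g j
      using z
    proof (induction z rule: T_space_induct)
      case (tensor p v)
      let ?F = "f - const (eval10 f)" and ?G = "g - const (eval10 g)"
      have e: "u - const (eval10 u) = u" if "eval10 u = 0" for u :: "'n An" using that by simp
      have z: "eval10 ?F = 0" "eval10 ?G = 0" by (simp_all add: eval10_diff eval10_const)
      have "rho (vf_bracket (axis i ?F) (axis j ?G)) v = rho (axis j (?F * der i g)) v - rho (axis i (?G * der j f)) v"
        unfolding vf_bracket_axis der_diff der_const diff_zero
      proof (rule act_diff_left[OF _ _ tensor])
        show "axis j (?F * der i g) \<in> mDelta" "axis i (?G * der j f) \<in> mDelta"
          by (simp_all add: mDelta_def axis_def m10_eq eval10_mult z)
      qed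
      then have "rho (axis i ?F) (rho (axis j ?G) v) - rho (axis j ?G) (rho (axis i ?F) v) =
          rho (axis j (?F * der i g)) v - rho (axis i (?G * der j f)) v"
        using act_bracket[OF aug_mDelta aug_mDelta tensor, of i f j g] by simp
      moreover have "T_th (?F * der i g) j (tensor scale p v) = tensor scale p (rho (axis j (?F * der i g)) v)"
        "T_th (?G * der j f) i (tensor scale p v) = tensor scale p (rho (axis i (?G * der j f)) v)"
        unfolding T_th_on_tensor[OF tensor] by (simp_all only: e eval10_mult z mult_zero_left const_0 diff_zero)
      ultimately show ?case
        unfolding T_th_on_tensor[OF tensor] T_th_on_tensor[OF rho_aug_closed[OF tensor]]
        by (simp only: tensor_diff_right[symmetric])
    next
      case (add y z)
      then show ?case by (simp add: adds algebra_simps)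
    qed
  qed (simp_all add: adds)
qed

sublocale T: Dn_mDelta_module "T_scale scale" "T_space V" "T_fun scale (*)" T_d T_th
  by (rule Dn_mDelta_module_T)

lemma T_vf_eq_gop:
  assumes "z \<in> T_space V"
  shows "T_vf scale (*) (Alam_d lam) rho X z = T.gop X z"
proof -
  interpret P: Dn_module pm_scale "(*)" "Alam_d lam" by (rule Dn_module_Alam)
  let ?TM = "T_mon scale (*) (Alam_d lam) rho"
  have L: "axis i (mon a r - (if r = 0 then 1 else 0)) \<in> mDelta" for i :: 'n and a r
    using mon_m10[of a r] by (auto simp: mDelta_def axis_def m10_0)
  have TM_add: "?TM a m i p (u + v) = ?TM a m i p u + ?TM a m i p v" if "u \<in> V" "v \<in> V" for a m i p u v
    using that by (simp add: T_mon_def tensor_bilinear act_add_right L T.scale_right_distrib sum.distrib)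
  have "(\<Sum>u\<in>keys f. lin_ext (\<lambda>b v. T_scale scale (lookup f u)
      (?TM (fst u) (snd u) i (single b 1) v)) z) = T.op f i z" for f i
    using assms
  proof (induction z rule: T_space_induct)
    case (add y z)
    then show ?case
      by (simp add: T.op_add_right lin_ext_add TM_add T.scale_right_distrib sum.distrib)
  next
    case (tensor p v)
    have tm: "T_scale scale c (?TM a m i p v) = tensor scale (const c * mon a m * Alam_d lam i p) v +
       (\<Sum>r | r \<le> m. T_fun scale (*) (const (c * of_nat (vec_binomial m r)) * mon a (m - r)) (T_th (mon a r) i (tensor scale p v)))"
      for c a m
    proof -
      have "T_fun scale (*) (const (c * of_nat (vec_binomial m r)) * mon a (m - r)) (T_th (mon a r) i (tensor scale p v)) =
          T_scale scale c (T_scale scale (of_nat (vec_binomial m r)) (tensor scale (mon a (m - r) * p)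
            (rho (axis i (mon a r - (if r = 0 then 1 else 0))) v)))" for r
        using tensor
        by (simp add: T_th_on_tensor T_fun_on_tensor eval10_mon_1 const_if const_mult mult.assoc
            tensor_bilinear(3)[symmetric] pm_scale_const del: T.scale_scale)
      then show ?thesis
        by (simp add: T_mon_def T.scale_right_distrib T.scale_sum_right tensor_bilinear(3)[symmetric] pm_scale_const
            mult.assoc vec_binomial_def del: T.scale_scale)
    qed
    have fam: "lin_ext (\<lambda>b v. T_scale scale c (?TM a m i (single b 1) v)) (tensor scale p v) =
        T_scale scale c (?TM a m i p v)" for c a m
      unfolding lin_ext_def
    proof (rule tensor_family_eq[where h = "\<lambda>p v. T_scale scale c (?TM a m i p v)"])
      fix q q'
      show "T_scale scale c (?TM a m i (q + q') v) = T_scale scale c (?TM a m i q v) + T_scale scale c (?TM a m i q' v)"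
        by (simp add: T_mon_def P.dact_add ring_distribs tensor_bilinear T.scale_right_distrib sum.distrib)
    next
      fix e q
      have s: "f * pm_scale e q = pm_scale e (f * q)" for f q :: "'n An"
        by (simp add: pm_scale_const mult.left_commute)
      show "T_scale scale c (?TM a m i q (scale e v)) = T_scale scale c (?TM a m i (pm_scale e q) v)"
        using tensor by (simp add: T_mon_def P.dact_scale s tensor_bilinear act_scale_right L)
    qed
    have "(\<Sum>u\<in>keys f. T_scale scale (lookup f u) (?TM (fst u) (snd u) i p v)) =
        (\<Sum>u\<in>keys f. tensor scale (const (lookup f u) * mon (fst u) (snd u) * Alam_d lam i p) v) +
        coprod_sum f (\<lambda>x y. T_fun scale (*) x (T_th y i (tensor scale p v)))"
      by (simp add: tm sum.distrib coprod_sum_def split_def)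
    also have "(\<Sum>u\<in>keys f. tensor scale (const (lookup f u) * mon (fst u) (snd u) * Alam_d lam i p) v) =
        tensor scale ((\<Sum>u\<in>keys f. const (lookup f u) * mon (fst u) (snd u)) * Alam_d lam i p) v"
    proof -
      interpret a: additive "\<lambda>p. tensor scale p v" by (rule additive.intro) (rule tensor_bilinear)
      show ?thesis by (simp add: sum_distrib_right a.sum)
    qed
    finally show ?case
      by (simp add: fam An_sum_monomials T.op_def T_d_on_tensor T_fun_on_tensor)
  qed
  then show ?thesis
    by (simp add: T_vf_def T.gop_def lin_ext_def split_def)
qed

lemma AG_module_T:
  "AG_module (T_scale scale) (T_space V) (T_fun scale (*)) (T_vf scale (*) (Alam_d lam) rho)"
proof -
  interpret G: AG_module "T_scale scale" "T_space V" "T_fun scale (*)" T.gop by (rule T.AG_module_gop)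
  show ?thesis
    by unfold_locales
      (simp_all add: T_vf_eq_gop T_space_cl G.subspace_V G.act_closed G.act_add_left G.act_scale_left G.act_add_right
        G.act_scale_right G.act_bracket G.aact_closed G.aact_add_left G.aact_add_right G.aact_const G.aact_mult G.compat)
qed

text \<open>The coefficient at $t^{\lambda+a} x^m$ receives contributions from this monomial and from the one with $x_i$-exponent raised by one.\<close>

lemma lookup_T_d:
  assumes "z \<in> T_space V"
  shows "lookup (T_d i z) (a, m) = scale (lam $ i + of_int (a $ i)) (lookup z (a, m)) +
     scale (of_nat (Suc (m $ i))) (lookup z (a, m + axis i 1))"
  using assms
proof (induction z rule: T_space_induct)
  case (add y z)
  then show ?case by (simp add: T_d_add lookup_add scale_right_distrib del: of_nat_Suc)
next
  case (tensor p v)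
  have "lookup (Alam_d lam i p) (a, m) = (lam $ i + of_int (a $ i)) * lookup p (a, m) +
      of_nat (Suc (m $ i)) * lookup p (a, m + axis i 1)"
  proof (induction p rule: An_induct)
    case (mon c b k)
    have 1: "(k - axis i 1 = m \<and> k $ i \<noteq> 0) \<longleftrightarrow> k = m + axis i 1" by (auto simp: vec_eq_iff axis_def)
    have cm: "const c * mon b k = single (b, k) c" for c b k
      by (simp add: const_def mon_def mult_single)
    have "Alam_d lam i (const c * mon b k) = single (b, k) (c * (lam $ i + of_int (b $ i)))
        + single (b, k - axis i 1) (c * of_nat (k $ i))"
      unfolding cm[symmetric] Alam_d_def der_mon pm_scale_const
      by (simp add: const_mult const_add ring_distribs mult.assoc mult.left_commute[of "const (lam $ i)"])
    then show ?case
      using 1 by (cases "k $ i = 0") (auto simp: cm lookup_add lookup_single when_def axis_def)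
  next
    case (add f g)
    then show ?case by (simp add: Alam_d_def der_add lookup_add algebra_simps)
  qed
  then show ?case by (simp add: T_d_on_tensor scale_left_distrib del: of_nat_Suc)
qed

end

section \<open>Submodules of the tensor modules\<close>

locale tensor_submodule = tensor_setting scale V rho lam
  for scale :: "complex \<Rightarrow> 'v::ab_group_add \<Rightarrow> 'v" and V and rho :: "'n::finite vf \<Rightarrow> 'v \<Rightarrow> 'v" and lam +
  fixes W :: "('n exponent \<Rightarrow>\<^sub>0 'v) set"
  assumes W: "W \<subseteq> T_space V" "T.subspace W"
    and A: "w \<in> W \<Longrightarrow> T_fun scale (*) f w \<in> W"
    and G: "w \<in> W \<Longrightarrow> T_vf scale (*) (Alam_d lam) rho X w \<in> W"
begin

text \<open>It will turn out that \<open>W\<close> is the tensor product of $A_n(\lambda)$ with this subspace.\<close>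

definition U :: "'v set" where
  "U = {v \<in> V. tensor scale 1 v \<in> W}"

lemmas W_cl = T.subspace_0[OF W(2)] T.subspace_add[OF W(2)] T.subspace_diff[OF W(2)] T.subspace_scale[OF W(2)]

lemma UV: "u \<in> U \<Longrightarrow> u \<in> V"
  by (simp add: U_def)

lemma subspace_U: "subspace U"
  by (rule subspaceI) (auto simp: U_def V_cl tensor_0 tensor_bilinear W_cl)

lemmas U_cl = subspace_0[OF subspace_U] subspace_add[OF subspace_U] subspace_diff[OF subspace_U]
  subspace_scale[OF subspace_U]

lemma tensor_U: "u \<in> U \<Longrightarrow> tensor scale p u \<in> W"
  using A[of "tensor scale 1 u" p] by (simp add: U_def T_fun_on_tensor)

lemma T_d_W: "w \<in> W \<Longrightarrow> T_d i w \<in> W"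
  using G[of w "axis i 1"] W(1) T_vf_eq_gop T.gop_axis_1 by auto

text \<open>Induction over finite sets \<open>S\<close> of exponents that contain, with each exponent, those with smaller $x$-part; the
  operators $d_i$ preserve the span of such a set. For a suitable exponent $(a,m)$ in \<open>S\<close>, the operator
  $d_i - \lambda_i - a_i$ kills the coefficient there, so the induction hypothesis applies to the image of \<open>z\<close>. A
  coefficient of the image is a nonzero multiple of a coefficient of \<open>z\<close>, which therefore lies in \<open>U\<close> and can be
  subtracted.\<close>

lemma coefficient_in_U:
  assumes "z \<in> W"
  shows "lookup z b \<in> U"
proof -
  define down_closed where "down_closed S \<longleftrightarrow> (\<forall>a m k. (a, m) \<in> S \<longrightarrow> k \<le> m \<longrightarrow> (a, k) \<in> S)"
    for S :: "'n exponent set"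
  have main: "\<forall>b. lookup z b \<in> U"
    if "finite S" "keys z \<subseteq> S" "down_closed S" "z \<in> W" for S z
    using that
  proof (induction "card S" arbitrary: S z rule: less_induct)
    case less
    have zN: "z \<in> T_space V" using less.prems(4) W(1) by blast
    then have zV: "lookup z b \<in> V" for b by (rule T_spaceD)
    have S_down: "(a, k) \<in> S" if "(a, m) \<in> S" "k \<le> m" for a m k
      using less.prems(3) that unfolding down_closed_def by blast
    have IH: "lookup y c \<in> U"
      if "b \<in> S" "keys y \<subseteq> S - {b}" "down_closed (S - {b})" "y \<in> W" for b y c
    proof -
      have "\<forall>c. lookup y c \<in> U"
        by (rule less.hyps[OF card_Diff1_less[OF less.prems(1) that(1)] _ that(2-4)]) (use less.prems(1) in simp)
      then show ?thesis ..
    qed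
    \<comment> \<open>Once one coefficient is known to lie in \<open>U\<close>, it can be subtracted.\<close>
    have remove: ?case
      if b: "b \<in> S" "lookup z b \<in> U" and down: "down_closed (S - {b})" for b
    proof
      let ?z = "z - tensor scale (single b 1) (lookup z b)"
      have l: "lookup ?z c = (if c = b then 0 else lookup z c)" for c
        by (simp add: lookup_minus lookup_single when_def)
      have keys: "keys ?z \<subseteq> S - {b}"
      proof
        fix c assume "c \<in> keys ?z"
        then have "lookup ?z c \<noteq> 0" unfolding in_keys_iff .
        then have "c \<noteq> b" "lookup z c \<noteq> 0" unfolding l by presburger+
        then show "c \<in> S - {b}" using less.prems(2) by (metis DiffI in_keys_iff singletonD subsetD)
      qed
      have zW: "?z \<in> W" using less.prems(4) tensor_U[OF b(2)] by (rule W_cl(3))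
      show "lookup z c \<in> U" for c
        using IH[OF b(1) keys down zW, of c] b(2) unfolding l by presburger
    qed
    \<comment> \<open>The operator $d_i - \lambda_i - e$ annihilates the multiples of $t^{\lambda+a}$ with $a_i = e$.\<close>
    let ?Q = "\<lambda>i e. T_d i z - T_scale scale (lam $ i + of_int e) z"
    have QW: "?Q i e \<in> W" for i e using less.prems(4) by (intro W_cl T_d_W)
    have lQ: "lookup (?Q i e) (a, m) = scale (of_int (a $ i) - of_int e) (lookup z (a, m)) +
        scale (of_nat (Suc (m $ i))) (lookup z (a, m + axis i 1))" for i e a m
      by (simp add: lookup_minus lookup_T_d[OF zN] scale_left_diff_distrib scale_left_distrib del: of_nat_Suc)
    show ?case
    proof (cases "\<exists>(a, m)\<in>S. m \<noteq> 0")
      case True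
      \<comment> \<open>Take \<open>m\<close> maximal for this \<open>a\<close>: the coefficient at \<open>(a, m)\<close> reappears at \<open>m - axis i 1\<close>.\<close>
      then obtain a m1 where m1: "(a, m1) \<in> S" "m1 \<noteq> 0" by auto
      let ?size = "\<lambda>m :: nat^'n. \<Sum>j\<in>UNIV. m $ j"
      have fin: "finite (snd ` S)" using less.prems(1) by simp
      have "?size m \<le> (\<Sum>k\<in>snd ` S. ?size k)" if "(a, m) \<in> S" for m
        using fin that by (intro member_le_sum) force+
      then obtain m where m: "(a, m) \<in> S" "m \<noteq> 0" "\<And>k. (a, k) \<in> S \<Longrightarrow> k \<noteq> 0 \<Longrightarrow> ?size k \<le> ?size m"
        using ex_has_greatest_nat[of "\<lambda>m. (a, m) \<in> S \<and> m \<noteq> 0" m1 ?size "Suc (\<Sum>k\<in>snd ` S. ?size k)"] m1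
        by (auto simp: less_Suc_eq_le)
      have max: "k = m" if "(a, k) \<in> S" "m \<le> k" for k
      proof (rule ccontr)
        assume "k \<noteq> m"
        with that(2) obtain j where j: "m $ j < k $ j"
          by (auto simp: vec_eq_iff less_eq_vec_def) (metis nat_less_le)
        have "?size m < ?size k"
          using that(2) j by (intro sum_strict_mono_ex1) (auto simp: less_eq_vec_def)
        moreover have "k \<noteq> 0" using j by auto
        ultimately show False using m(3)[OF that(1)] by simp
      qed
      obtain i where i: "m $ i \<noteq> 0" using m(2) by (auto simp: vec_eq_iff)
      have "(a', k) \<in> S - {(a, m)}" if "(a', m') \<in> S - {(a, m)}" "k \<le> m'" for a' m' k
        using that S_down[of a' m' k] max[of m'] by auto
      then have down: "down_closed (S - {(a, m)})" unfolding down_closed_def by blast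
      have up: "(a, m + axis i 1) \<notin> S"
      proof
        assume "(a, m + axis i 1) \<in> S"
        then have "m + axis i 1 = m" by (rule max) (simp add: less_eq_vec_def)
        then have "(m + axis i 1) $ i = m $ i" by simp
        then show False by (simp add: axis_def)
      qed
      have key: "lookup z b = 0" if "b \<notin> S" for b
        using less.prems(2) that by (auto simp: in_keys_iff)
      let ?z = "?Q i (a $ i)"
      have keys: "keys ?z \<subseteq> S - {(a, m)}"
      proof
        fix b assume "b \<in> keys ?z"
        then obtain a' k where b: "b = (a', k)" "lookup ?z (a', k) \<noteq> 0" by (cases b) (auto simp: in_keys_iff)
        have "(a', k) \<in> S"
        proof (rule ccontr)
          assume n: "(a', k) \<notin> S"
          have "k \<le> k + axis i 1" by (simp add: less_eq_vec_def)
          then have "(a', k + axis i 1) \<notin> S" using n S_down by blast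
          then show False using b(2) n unfolding lQ by (simp add: key)
        qed
        moreover have "(a', k) \<noteq> (a, m)" using b(2) up unfolding lQ by (auto simp: key)
        ultimately show "b \<in> S - {(a, m)}" using b(1) by simp
      qed
      note zU = IH[OF m(1) keys down QW]
      have "m - axis i 1 + axis i 1 = m" using i by (auto simp: vec_eq_iff axis_def)
      then have "scale (of_nat (Suc ((m - axis i 1) $ i))) (lookup z (a, m)) \<in> U"
        using zU[of "(a, m - axis i 1)"] unfolding lQ by simp
      from U_cl(4)[OF this, of "inverse (of_nat (Suc ((m - axis i 1) $ i)))"]
      have "lookup z (a, m) \<in> U" by (simp del: of_nat_Suc)
      then show ?thesis by (rule remove[OF m(1) _ down])
    next
      case False
      then have S0: "m = 0" if "(a, m) \<in> S" for a m using that by auto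
      have key: "lookup z b = 0" if "b \<notin> S" for b
        using less.prems(2) that by (auto simp: in_keys_iff)
      have "(a', k) \<in> S - {b}" if "(a', m') \<in> S - {b}" "k \<le> m'" for a' m' k b
      proof -
        have "m' = 0" using S0 that(1) by blast
        then have "k = 0" using that(2) by (simp add: less_eq_vec_def vec_eq_iff)
        then show ?thesis using that(1) \<open>m' = 0\<close> by simp
      qed
      then have down: "down_closed (S - {b})" for b unfolding down_closed_def by blast
      have up: "lookup z (a, m + axis i 1) = 0" for a m i
      proof (rule key)
        have "(m + axis i 1) $ i \<noteq> 0" by (simp add: axis_def)
        then have "m + axis i 1 \<noteq> 0" by (metis zero_index)
        then show "(a, m + axis i 1) \<notin> S" using S0 by blast
      qed
      show ?thesis
      proof (cases "\<exists>a b. (a, 0) \<in> S \<and> (b, 0) \<in> S \<and> a \<noteq> b")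
        case True
        \<comment> \<open>Only powers of \<open>t\<close> occur: killing $t^a$ multiplies the coefficient of $t^b$ by $b_i - a_i$.\<close>
        then obtain a b where ab: "(a, 0) \<in> S" "(b, 0) \<in> S" "a \<noteq> b" by blast
        obtain i where i: "a $ i \<noteq> b $ i" using ab(3) by (auto simp: vec_eq_iff)
        let ?z = "?Q i (a $ i)"
        have keys: "keys ?z \<subseteq> S - {(a, 0)}"
        proof
          fix c assume c: "c \<in> keys ?z"
          have "c \<in> S"
          proof (rule ccontr)
            assume "c \<notin> S"
            then show False using c key[of c] lQ[of i "a $ i" "fst c" "snd c"] by (simp add: in_keys_iff up[unfolded One_nat_def])
          qed
          moreover have "c \<noteq> (a, 0)" using c lQ[of i "a $ i" a 0] up[of a 0 i] by (auto simp: in_keys_iff up[unfolded One_nat_def])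
          ultimately show "c \<in> S - {(a, 0)}" by simp
        qed
        have "lookup ?z (b, 0) \<in> U" by (rule IH[OF ab(1) keys down QW])
        then have "scale (of_int (b $ i) - of_int (a $ i)) (lookup z (b, 0)) \<in> U"
          unfolding lQ using up[of b 0 i] by simp
        from U_cl(4)[OF this, of "inverse (of_int (b $ i) - of_int (a $ i))"]
        have "lookup z (b, 0) \<in> U" using i by simp
        then show ?thesis by (rule remove[OF ab(2) _ down])
      next
        case False
        show ?thesis
        proof (cases "S = {}")
          case True
          then show ?thesis using key U_cl(1) by simp
        next
          case nonempty: False
          then obtain a m where "(a, m) \<in> S" by (metis all_not_in_conv surj_pair)
          then have a: "(a, 0) \<in> S" using S0[of a m] by simp
          have "c = (a, 0)" if "c \<in> S" for c
          proof -
            obtain b m where c: "c = (b, m)" by (cases c)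
            then have "m = 0" using that S0[of b m] by simp
            then have "b = a" using False a that c by blast
            with \<open>m = 0\<close> c show ?thesis by simp
          qed
          then have S: "S = {(a, 0)}" using a by blast
          have "z = tensor scale (mon a 0) (lookup z (a, 0))"
            using key S by (intro poly_mapping_eqI) (auto simp: mon_def lookup_single when_def)
          then have "T_fun scale (*) (mon (- a) 0) z = tensor scale (mon (- a) 0 * mon a 0) (lookup z (a, 0))"
            by (metis T_fun_on_tensor)
          then have "tensor scale 1 (lookup z (a, 0)) \<in> W"
            using A[OF less.prems(4), of "mon (- a) 0"] by (simp add: mon_mult)
          then have "lookup z (a, 0) \<in> U" using zV by (simp add: U_def)
          then show "\<forall>b. lookup z b \<in> U" using key U_cl(1) unfolding S by (metis singletonD)
        qed
      qed
    qed
  qed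
  let ?S = "\<Union>(a, m)\<in>keys z. {a} \<times> {k. k \<le> m}"
  have "\<forall>b. lookup z b \<in> U"
  proof (rule main[of ?S])
    show "down_closed ?S" unfolding down_closed_def by (auto intro: order_trans)
  qed (use assms in \<open>auto simp: finite_vec_le\<close>)
  then show ?thesis ..
qed

lemma W_eq: "W = T_space U"
proof (intro equalityI subsetI)
  show "z \<in> T_space U" if "z \<in> W" for z using coefficient_in_U[OF that] by (simp add: T_space_def)
  fix z :: "'n exponent \<Rightarrow>\<^sub>0 'v" assume "z \<in> T_space U"
  then have zU: "lookup z b \<in> U" for b by (rule T_spaceD)
  have "(\<Sum>b\<in>keys z. tensor scale (single b 1) (lookup z b)) \<in> W"
    by (intro T.subspace_sum[OF W(2)] tensor_U zU)
  then show "z \<in> W" by (simp flip: tensor_expand)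
qed

text \<open>In $(t^a x^m d_i)(1 \otimes u)$ the part coming from $m_{1,0}\Delta$ has, at the monomial $t^a$, the coefficient
  $(t^a x^m - \delta_{m,0}) d_i u$, and these vector fields span $m_{1,0}\Delta$.\<close>

lemma U_stable:
  assumes X: "X \<in> mDelta" and u: "u \<in> U"
  shows "rho X u \<in> U"
proof -
  have uN: "tensor scale 1 u \<in> T_space V" using UV[OF u] by (rule T_space_cl)
  have comp: "rho (axis i (reduced f)) u \<in> U" for i f
  proof (induction f rule: An_induct)
    case (mon c a m)
    let ?f = "const c * mon a m"
    let ?t = "tensor scale 1 u"
    have "T.op ?f i ?t \<in> W"
      using G[of ?t "axis i ?f"] tensor_U[OF u, of 1] T_vf_eq_gop[OF uN] T.gop_axis[OF uN] by simp
    moreover have "T_fun scale (*) ?f (T_d i ?t) \<in> W" using tensor_U[OF u] by (intro A T_d_W)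
    ultimately have "coprod_sum ?f (\<lambda>x y. T_fun scale (*) x (T_th y i ?t)) \<in> W"
      using W_cl(3)[of "T.op ?f i ?t" "T_fun scale (*) ?f (T_d i ?t)"] by (simp add: T.op_def)
    moreover have "lookup (coprod_sum ?f (\<lambda>x y. T_fun scale (*) x (T_th y i ?t))) (a, 0) =
        scale c (rho (axis i (reduced (mon a m))) u)"
    proof -
      have "lookup (coprod_sum ?f (\<lambda>x y. T_fun scale (*) x (T_th y i ?t))) (a, 0) =
          (\<Sum>r | r \<le> m. lookup (tensor scale (const (c * of_nat (vec_binomial m r)) * mon a (m - r))
            (rho (axis i (reduced (mon a r))) u)) (a, 0))"
        unfolding coprod_sum_mon[OF T.balanced_action[OF uN]] using UV[OF u]
        by (simp add: lookup_sum T_fun_on_tensor T_th_on_tensor)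
      also have "\<dots> = (\<Sum>r | r \<le> m. if r = m then scale c (rho (axis i (reduced (mon a r))) u) else 0)"
      proof (rule sum.cong)
        fix r assume "r \<in> {r. r \<le> m}"
        then have "m - r = 0 \<longleftrightarrow> r = m" by (auto simp: vec_eq_iff less_eq_vec_def intro: antisym)
        moreover have "vec_binomial m m = 1" by (simp add: vec_binomial_def)
        moreover have "const b * mon a k = single (a, k) b" for b k
          by (simp add: const_def mon_def mult_single)
        ultimately show "lookup (tensor scale (const (c * of_nat (vec_binomial m r)) * mon a (m - r))
            (rho (axis i (reduced (mon a r))) u)) (a, 0) =
            (if r = m then scale c (rho (axis i (reduced (mon a r))) u) else 0)"
          by (auto simp: lookup_single when_def)
      qed simp
      finally show ?thesis by (simp add: finite_vec_le)
    qed
    ultimately have "scale c (rho (axis i (reduced (mon a m))) u) \<in> U" using coefficient_in_U by metis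
    moreover have "axis i (reduced ?f) = vf_scale c (axis i (reduced (mon a m)))"
      by (simp add: vec_eq_iff axis_def vf_scale_def eval10_mult eval10_const const_mult right_diff_distrib)
    ultimately show ?case using UV[OF u] by (simp add: act_scale_left aug_mDelta)
  next
    case (add f g)
    have "axis i (f + g - const (eval10 (f + g))) = axis i (reduced f) + axis i (reduced g)"
      by (simp add: vec_eq_iff axis_def eval10_add const_add)
    then show ?case using add UV[OF u] by (simp add: act_add_left aug_mDelta U_cl)
  qed
  have "(\<Sum>i\<in>S. axis i (X $ i)) \<in> mDelta \<and> rho (\<Sum>i\<in>S. axis i (X $ i)) u \<in> U" for S
  proof (induction S rule: infinite_finite_induct)
    case (insert i S)
    have z: "eval10 (X $ i) = 0" using X by (simp add: mDelta_def m10_eq)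
    have "axis i (X $ i) \<in> mDelta" "rho (axis i (X $ i)) u \<in> U"
      using aug_mDelta[of i "X $ i"] comp[of i "X $ i"] by (simp_all add: z)
    then show ?case using insert UV[OF u] by (simp add: act_add_left U_cl mDelta_subalgebra)
  qed (simp_all add: mDelta_subalgebra act_zero_left UV[OF u] U_cl)
  from this[of UNIV] show ?thesis by (simp add: vf_expand)
qed

end

context tensor_setting
begin

theorem simple_T:
  assumes "simple_lie_module scale vf_scale vf_bracket (mDelta :: 'n vf set) V rho"
  shows "simple_AG_module (T_scale scale) (T_space V :: ('n exponent \<Rightarrow>\<^sub>0 'v) set)
    (T_fun scale (*)) (T_vf scale (*) (Alam_d lam) rho)"
  unfolding simple_AG_module_def
proof (intro conjI allI impI AG_module_T)
  have sV: "V \<noteq> {0}" "\<And>U. U \<subseteq> V \<Longrightarrow> subspace U \<Longrightarrow> (\<forall>X\<in>mDelta. \<forall>u\<in>U. rho X u \<in> U) \<Longrightarrow> U = {0} \<or> U = V"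
    using assms unfolding simple_lie_module_def by auto
  have T0: "T_space {0} = {0 :: 'n exponent \<Rightarrow>\<^sub>0 'v}"
    by (auto simp: T_space_def intro!: poly_mapping_eqI)
  obtain v where v: "v \<in> V" "v \<noteq> 0" using sV(1) V_cl(1) by blast
  have "single 0 v \<in> (T_space V :: ('n exponent \<Rightarrow>\<^sub>0 'v) set)"
    using v(1) by (rule T_space_cl)
  moreover have "single 0 v \<noteq> (0 :: 'n exponent \<Rightarrow>\<^sub>0 'v)"
    using v(2) by (metis lookup_single_eq lookup_zero)
  ultimately show "T_space V \<noteq> {0 :: 'n exponent \<Rightarrow>\<^sub>0 'v}" by blast
  fix W :: "('n exponent \<Rightarrow>\<^sub>0 'v) set"
  assume W: "W \<subseteq> T_space V" "T.subspace W" "\<forall>f. \<forall>w\<in>W. T_fun scale (*) f w \<in> W"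
    "\<forall>X. \<forall>w\<in>W. T_vf scale (*) (Alam_d lam) rho X w \<in> W"
  interpret tensor_submodule scale V rho lam W
    by unfold_locales (use W in auto)
  have "U = {0} \<or> U = V"
    by (rule sV(2)[OF _ subspace_U]) (auto simp: U_stable UV)
  moreover have "T_space U = {0 :: 'n exponent \<Rightarrow>\<^sub>0 'v}" if "U = {0}" unfolding that by (rule T0)
  moreover have "T_space U = (T_space V :: ('n exponent \<Rightarrow>\<^sub>0 'v) set)" if "U = V" unfolding that ..
  ultimately show "W = {0} \<or> W = T_space V" using W_eq by argo
qed

end

section \<open>Finite-dimensional simple modules over $m_{1,0}\Delta$\<close>

text \<open>On the monomials with $a_i \ne 0$ the derivation $d_i$ is $a_i$ plus a nilpotent operator; on the others it is $\partial/\partial x_i$.\<close>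

lemma der_surj: "\<exists>g. der i g = h"
proof (induction h rule: An_induct)
  case (mon c a m)
  show ?case
  proof (cases "a $ i = 0")
    case True
    have "der i (const (c / of_nat (Suc (m $ i))) * mon a (m + axis i 1)) =
        const (c / of_nat (Suc (m $ i))) * (const (of_nat (Suc (m $ i))) * mon a m)"
      using True by (simp add: der_mon axis_def del: of_nat_Suc)
    also have "\<dots> = const c * mon a m"
      by (simp del: of_nat_Suc flip: mult.assoc const_mult)
    finally show ?thesis by blast
  next
    case False
    show ?thesis
    proof (induction "m $ i" arbitrary: m c)
      case 0
      have "der i (const (c / of_int (a $ i)) * mon a m) = const (c / of_int (a $ i)) * (const (of_int (a $ i)) * mon a m)"
        using 0 by (simp add: der_mon)
      also have "\<dots> = const c * mon a m" using False by (simp flip: mult.assoc const_mult)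
      finally show ?case by blast
    next
      case (Suc k)
      have "k = (m - axis i 1) $ i" using Suc(2) by (simp add: axis_def)
      from Suc(1)[OF this, of "c / of_int (a $ i) * of_nat (m $ i)"] obtain g
        where g: "der i g = const (c / of_int (a $ i) * of_nat (m $ i)) * mon a (m - axis i 1)" by blast
      have "der i (const (c / of_int (a $ i)) * mon a m - g) =
          const (c / of_int (a $ i)) * (const (of_int (a $ i)) * mon a m)"
        by (simp only: der_diff der_mon g const_mult ring_distribs mult.assoc add_diff_cancel)
      also have "\<dots> = const c * mon a m" using False by (simp flip: mult.assoc const_mult)
      finally show ?case by blast
    qed
  qed
next
  case (add f g)
  then show ?case by (metis der_add)
qed

lemma der_power: "der i (f ^ Suc k) = const (of_nat (Suc k)) * f ^ k * der i f"
proof (induction k)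
  case (Suc k)
  have "der i (f ^ Suc (Suc k)) = der i f * f ^ Suc k + f * der i (f ^ Suc k)"
    by (simp only: power_Suc[of f "Suc k"] der_mult)
  also have "\<dots> = (1 + const (of_nat (Suc k))) * f ^ Suc k * der i f"
    unfolding Suc by (simp add: algebra_simps)
  also have "1 + const (of_nat (Suc k)) = const (of_nat (Suc (Suc k)))"
    by (simp only: of_nat_Suc[of "Suc k"] const_add const_1)
  finally show ?case .
qed simp

definition poly_at :: "complex poly \<Rightarrow> 'n::finite An \<Rightarrow> 'n An" where
  "poly_at q w = poly (map_poly const q) w"

lemma poly_at_pCons: "poly_at (pCons a q) w = const a + w * poly_at q w"
  by (cases "a = 0 \<and> q = 0") (auto simp: poly_at_def map_poly_pCons)

lemma poly_at_0 [simp]: "poly_at 0 w = 0"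
  by (simp add: poly_at_def)

lemma poly_at_add: "poly_at (p + q) w = poly_at p w + poly_at q w"
  by (induction p q rule: poly_induct2) (simp_all add: poly_at_pCons const_add algebra_simps)

lemma poly_at_smult: "poly_at (smult c q) w = const c * poly_at q w"
  by (induction q) (simp_all add: poly_at_pCons const_mult algebra_simps)

lemma poly_at_mult: "poly_at (p * q) w = poly_at p w * poly_at q w"
  by (induction p) (simp_all add: poly_at_pCons poly_at_add poly_at_smult algebra_simps)

lemma poly_at_diff: "poly_at (p - q) w = poly_at p w - poly_at q w"
  using poly_at_add[of "p - q" q w] by (simp add: algebra_simps)

lemma poly_at_sum: "poly_at (sum f S) w = (\<Sum>s\<in>S. poly_at (f s) w)"
  by (induction S rule: infinite_finite_induct) (simp_all add: poly_at_add)

lemma poly_at_monom: "poly_at (monom c k) w = const c * w ^ k"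
  by (induction k) (simp_all add: monom_0 monom_Suc poly_at_pCons mult.left_commute)

lemma der_poly_at: "der i (poly_at q w) = poly_at (pderiv q) w * der i w"
  by (induction q) (simp_all add: poly_at_pCons der_add der_mult pderiv_pCons poly_at_add algebra_simps)

text \<open>A truncation of $\log(1 + u)$.\<close>

definition trunc_log :: "nat \<Rightarrow> 'n::finite An \<Rightarrow> 'n An" where
  "trunc_log N u = (\<Sum>k<N. const ((-1) ^ k / of_nat (Suc k)) * u ^ Suc k)"

lemma der_trunc_log:
  assumes "der i u = 1 + u"
  shows "der i (trunc_log N u) = 1 - const ((-1) ^ N) * u ^ N"
proof (induction N)
  case (Suc N)
  have "der i (const ((-1) ^ N / of_nat (Suc N)) * u ^ Suc N) =
      const ((-1) ^ N / of_nat (Suc N) * of_nat (Suc N)) * (u ^ N * (1 + u))"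
    unfolding der_const_mult der_power assms const_mult by (simp only: mult.assoc)
  also have "(-1) ^ N / of_nat (Suc N) * of_nat (Suc N) = ((-1) ^ N :: complex)"
    by (simp del: of_nat_Suc)
  finally have "der i (const ((-1) ^ N / of_nat (Suc N)) * u ^ Suc N) = const ((-1) ^ N) * (u ^ N * (1 + u))" .
  then show ?case
    using Suc by (simp add: trunc_log_def der_add const_minus algebra_simps)
qed (simp add: trunc_log_def)

lemma der_trunc_log_0: "der i u = 0 \<Longrightarrow> der i (trunc_log N u) = 0"
  unfolding trunc_log_def der_sum der_const_mult der_power by simp

lemma trunc_log_eq: "\<exists>s. trunc_log (Suc N) u = u + u * u * s"
proof (induction N)
  case 0
  show ?case by (rule exI[of _ 0]) (simp add: trunc_log_def)
next
  case (Suc N)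
  then obtain s where "trunc_log (Suc N) u = u + u * u * s" by blast
  then have "trunc_log (Suc (Suc N)) u = u + u * u * (s + const ((-1) ^ Suc N / of_nat (Suc (Suc N))) * u ^ N)"
    unfolding trunc_log_def sum.lessThan_Suc[of _ "Suc N"] by (simp add: algebra_simps)
  then show ?case by blast
qed

primrec m10_power :: "nat \<Rightarrow> 'n::finite An set" where
  "m10_power 0 = UNIV"
| "m10_power (Suc k) = An.span {f * g |f g. f \<in> m10 \<and> g \<in> m10_power k}"

lemma m10_power_ideal:
  "0 \<in> m10_power k" "f \<in> m10_power k \<Longrightarrow> g \<in> m10_power k \<Longrightarrow> f + g \<in> m10_power k" "f \<in> m10_power k \<Longrightarrow> h * f \<in> m10_power k"
  "f \<in> m10_power k \<Longrightarrow> g \<in> m10_power k \<Longrightarrow> f - g \<in> m10_power k"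
  by (cases k; auto intro: An.span_zero An.span_add An.span_scale An.span_diff)+

lemma m10_power_mult_m10: "f \<in> m10 \<Longrightarrow> g \<in> m10_power k \<Longrightarrow> f * g \<in> m10_power (Suc k)"
  by (auto intro: An.span_base)

lemma m10_power_Suc_induct [consumes 1, case_names base add mult]:
  assumes "f \<in> m10_power (Suc k)"
    and base: "\<And>f g. f \<in> m10 \<Longrightarrow> g \<in> m10_power k \<Longrightarrow> P (f * g)"
    and add: "\<And>f g. f \<in> m10_power (Suc k) \<Longrightarrow> g \<in> m10_power (Suc k) \<Longrightarrow> P f \<Longrightarrow> P g \<Longrightarrow> P (f + g)"
    and mult: "\<And>f h. f \<in> m10_power (Suc k) \<Longrightarrow> P f \<Longrightarrow> P (h * f)"
  shows "P f"
proof -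
  have z: "P 0"
  proof -
    have "P (0 * 0)" by (rule base) (simp_all add: m10_0 m10_power_ideal)
    then show ?thesis by simp
  qed
  have "f \<in> An.span {f * g |f g. f \<in> m10 \<and> g \<in> m10_power k}" using assms(1) by simp
  then have "f \<in> m10_power (Suc k) \<and> P f"
  proof (rule An.span_induct)
    show "An.subspace {f. f \<in> m10_power (Suc k) \<and> P f}"
      by (rule An.subspaceI) (simp_all add: z add mult m10_power_ideal del: m10_power.simps)
    show "x \<in> m10_power (Suc k) \<and> P x" if "x \<in> {f * g |f g. f \<in> m10 \<and> g \<in> m10_power k}" for x
      using that base m10_power_mult_m10 by blast
  qed
  then show ?thesis ..
qed

lemma m10_power_Suc_subset: "m10_power (Suc k) \<subseteq> m10_power k"
proof
  show "f \<in> m10_power k" if "f \<in> m10_power (Suc k)" for f :: "'a An"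
    using that by (induction rule: m10_power_Suc_induct) (simp_all add: m10_power_ideal)
qed

lemma m10_power_antimono: "k \<le> l \<Longrightarrow> m10_power l \<subseteq> m10_power k"
  by (induction l rule: dec_induct) (use m10_power_Suc_subset in \<open>auto simp del: m10_power.simps\<close>)

lemma m10_power_Suc_m10: "m10_power (Suc k) \<subseteq> m10"
proof
  show "f \<in> m10" if "f \<in> m10_power (Suc k)" for f :: "'a An"
    using that
  proof (induction rule: m10_power_Suc_induct)
    case (base f g)
    then show ?case using m10_mult[of f g] by (simp add: mult.commute)
  qed (simp_all add: m10_add m10_mult)
qed

lemma m10_power_mult: "f \<in> m10_power k \<Longrightarrow> g \<in> m10_power l \<Longrightarrow> f * g \<in> m10_power (k + l)"
proof (induction k arbitrary: f g)
  case 0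
  then show ?case by (simp add: m10_power_ideal)
next
  case (Suc k)
  from Suc.prems(1) show ?case
  proof (induction rule: m10_power_Suc_induct)
    case (base a b)
    then show ?case using Suc.IH[OF base(2) Suc.prems(2)] m10_power_mult_m10[of a "b * g" "k + l"]
      by (simp add: mult.assoc del: m10_power.simps)
  next
    case (add a b)
    then show ?case by (simp add: ring_distribs m10_power_ideal del: m10_power.simps)
  next
    case (mult a h)
    then show ?case by (simp add: mult.assoc m10_power_ideal del: m10_power.simps)
  qed
qed

lemma der_m10_power: "f \<in> m10_power (Suc k) \<Longrightarrow> der j f \<in> m10_power k"
proof (induction k arbitrary: f)
  case (Suc k)
  from Suc.prems show ?case
  proof (induction rule: m10_power_Suc_induct)
    case (base a b)
    have "der j a * b + a * der j b \<in> m10_power (Suc k)"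
      using base by (intro m10_power_ideal m10_power_mult_m10 Suc.IH)
    then show ?case by (simp only: der_mult)
  next
    case (mult f h)
    have "der j h * f + h * der j f \<in> m10_power (Suc k)"
      using mult m10_power_Suc_subset by (intro m10_power_ideal) blast+
    then show ?case by (simp only: der_mult)
  qed (simp add: der_add m10_power_ideal del: m10_power.simps)
qed simp

locale simple_mDelta_module = mDelta_module scale V rho
  for scale :: "complex \<Rightarrow> 'v::ab_group_add \<Rightarrow> 'v" and V and rho :: "'n::finite vf \<Rightarrow> 'v \<Rightarrow> 'v" +
  assumes fd: "fin_dim scale V"
    and simple: "simple_lie_module scale vf_scale vf_bracket (mDelta :: 'n vf set) V rho"
begin

definition R :: "'n An \<Rightarrow> 'n \<Rightarrow> 'v \<Rightarrow> 'v" where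
  "R f i v = rho (axis i f) v"

lemma R_closed: "f \<in> m10 \<Longrightarrow> v \<in> V \<Longrightarrow> R f i v \<in> V"
  by (simp add: R_def act_closed axis_mDelta)

lemma R_add: "f \<in> m10 \<Longrightarrow> g \<in> m10 \<Longrightarrow> v \<in> V \<Longrightarrow> R (f + g) i v = R f i v + R g i v"
  by (simp add: R_def axis_linear act_add_left axis_mDelta)

lemma R_diff: "f \<in> m10 \<Longrightarrow> g \<in> m10 \<Longrightarrow> v \<in> V \<Longrightarrow> R (f - g) i v = R f i v - R g i v"
  by (simp add: R_def axis_linear act_diff_left axis_mDelta)

lemma R_const: "f \<in> m10 \<Longrightarrow> v \<in> V \<Longrightarrow> R (const c * f) i v = scale c (R f i v)"
  by (simp add: R_def axis_linear act_scale_left axis_mDelta)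

lemma R_zero: "v \<in> V \<Longrightarrow> R 0 i v = 0" "f \<in> m10 \<Longrightarrow> R f i 0 = 0"
  using R_add[of 0 0 v i] by (simp_all add: m10_0 R_def act_zero_right axis_mDelta)

lemma m10_mult_right: "f \<in> m10 \<Longrightarrow> f * g \<in> m10"
  using m10_mult[of f g] by (simp add: mult.commute)

lemma R_sum: "(\<And>s. s \<in> S \<Longrightarrow> f s \<in> m10) \<Longrightarrow> v \<in> V \<Longrightarrow> sum f S \<in> m10 \<and> R (sum f S) i v = (\<Sum>s\<in>S. R (f s) i v)"
  by (induction S rule: infinite_finite_induct) (simp_all add: R_zero R_add m10_0 m10_add)

lemma R_bracket:
  assumes "f \<in> m10" "g \<in> m10" "v \<in> V"
  shows "R f i (R g j v) - R g j (R f i v) = R (f * der i g) j v - R (g * der j f) i v"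
  using act_bracket[of "axis i f" "axis j g" v] assms
  by (simp add: R_def vf_bracket_axis act_diff_left axis_mDelta m10_mult_right)

lemma rho_components:
  assumes "X \<in> mDelta" "v \<in> V"
  shows "rho X v = (\<Sum>i\<in>UNIV. R (X $ i) i v)"
proof -
  have "(\<Sum>i\<in>S. axis i (X $ i)) \<in> mDelta \<and> rho (\<Sum>i\<in>S. axis i (X $ i)) v = (\<Sum>i\<in>S. R (X $ i) i v)" for S
  proof (induction S rule: infinite_finite_induct)
    case (insert i S)
    have "X $ i \<in> m10" using assms(1) by (simp add: mDelta_def)
    then show ?case using insert assms(2) by (simp add: act_add_left axis_mDelta mDelta_subalgebra R_def)
  qed (use act_add_left[of 0 0 v] assms(2) in \<open>simp_all add: mDelta_subalgebra\<close>)
  from this[of UNIV] show ?thesis by (simp add: vf_expand)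
qed

text \<open>The largest ideal $I$ of $A_n$ contained in $m_{1,0}$ such that $I\Delta$ annihilates the module.\<close>

definition ann :: "'n An set" where
  "ann = {f \<in> m10. \<forall>h i. \<forall>v\<in>V. R (h * f) i v = 0}"

lemma annD: "f \<in> ann \<Longrightarrow> f \<in> m10" "f \<in> ann \<Longrightarrow> v \<in> V \<Longrightarrow> R (h * f) i v = 0" "f \<in> ann \<Longrightarrow> v \<in> V \<Longrightarrow> R f i v = 0"
  "f \<in> ann \<Longrightarrow> v \<in> V \<Longrightarrow> R (f * h) i v = 0"
proof -
  show a: "f \<in> m10" "v \<in> V \<Longrightarrow> R (h * f) i v = 0" if "f \<in> ann" for f h i v using that by (auto simp: ann_def)
  show "R f i v = 0" "R (f * h) i v = 0" if "f \<in> ann" "v \<in> V"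
    using a(2)[OF that, of 1] a(2)[OF that, of h] by (simp_all add: mult.commute)
qed

lemma ann_ideal:
  "0 \<in> ann" "f \<in> ann \<Longrightarrow> g \<in> ann \<Longrightarrow> f + g \<in> ann" "f \<in> ann \<Longrightarrow> h * f \<in> ann" "f \<in> ann \<Longrightarrow> f * h \<in> ann"
  "f \<in> ann \<Longrightarrow> g \<in> ann \<Longrightarrow> f - g \<in> ann"
proof -
  show m: "h * f \<in> ann" if "f \<in> ann" for f h
    using that annD(2)[OF that, of _ "_ * h"] by (auto simp: ann_def m10_mult mult.assoc)
  then show "f \<in> ann \<Longrightarrow> f * h \<in> ann" by (simp add: mult.commute)
  show "0 \<in> ann" by (simp add: ann_def m10_0 R_zero)
  show p: "f + g \<in> ann" if "f \<in> ann" "g \<in> ann" for f g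
    using that by (auto simp: ann_def m10_add ring_distribs R_add m10_mult)
  show "f - g \<in> ann" if "f \<in> ann" "g \<in> ann"
    using p[OF that(1) m[OF that(2), of "-1"]] by simp
qed

lemma ann_sum: "(\<And>s. s \<in> S \<Longrightarrow> f s \<in> ann) \<Longrightarrow> sum f S \<in> ann"
  by (induction S rule: infinite_finite_induct) (simp_all add: ann_ideal)

lemma ann_power_mono: "w ^ N \<in> ann \<Longrightarrow> N \<le> K \<Longrightarrow> w ^ K \<in> ann"
  using ann_ideal(4)[of "w ^ N" "w ^ (K - N)"] by (simp flip: power_add)

text \<open>The vector fields acting by zero form an ideal, and $[h g d_j, f d_i] = h g d_j(f) d_i - f d_i(h g) d_j$.\<close>

lemma ann_stable:
  assumes "g \<in> m10" "f \<in> ann"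
  shows "g * der j f \<in> ann"
  unfolding ann_def
proof (intro CollectI conjI allI ballI)
  show "g * der j f \<in> m10" using assms(1) by (rule m10_mult_right)
  fix h i v assume v: "v \<in> V"
  have hg: "h * g \<in> m10" using assms(1) by (rule m10_mult)
  show "R (h * (g * der j f)) i v = 0"
    using R_bracket[OF hg annD(1)[OF assms(2)] v, of j i] annD(3,4)[OF assms(2)] v
    by (simp add: R_zero R_closed hg mult.assoc)
qed

text \<open>For $d_i(g) = h$ the bracket of $g f d_i$ with $f d_i$ is $- f^2 h d_i$, so $f^2 A_n d_i$ acts by zero. The bracket of
  $f^2 h d_i$ with $x_i d_j$ transports this to the other $d_j$.\<close>

lemma square_in_ann:
  assumes f: "f \<in> m10" "\<And>v. v \<in> V \<Longrightarrow> R f i v = 0" and d: "\<And>j. j \<noteq> i \<Longrightarrow> der j f = 0"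
  shows "f * f \<in> ann"
proof -
  have m: "f * f * h \<in> m10" for h using f(1) by (simp add: m10_mult_right mult.assoc)
  have i: "R (f * f * h) i v = 0" if v: "v \<in> V" for h v
  proof -
    obtain g where g: "der i g = h" using der_surj by blast
    have gf: "g * f \<in> m10" using f(1) by (rule m10_mult)
    have "R (g * f * der i f) i v - R (f * der i (g * f)) i v = 0"
      using R_bracket[OF gf f(1) v, of i i] f v gf by (simp add: R_zero R_closed)
    moreover have "f * der i (g * f) = g * f * der i f + f * f * h"
      by (simp add: der_mult g algebra_simps)
    ultimately show ?thesis
      using R_add[of "g * f * der i f" "f * f * h" v i, OF m10_mult_right[OF gf] m v] by simp
  qed
  have j: "R (f * f * h) j v = 0" if v: "v \<in> V" and "j \<noteq> i" for h j v
  proof -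
    have "R (f * f * h) i (R (xvar i) j v) - R (xvar i) j (R (f * f * h) i v) =
        R (f * f * h * der i (xvar i)) j v - R (xvar i * der j (f * f * h)) i v"
      by (rule R_bracket[OF m xvar_m10 v])
    moreover have "xvar i * der j (f * f * h) = f * f * (xvar i * der j h)"
      using d[OF \<open>j \<noteq> i\<close>] by (simp add: der_mult algebra_simps)
    ultimately show ?thesis
      using i v by (simp add: R_zero R_closed xvar_m10 der_xvar)
  qed
  have "R (h * (f * f)) j v = 0" if "v \<in> V" for h j v
    using i[OF that, of h] j[OF that, of j h] by (cases "j = i") (simp_all add: mult.commute)
  then show ?thesis using m[of 1] by (simp add: ann_def)
qed

text \<open>Two operators among infinitely many $w^{k+1} d_i$ being dependent, some polynomial in \<open>w\<close> acts by zero, and its square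
  lies in the ideal. Let $q(w)$ be such an element of least degree. Then $w q'(w) - (\deg q) q(w)$ has smaller degree and
  also lies in the ideal, so it is zero and $q$ is a monomial.\<close>

lemma power_in_ann:
  assumes w: "w \<in> m10" "\<And>j. j \<noteq> i \<Longrightarrow> der j w = 0" and e: "e * der i w = 1"
  shows "\<exists>N. w ^ N \<in> ann"
proof -
  obtain B where B: "finite B" "V \<subseteq> span B" using fd by (auto simp: fin_dim_def)
  have wk: "w ^ Suc k \<in> m10" for k using w(1) by (simp add: m10_mult_right)
  have endo: "endo_on V (R (w ^ Suc k) i)" for k
    using endo_act[OF axis_mDelta[OF wk], of i k] by (simp add: R_def[abs_def])
  obtain N c where c: "\<exists>k\<le>N. c k \<noteq> 0" "\<And>v. v \<in> V \<Longrightarrow> (\<Sum>k\<le>N. scale (c k) (R (w ^ Suc k) i v)) = 0"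
    using operator_relation[OF B subspace_V, of "\<lambda>k. R (w ^ Suc k) i"] endo by blast
  define q0 where "q0 = (\<Sum>k\<le>N. monom (c k) (Suc k))"
  have ev0: "poly_at q0 w = (\<Sum>k\<le>N. const (c k) * w ^ Suc k)"
    by (simp only: q0_def poly_at_sum poly_at_monom)
  have f: "poly_at q0 w \<in> m10" "R (poly_at q0 w) i v = 0" if "v \<in> V" for v
    using R_sum[of "{..N}" "\<lambda>k. const (c k) * w ^ Suc k" v i] that c(2)[OF that] wk
    unfolding ev0 by (simp_all add: m10_mult R_const del: power_Suc)
  have f1: "poly_at q0 w \<in> m10" using f(1)[OF subspace_0[OF subspace_V]] .
  have "poly_at q0 w * poly_at q0 w \<in> ann"
    by (rule square_in_ann[OF f1 f(2)]) (simp_all add: der_poly_at w(2))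
  then have "poly_at (q0 * q0) w \<in> ann" by (simp add: poly_at_mult)
  moreover have "q0 * q0 \<noteq> 0"
  proof -
    obtain k where k: "k \<le> N" "c k \<noteq> 0" using c(1) by blast
    have "coeff q0 (Suc k) = c k"
      using k(1) by (simp add: q0_def coeff_sum)
    then show ?thesis using k(2) by auto
  qed
  ultimately obtain q where q: "q \<noteq> 0" "poly_at q w \<in> ann" "\<And>p. p \<noteq> 0 \<Longrightarrow> poly_at p w \<in> ann \<Longrightarrow> degree q \<le> degree p"
    using ex_has_least_nat[of "\<lambda>q. q \<noteq> 0 \<and> poly_at q w \<in> ann" "q0 * q0" degree] by blast
  define r where "r = pCons 0 (pderiv q) - smult (of_nat (degree q)) q"
  have cr: "coeff r k = (of_nat k - of_nat (degree q)) * coeff q k" for k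
    by (cases k) (simp_all add: r_def coeff_pderiv algebra_simps)
  have "poly_at r w = e * (w * der i (poly_at q w)) - const (of_nat (degree q)) * poly_at q w"
  proof -
    have "e * (w * der i (poly_at q w)) = w * poly_at (pderiv q) w * (e * der i w)" by (simp add: der_poly_at algebra_simps)
    then show ?thesis by (simp add: r_def poly_at_diff poly_at_smult poly_at_pCons e)
  qed
  then have "poly_at r w \<in> ann" using q(2) ann_stable[OF w(1) q(2)] by (simp add: ann_ideal)
  moreover have "r = 0 \<or> degree r < degree q"
    by (rule eq_zero_or_degree_less[OF degree_le]) (auto simp: cr coeff_eq_0)
  ultimately have "r = 0" using q(3)[of r] by force
  then have "coeff q k = 0" if "k \<noteq> degree q" for k
    using cr[of k] that by simp
  then have "q = monom (lead_coeff q) (degree q)" by (intro poly_eqI) simp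
  then have "poly_at q w = const (lead_coeff q) * w ^ degree q" by (metis poly_at_monom)
  then have "const (inverse (lead_coeff q)) * poly_at q w = w ^ degree q"
    using q(1) by (simp flip: mult.assoc const_mult)
  then show ?thesis using ann_ideal(3)[OF q(2)] by metis
qed

lemma generator_power_in_ann: "\<exists>N. (tvar i - 1) ^ N \<in> ann" "\<exists>N. xvar i ^ N \<in> ann"
proof -
  have "axis i (-1) + axis i 1 = (0 :: int^'n)" by (simp add: vec_eq_iff axis_def)
  then have "mon (axis i (-1)) 0 * tvar i = (1 :: 'n An)" by (simp only: tvar_def mon_mult) simp
  then have "mon (axis i (-1)) 0 * der i (tvar i - 1) = (1 :: 'n An)" by (simp add: der_diff der_tvar)
  then show "\<exists>N. (tvar i - 1) ^ N \<in> ann"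
    by (rule power_in_ann[OF tvar_m10, rotated]) (simp add: der_diff der_tvar)
  show "\<exists>N. xvar i ^ N \<in> ann"
    by (rule power_in_ann[OF xvar_m10[of i], of i 1]) (simp_all add: der_xvar)
qed

lemma ann_power_sum:
  assumes "f ^ a \<in> ann" "g ^ b \<in> ann"
  shows "(f + g) ^ (a + b) \<in> ann"
  unfolding binomial_ring
proof (rule ann_sum)
  fix k
  show "of_nat (a + b choose k) * f ^ k * g ^ (a + b - k) \<in> ann"
  proof (cases "a \<le> k")
    case True
    then show ?thesis using ann_power_mono[OF assms(1)] by (simp add: ann_ideal)
  next
    case False
    then show ?thesis using ann_power_mono[OF assms(2), of "a + b - k"] by (simp add: ann_ideal)
  qed
qed

lemma rho_ann: "(\<And>i. X $ i \<in> ann) \<Longrightarrow> v \<in> V \<Longrightarrow> rho X v = 0"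
  by (subst rho_components) (simp_all add: mDelta_def annD)

text \<open>The ideals \<open>E\<close> for which $E\Delta$ is an ideal of $m_{1,0}\Delta$ acting by commuting operators.\<close>

definition commuting_ideal :: "'n An set \<Rightarrow> bool" where
  "commuting_ideal E \<longleftrightarrow> E \<subseteq> m10 \<and> (\<forall>f\<in>E. \<forall>g\<in>E. f + g \<in> E) \<and> (\<forall>f\<in>E. \<forall>h. h * f \<in> E) \<and>
     (\<forall>f\<in>E. \<forall>g\<in>m10. \<forall>j. g * der j f \<in> E) \<and> (\<forall>f\<in>E. \<forall>g\<in>E. \<forall>j. f * der j g \<in> ann)"

lemma commuting_idealI:
  assumes "E \<subseteq> m10" "\<And>f g. f \<in> E \<Longrightarrow> g \<in> E \<Longrightarrow> f + g \<in> E" "\<And>f h. f \<in> E \<Longrightarrow> h * f \<in> E"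
    "\<And>f g j. f \<in> E \<Longrightarrow> g \<in> m10 \<Longrightarrow> g * der j f \<in> E"
    "\<And>f g j. f \<in> E \<Longrightarrow> g \<in> E \<Longrightarrow> f * der j g \<in> ann"
  shows "commuting_ideal E"
  using assms by (simp add: commuting_ideal_def)

lemma commuting_idealD:
  assumes "commuting_ideal E"
  shows "E \<subseteq> m10" "f \<in> E \<Longrightarrow> g \<in> E \<Longrightarrow> f + g \<in> E" "f \<in> E \<Longrightarrow> h * f \<in> E"
    "f \<in> E \<Longrightarrow> g \<in> m10 \<Longrightarrow> g * der j f \<in> E" "f \<in> E \<Longrightarrow> g \<in> E \<Longrightarrow> f * der j g \<in> ann"
  using assms by (simp_all add: commuting_ideal_def)

lemma ideal_commutators_vanish:
  assumes ci: "commuting_ideal E"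
    and fg: "f \<in> E" "g \<in> m10" and v: "v \<in> V"
  shows "R (g * der i f) j v = R (f * der j g) i v"
proof -
  note E = commuting_idealD(1-3)[OF ci] and stable = commuting_idealD(4)[OF ci] and sq = commuting_idealD(5)[OF ci]
  have E0: "0 \<in> E" using E(3)[OF fg(1), of 0] by simp
  have Ed: "a - b \<in> E" if "a \<in> E" "b \<in> E" for a b using E(2)[OF that(1) E(3)[OF that(2), of "-1"]] by simp
  have Es: "sum h S \<in> E" if "\<And>s. h s \<in> E" for h and S :: "'n set"
    using that by (induction S rule: infinite_finite_induct) (simp_all add: E0 E(2))
  have Er: "a * h \<in> E" if "a \<in> E" for a h using E(3)[OF that, of h] by (simp add: mult.commute)
  let ?J = "{X :: 'n vf. \<forall>i. X $ i \<in> E}"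
  have "rho (vf_bracket (axis i g) (axis j f)) v = 0"
  proof (rule abelian_ideal_commutators_vanish[OF fd simple, of ?J])
    show "?J \<subseteq> mDelta" using E(1) by (auto simp: mDelta_def)
    show "vf_bracket Y X \<in> ?J" if "X \<in> ?J" "Y \<in> mDelta" for X Y
    proof -
      have "Y $ i * der i (X $ k) \<in> E" "X $ i * der i (Y $ k) \<in> E" for i k
        using that stable Er by (auto simp: mDelta_def)
      then show ?thesis by (auto simp: vf_bracket_def vf_act_def intro!: Ed Es)
    qed
    show "rho X (rho Y w) = rho Y (rho X w)" if "X \<in> ?J" "Y \<in> ?J" "w \<in> V" for X Y w
    proof -
      have XY: "X \<in> mDelta" "Y \<in> mDelta" using that E(1) by (auto simp: mDelta_def)
      have "rho (vf_bracket X Y) w = 0"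
      proof (rule rho_ann)
        have "X $ i * der i (Y $ k) \<in> ann" "Y $ i * der i (X $ k) \<in> ann" for i k
          using that sq by auto
        then show "vf_bracket X Y $ k \<in> ann" for k
          by (auto simp: vf_bracket_def vf_act_def intro!: ann_ideal(5) ann_sum)
      qed (rule \<open>w \<in> V\<close>)
      then show ?thesis using act_bracket[OF XY \<open>w \<in> V\<close>] by simp
    qed
    show "axis j f \<in> ?J" using fg(1) E0 by (simp add: axis_def)
    show "axis i g \<in> mDelta" using fg(2) by (rule axis_mDelta)
  qed (rule v)
  moreover have "g * der i f \<in> m10" "f * der j g \<in> m10"
    using fg E(1) by (auto intro: m10_mult_right)
  ultimately show ?thesis
    using v by (simp add: vf_bracket_axis act_diff_left axis_mDelta R_def)
qed

text \<open>The brackets $[g s d_i, f d_i]$ and $[g d_i, s f d_i]$ both act by zero, and they differ by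
  $-2 f g d_i(s) d_i$, where $d_i(s)$ is arbitrary.\<close>

lemma m10_times_ideal:
  assumes ci: "commuting_ideal E"
    and fg: "f \<in> E" "g \<in> m10"
  shows "g * f \<in> ann"
  unfolding ann_def
proof (intro CollectI conjI allI ballI)
  show "g * f \<in> m10" using fg(2) by (rule m10_mult_right)
  note E = commuting_idealD(1-3)[OF ci] and comm = ideal_commutators_vanish[OF ci]
  fix h :: "'n An" and i v assume v: "v \<in> V"
  obtain s where s: "der i s = h" using der_surj by blast
  have fm: "f \<in> m10" using fg(1) E(1) by blast
  have "g * s \<in> m10" using fg(2) by (rule m10_mult_right)
  then have 1: "R (g * s * der i f) i v = R (f * der i (g * s)) i v"
    by (rule comm[OF fg(1) _ v])
  have 2: "R (g * der i (s * f)) i v = R (s * f * der i g) i v"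
    by (rule comm[OF E(3)[OF fg(1)] fg(2) v])
  have m: "f * x \<in> m10" "g * x \<in> m10" "s * f * x \<in> m10" "h * (g * f) \<in> m10" "g * s * x \<in> m10" for x
    using fm fg(2) by (auto intro: m10_mult_right m10_mult simp: mult.assoc)
  have e1: "f * der i (g * s) = h * (g * f) + s * f * der i g" by (simp add: der_mult s algebra_simps)
  have e2: "g * der i (s * f) = h * (g * f) + g * s * der i f" by (simp add: der_mult s algebra_simps)
  have "R (h * (g * f)) i v + R (h * (g * f)) i v = 0"
    using 1 2 unfolding e1 e2 by (simp add: R_add m v)
  then have "scale 2 (R (h * (g * f)) i v) = 0"
    using scale_left_distrib[of 1 1 "R (h * (g * f)) i v"] by simp
  then show "R (h * (g * f)) i v = 0" by (simp only: scale_eq_0_iff) simp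
qed

text \<open>If $y^{2b}$ lies in the ideal, the ideal generated by $y^b$ is a commuting one, because the derivatives of \<open>y\<close> are
  negligible. The bracket of $x_i d_i$ with $k y^b d_i$ then acts by zero; it is $- k y^b d_i$ up to negligible terms. So
  the exponent of \<open>y\<close> can be halved.\<close>

lemma root_in_ann:
  assumes y: "y \<in> m10" "\<And>j. der j y \<in> ann" and M: "y ^ M \<in> ann"
  shows "y \<in> ann"
proof -
  have half: "y ^ b \<in> ann" if b: "b \<ge> 1" "y ^ (b + b) \<in> ann" for b
  proof -
    define E where "E = {f. \<exists>h. f - h * y ^ b \<in> ann}"
    have yb: "y ^ b \<in> m10" using b(1) y(1) by (cases b) (simp_all add: m10_mult_right)
    have dyb: "der j (y ^ b) \<in> ann" for j
      using b(1) y(2) by (cases b) (simp_all add: der_power ann_ideal del: power_Suc)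
    have E1: "E \<subseteq> m10"
    proof
      fix f assume "f \<in> E"
      then obtain h where "f - h * y ^ b \<in> ann" by (auto simp: E_def)
      then have "(f - h * y ^ b) + h * y ^ b \<in> m10" by (intro m10_add m10_mult yb annD(1))
      then show "f \<in> m10" by simp
    qed
    have E2: "f + g \<in> E" if fg: "f \<in> E" "g \<in> E" for f g
    proof -
      obtain h h' where "f - h * y ^ b \<in> ann" "g - h' * y ^ b \<in> ann" using fg by (auto simp: E_def)
      then have "(f - h * y ^ b) + (g - h' * y ^ b) \<in> ann" by (rule ann_ideal)
      then have "f + g - (h + h') * y ^ b \<in> ann" by (simp add: algebra_simps)
      then show ?thesis unfolding E_def by blast
    qed
    have E3: "k * f \<in> E" if "f \<in> E" for k f
    proof -
      from that obtain h where "f - h * y ^ b \<in> ann" by (auto simp: E_def)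
      then have "k * (f - h * y ^ b) \<in> ann" by (rule ann_ideal)
      then have "k * f - (k * h) * y ^ b \<in> ann" by (simp add: algebra_simps)
      then show ?thesis unfolding E_def by blast
    qed
    have dE: "g * der j f - (g * der j h) * y ^ b \<in> ann" if "f - h * y ^ b \<in> ann" "g \<in> m10" for f g h j
    proof -
      have "g * h * der j (y ^ b) + g * der j (f - h * y ^ b) \<in> ann"
        by (rule ann_ideal(2)[OF ann_ideal(3)[OF dyb] ann_stable[OF that(2,1)]])
      then show ?thesis by (simp add: der_diff der_mult algebra_simps)
    qed
    have E4: "g * der j f \<in> E" if "f \<in> E" "g \<in> m10" for f g j
      using that dE unfolding E_def by blast
    have E5: "f * der j g \<in> ann" if fg: "f \<in> E" "g \<in> E" for f g j
    proof -
      obtain h where h: "f - h * y ^ b \<in> ann" using fg(1) unfolding E_def by blast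
      obtain h' where h': "g - h' * y ^ b \<in> ann" using fg(2) unfolding E_def by blast
      have "y ^ b * der j g - (y ^ b * der j h') * y ^ b \<in> ann" by (rule dE[OF h' yb])
      moreover have "der j h' * (y ^ b * y ^ b) \<in> ann" using b(2) by (simp add: ann_ideal power_add)
      ultimately have "(y ^ b * der j g - (y ^ b * der j h') * y ^ b) + der j h' * (y ^ b * y ^ b) \<in> ann"
        by (rule ann_ideal)
      then have "y ^ b * der j g \<in> ann" by (simp add: algebra_simps)
      then have "h * (y ^ b * der j g) + (f - h * y ^ b) * der j g \<in> ann" using h
        by (intro ann_ideal(2) ann_ideal(3)[of "y ^ b * der j g"] ann_ideal(4)[of "f - h * y ^ b"])
      then show ?thesis by (simp add: algebra_simps)
    qed
    have ci: "commuting_ideal E" by (intro commuting_idealI E1 E2 E3 E4 E5)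
    have ybE: "k * y ^ b \<in> E" for k unfolding E_def by (intro CollectI exI[of _ k]) (simp add: ann_ideal)
    have "R (k * y ^ b) i v = 0" if v: "v \<in> V" for k i v
    proof -
      have "xvar i * der i (k * y ^ b) - (xvar i * der i k) * y ^ b \<in> ann"
        by (rule dE) (simp_all add: ann_ideal xvar_m10)
      moreover have "der i k * (xvar i * y ^ b) \<in> ann"
        using m10_times_ideal[OF ci ybE[of 1] xvar_m10[of i]] by (simp add: ann_ideal)
      ultimately have "(xvar i * der i (k * y ^ b) - (xvar i * der i k) * y ^ b) + der i k * (xvar i * y ^ b) \<in> ann"
        by (rule ann_ideal)
      then have "xvar i * der i (k * y ^ b) \<in> ann" by (simp add: algebra_simps)
      then have "R (xvar i * der i (k * y ^ b)) i v = 0" using v by (rule annD)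
      moreover have "R (xvar i * der i (k * y ^ b)) i v = R (k * y ^ b * der i (xvar i)) i v"
        by (rule ideal_commutators_vanish[OF ci ybE xvar_m10 v])
      ultimately show ?thesis by (simp add: der_xvar)
    qed
    then show ?thesis using yb by (simp add: ann_def)
  qed
  have "y ^ Suc k \<in> ann \<Longrightarrow> y \<in> ann" for k
  proof (induction k rule: less_induct)
    case (less k)
    show ?case
    proof (cases "k = 0")
      case False
      define b where "b = Suc (k div 2)"
      have "y ^ b \<in> ann"
        by (rule half) (use ann_power_mono[OF less.prems, of "b + b"] in \<open>simp_all add: b_def\<close>)
      then show ?thesis using less.IH[of "k div 2"] False by (simp add: b_def)
    qed (use less.prems in simp)
  qed
  then show ?thesis using ann_power_mono[OF M, of "Suc M"] by simp
qed

text \<open>The truncation $y$ of $\log t_i - x_i$ is a combination of powers of $t_i - 1$ and $x_i$, hence nilpotent modulo the ideal, and so lies in it by the preceding lemma.\<close>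

lemma tvar_minus_xvar_in_ann: "\<exists>q\<in>m10_power 2. tvar i - 1 - xvar i - q \<in> ann"
proof -
  define u where "u = tvar i - (1 :: 'n An)"
  have um: "u \<in> m10" by (simp add: u_def tvar_m10)
  have du: "der j u = (if j = i then 1 + u else 0)" for j by (simp add: u_def der_diff der_tvar)
  obtain N where N: "u ^ N \<in> ann" using generator_power_in_ann(1) unfolding u_def by blast
  obtain K where K: "xvar i ^ K \<in> ann" using generator_power_in_ann(2) by blast
  obtain s where s: "trunc_log (Suc N) u = u + u * u * s" using trunc_log_eq by blast
  define y where "y = trunc_log (Suc N) u - xvar i"
  have y: "y = (u + u * u * s) - xvar i" by (simp add: y_def s)
  have uN: "u ^ Suc N \<in> ann" by (rule ann_power_mono[OF N]) simp
  have ym: "y \<in> m10" unfolding y using um by (intro m10_diff m10_add xvar_m10 m10_mult_right)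
  have dy: "der j y \<in> ann" for j
  proof (cases "j = i")
    case True
    then have "der j y = - (const ((-1) ^ Suc N) * u ^ Suc N)"
      using der_trunc_log[of i u "Suc N"] du by (simp add: y_def der_diff der_xvar)
    also have "\<dots> = (- const ((-1) ^ Suc N)) * u ^ Suc N" by simp
    also have "\<dots> \<in> ann" using uN by (rule ann_ideal)
    finally show ?thesis .
  next
    case False
    then show ?thesis using der_trunc_log_0[of j u "Suc N"] du
      by (simp add: y_def der_diff der_xvar ann_ideal)
  qed
  have "(u * (1 + u * s)) ^ N \<in> ann" using N by (simp add: power_mult_distrib ann_ideal)
  moreover have "(- xvar i) ^ K \<in> ann" using K ann_ideal(3)[OF K, of "(-1) ^ K"] by (simp add: power_minus[of "xvar i"])
  moreover have "y = u * (1 + u * s) + - xvar i" by (simp add: y algebra_simps)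
  ultimately have "y ^ (N + K) \<in> ann" using ann_power_sum by metis
  then have "y \<in> ann" by (rule root_in_ann[OF ym dy])
  moreover have "- (u * u * s) \<in> m10_power 2"
  proof -
    have "u * 1 \<in> m10_power (Suc 0)" by (rule m10_power_mult_m10[OF um]) simp
    then have "u * (u * 1) \<in> m10_power (Suc (Suc 0))" by (rule m10_power_mult_m10[OF um])
    then have "(- s) * (u * (u * 1)) \<in> m10_power (Suc (Suc 0))" by (rule m10_power_ideal)
    then show ?thesis by (simp add: numeral_2_eq_2 algebra_simps del: m10_power.simps)
  qed
  moreover have "u - xvar i - (- (u * u * s)) = y" by (simp add: y)
  ultimately show ?thesis unfolding u_def by metis
qed

text \<open>\<open>C\<close> is the ideal of those \<open>f\<close> for which $m_{1,0}^N f$ lies in the annihilator for some \<open>N\<close>. An element all of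
  whose multiples by the finitely many generators \<open>W\<close> lie in \<open>C\<close> lies in \<open>C\<close> itself. If $1$ were not in \<open>C\<close>, a
  monomial in the generators of maximal degree outside \<open>C\<close> would contradict this; there is one, because large powers of
  the generators are in \<open>C\<close>.\<close>

lemma m10_power_subset_ann: "\<exists>N. m10_power N \<subseteq> ann"
proof -
  define W where "W = range (\<lambda>i. tvar i - (1 :: 'n An)) \<union> range xvar"
  have fW: "finite W" by (simp add: W_def)
  have m10_W: "m10 = An.span W" by (simp add: m10_def W_def)
  have "\<exists>N. w ^ N \<in> ann" if "w \<in> W" for w
    using that generator_power_in_ann by (auto simp: W_def)
  then obtain n where n: "\<And>w. w \<in> W \<Longrightarrow> w ^ n w \<in> ann" by metis
  define K where "K = (\<Sum>w\<in>W. n w)"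
  have K: "w ^ K \<in> ann" if "w \<in> W" for w
    by (rule ann_power_mono[OF n[OF that]]) (simp add: K_def member_le_sum fW that)
  define C where "C = {f. \<exists>N. \<forall>g\<in>m10_power N. g * f \<in> ann}"
  have C_mult: "h * f \<in> C" if "f \<in> C" for f h
  proof -
    from that obtain N where N: "\<forall>g\<in>m10_power N. g * f \<in> ann" by (auto simp: C_def)
    have "g * (h * f) \<in> ann" if "g \<in> m10_power N" for g
      using ann_ideal(3)[OF bspec[OF N that], of h] by (simp add: mult_ac)
    then show ?thesis by (auto simp: C_def)
  qed
  have ann_C: "f \<in> C" if "f \<in> ann" for f
    using that by (auto simp: C_def ann_ideal)
  have step: "f \<in> C" if wf: "\<And>w. w \<in> W \<Longrightarrow> w * f \<in> C" for f
  proof -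
    from wf obtain l where l: "\<And>w g. w \<in> W \<Longrightarrow> g \<in> m10_power (l w) \<Longrightarrow> g * (w * f) \<in> ann"
      unfolding C_def mem_Collect_eq by metis
    define N where "N = (\<Sum>w\<in>W. l w)"
    have lN: "g * (w * f) \<in> ann" if "w \<in> W" "g \<in> m10_power N" for w g
    proof (rule l[OF that(1)])
      have "l w \<le> N" by (simp add: N_def member_le_sum fW that)
      then show "g \<in> m10_power (l w)" using m10_power_antimono that(2) by blast
    qed
    have "g * f \<in> ann" if "g \<in> m10_power (Suc N)" for g
      using that
    proof (induction rule: m10_power_Suc_induct)
      case (base a g)
      have "a \<in> An.span W" using base(1) by (simp add: m10_W)
      then show ?case
      proof (rule An.span_induct)
        show "An.subspace {a. a * g * f \<in> ann}"
          by (rule An.subspaceI) (simp_all add: ann_ideal ring_distribs mult.assoc)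
        show "w * g * f \<in> ann" if "w \<in> W" for w
          using lN[OF that base(2)] by (simp add: mult_ac)
      qed
    qed (simp_all add: ring_distribs ann_ideal mult.assoc)
    then show ?thesis by (auto simp: C_def simp del: m10_power.simps)
  qed
  have "1 \<in> C"
  proof (rule ccontr)
    assume 1: "1 \<notin> C"
    define Mn where "Mn e = (\<Prod>w\<in>W. w ^ e w)" for e :: "'n An \<Rightarrow> nat"
    have bound: "e w < K" if "Mn e \<notin> C" "w \<in> W" for e w
    proof (rule ccontr)
      assume "\<not> e w < K"
      then have "w ^ e w \<in> ann" using ann_power_mono[OF K[OF that(2)]] by simp
      moreover have "Mn e = w ^ e w * (\<Prod>w\<in>W - {w}. w ^ e w)"
        unfolding Mn_def by (rule prod.remove[OF fW that(2)])
      ultimately have "Mn e \<in> ann" by (simp add: ann_ideal)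
      then show False using ann_C that(1) by blast
    qed
    have "(\<Sum>w\<in>W. e w) \<le> card W * K" if "Mn e \<notin> C" for e
      using sum_bounded_above[of W e K] bound[OF that] by (simp add: less_imp_le)
    moreover have "Mn (\<lambda>_. 0) \<notin> C" using 1 by (simp add: Mn_def)
    ultimately obtain e where e: "Mn e \<notin> C" "\<And>e'. Mn e' \<notin> C \<Longrightarrow> (\<Sum>w\<in>W. e' w) \<le> (\<Sum>w\<in>W. e w)"
      using Lattices_Big.ex_has_greatest_nat[of "\<lambda>e. Mn e \<notin> C" "\<lambda>_. 0" "\<lambda>e. \<Sum>w\<in>W. e w" "Suc (card W * K)"]
      by (auto simp: less_Suc_eq_le)
    from step[of "Mn e"] e(1) obtain w where w: "w \<in> W" "w * Mn e \<notin> C" by blast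
    let ?e = "e(w := Suc (e w))"
    have "Mn ?e = w ^ Suc (e w) * (\<Prod>w\<in>W - {w}. w ^ ?e w)"
      unfolding Mn_def by (subst prod.remove[OF fW w(1)]) simp
    also have "(\<Prod>w\<in>W - {w}. w ^ ?e w) = (\<Prod>w\<in>W - {w}. w ^ e w)" by (rule prod.cong) auto
    finally have "Mn ?e = w * Mn e"
      unfolding Mn_def by (subst (2) prod.remove[OF fW w(1)]) (simp add: mult.assoc)
    then have "(\<Sum>w\<in>W. ?e w) \<le> (\<Sum>w\<in>W. e w)" using w(2) e(2)[of ?e] by simp
    moreover have "(\<Sum>u\<in>W. ?e u) = Suc (\<Sum>u\<in>W. e u)"
    proof -
      have "(\<Sum>u\<in>W. ?e u) = Suc (e w) + (\<Sum>u\<in>W - {w}. ?e u)"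
        by (subst sum.remove[OF fW w(1)]) simp
      also have "(\<Sum>u\<in>W - {w}. ?e u) = (\<Sum>u\<in>W - {w}. e u)" by (rule sum.cong) auto
      finally show ?thesis by (simp add: sum.remove[OF fW w(1)])
    qed
    ultimately show False by simp
  qed
  then obtain N where "\<And>g. g \<in> m10_power N \<Longrightarrow> g \<in> ann" by (auto simp: C_def)
  then show ?thesis by blast
qed

definition euler :: "'n An \<Rightarrow> 'n An" where
  "euler f = (\<Sum>j\<in>UNIV. xvar j * der j f)"

lemma euler_add: "euler (f + g) = euler f + euler g"
  by (simp add: euler_def der_add ring_distribs sum.distrib)

lemma euler_mult: "euler (f * g) = euler f * g + f * euler g"
  by (simp add: euler_def der_mult ring_distribs sum.distrib sum_distrib_left sum_distrib_right mult_ac)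

lemma euler_m10: "euler f \<in> m10"
proof -
  have "(\<Sum>j\<in>S. xvar j * der j f) \<in> m10" for S
    by (induction S rule: infinite_finite_induct) (simp_all add: m10_0 m10_add m10_mult_right xvar_m10)
  then show ?thesis by (simp add: euler_def)
qed

text \<open>The ideal $m_{1,0}^k + I$, where $I$ is the annihilator.\<close>

definition plus_ann :: "nat \<Rightarrow> 'n An set" where
  "plus_ann k = {f. \<exists>q\<in>m10_power k. f - q \<in> ann}"

lemma plus_ann_ideal:
  "f \<in> plus_ann k \<Longrightarrow> g \<in> plus_ann k \<Longrightarrow> f + g \<in> plus_ann k"
  "f \<in> plus_ann k \<Longrightarrow> h * f \<in> plus_ann k"
  "f \<in> m10_power k \<Longrightarrow> f \<in> plus_ann k"
  "f \<in> m10 \<Longrightarrow> g \<in> plus_ann k \<Longrightarrow> f * g \<in> plus_ann (Suc k)"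
  "f \<in> plus_ann k \<Longrightarrow> g \<in> m10_power l \<Longrightarrow> f * g \<in> plus_ann (k + l)"
proof -
  assume "f \<in> plus_ann k" "g \<in> plus_ann k"
  then obtain p q where pq: "p \<in> m10_power k" "f - p \<in> ann" "q \<in> m10_power k" "g - q \<in> ann" by (auto simp: plus_ann_def)
  have "f + g - (p + q) = (f - p) + (g - q)" by simp
  also have "\<dots> \<in> ann" using pq by (intro ann_ideal(2))
  finally show "f + g \<in> plus_ann k" using m10_power_ideal(2)[OF pq(1,3)] unfolding plus_ann_def by blast
next
  assume "f \<in> plus_ann k"
  then obtain p where p: "p \<in> m10_power k" "f - p \<in> ann" by (auto simp: plus_ann_def)
  have "h * f - h * p = h * (f - p)" by (simp add: algebra_simps)
  also have "\<dots> \<in> ann" using p by (intro ann_ideal(3))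
  finally show "h * f \<in> plus_ann k" using m10_power_ideal(3)[OF p(1)] unfolding plus_ann_def by blast
next
  assume "f \<in> m10_power k"
  then show "f \<in> plus_ann k" unfolding plus_ann_def by (auto intro!: bexI[of _ f] simp: ann_ideal)
next
  assume f: "f \<in> m10" and "g \<in> plus_ann k"
  then obtain p where p: "p \<in> m10_power k" "g - p \<in> ann" by (auto simp: plus_ann_def)
  have "f * g - f * p = f * (g - p)" by (simp add: algebra_simps)
  also have "\<dots> \<in> ann" using p by (intro ann_ideal(3))
  finally show "f * g \<in> plus_ann (Suc k)" using m10_power_mult_m10[OF f p(1)] unfolding plus_ann_def by blast
next
  assume "f \<in> plus_ann k" and g: "g \<in> m10_power l"
  then obtain p where p: "p \<in> m10_power k" "f - p \<in> ann" by (auto simp: plus_ann_def)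
  have "f * g - p * g = (f - p) * g" by (simp add: algebra_simps)
  also have "\<dots> \<in> ann" using p by (intro ann_ideal(4))
  finally show "f * g \<in> plus_ann (k + l)" using m10_power_mult[OF p(1) g] unfolding plus_ann_def by blast
qed

text \<open>The Euler field fixes $x_i$, and it sends $t_i - 1$ to $x_i t_i$, which is congruent to $t_i - 1$ because
  $t_i - 1$ and $x_i$ agree modulo $m_{1,0}^2 + I$.\<close>

lemma euler_m10_mod:
  assumes "f \<in> m10"
  shows "euler f - f \<in> plus_ann 2"
proof -
  have x: "euler (xvar i) - xvar i = 0" for i
    by (simp add: euler_def der_xvar if_distrib cong: if_cong)
  have t: "euler (tvar i - 1) = xvar i * tvar i" for i
  proof -
    have "xvar j * der j (tvar i - 1) = (if j = i then xvar i * tvar i else 0)" for j :: 'n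
      by (simp add: der_diff der_tvar)
    then show ?thesis by (simp add: euler_def)
  qed
  have m1: "f \<in> m10_power (Suc 0)" if "f \<in> m10" for f :: "'n An"
    using m10_power_mult_m10[OF that, of 1 0] by simp
  have "f \<in> An.span (range (\<lambda>i. tvar i - 1) \<union> range xvar)" using assms by (simp add: m10_def)
  then have "f \<in> m10 \<and> euler f - f \<in> plus_ann 2"
  proof (rule An.span_induct)
    show "An.subspace {f. f \<in> m10 \<and> euler f - f \<in> plus_ann 2}"
    proof (rule An.subspaceI)
      have "euler 0 - 0 \<in> plus_ann 2" by (rule plus_ann_ideal(3)) (simp add: euler_def m10_power_ideal)
      then show "0 \<in> {f. f \<in> m10 \<and> euler f - f \<in> plus_ann 2}" by (simp add: m10_0)
      show "f + g \<in> {f. f \<in> m10 \<and> euler f - f \<in> plus_ann 2}"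
        if "f \<in> {f. f \<in> m10 \<and> euler f - f \<in> plus_ann 2}" "g \<in> {f. f \<in> m10 \<and> euler f - f \<in> plus_ann 2}" for f g
      proof -
        have "(euler f - f) + (euler g - g) \<in> plus_ann 2" using that by (intro plus_ann_ideal(1)) auto
        then show ?thesis using that by (simp add: euler_add m10_add algebra_simps)
      qed
      show "h * f \<in> {f. f \<in> m10 \<and> euler f - f \<in> plus_ann 2}"
        if "f \<in> {f. f \<in> m10 \<and> euler f - f \<in> plus_ann 2}" for h f
      proof -
        have "euler h * f \<in> m10_power (Suc (Suc 0))" using that m1 by (intro m10_power_mult_m10 euler_m10) auto
        then have "euler h * f \<in> plus_ann 2" by (intro plus_ann_ideal(3)) (simp add: numeral_2_eq_2 del: m10_power.simps)
        moreover have "h * (euler f - f) \<in> plus_ann 2" using that by (intro plus_ann_ideal(2)) auto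
        ultimately have "euler h * f + h * (euler f - f) \<in> plus_ann 2" by (rule plus_ann_ideal(1))
        then show ?thesis using that by (simp add: euler_mult m10_mult m10_mult_right algebra_simps)
      qed
    qed
    show "f \<in> m10 \<and> euler f - f \<in> plus_ann 2" if "f \<in> range (\<lambda>i. tvar i - 1) \<union> range xvar" for f
    proof -
      have "euler (xvar i) - xvar i \<in> plus_ann 2" for i
        unfolding x by (rule plus_ann_ideal(3)[OF m10_power_ideal(1)])
      moreover have "euler (tvar i - 1) - (tvar i - 1) \<in> plus_ann 2" for i
      proof -
        obtain q where "q \<in> m10_power 2" "tvar i - 1 - xvar i - q \<in> ann" using tvar_minus_xvar_in_ann by blast
        then have "tvar i - 1 - xvar i \<in> plus_ann 2" unfolding plus_ann_def by blast
        then have "(-1) * (tvar i - 1 - xvar i) \<in> plus_ann 2" by (rule plus_ann_ideal(2))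
        moreover have "xvar i * (tvar i - 1) \<in> m10_power (Suc (Suc 0))"
          by (intro m10_power_mult_m10 xvar_m10 m1 tvar_m10)
        then have "xvar i * (tvar i - 1) \<in> plus_ann 2"
          by (intro plus_ann_ideal(3)) (simp add: numeral_2_eq_2 del: m10_power.simps)
        ultimately have "(-1) * (tvar i - 1 - xvar i) + xvar i * (tvar i - 1) \<in> plus_ann 2"
          by (rule plus_ann_ideal(1))
        then show ?thesis by (simp add: t algebra_simps)
      qed
      ultimately show ?thesis using that by (auto simp: tvar_m10 xvar_m10)
    qed
  qed
  then show ?thesis ..
qed

lemma euler_m10_power: "f \<in> m10_power k \<Longrightarrow> euler f - const (of_nat k) * f \<in> plus_ann (Suc k)"
proof (induction k arbitrary: f)
  case 0
  have "euler f * 1 \<in> m10_power (Suc 0)" by (intro m10_power_mult_m10 euler_m10) simp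
  then show ?case by (simp add: plus_ann_ideal del: m10_power.simps)
next
  case (Suc k)
  let ?c = "const (of_nat (Suc k)) :: 'n An"
  have c: "?c = 1 + const (of_nat k)" by (simp only: of_nat_Suc const_add const_1)
  from Suc.prems show ?case
  proof (induction rule: m10_power_Suc_induct)
    case (base f g)
    have "f * (euler g - const (of_nat k) * g) \<in> plus_ann (Suc (Suc k))"
      using base Suc.IH by (intro plus_ann_ideal(4))
    moreover have "(euler f - f) * g \<in> plus_ann (2 + k)"
      using base euler_m10_mod by (intro plus_ann_ideal(5))
    ultimately have "f * (euler g - const (of_nat k) * g) + (euler f - f) * g \<in> plus_ann (Suc (Suc k))"
      by (intro plus_ann_ideal(1)) simp_all
    moreover have "f * (euler g - const (of_nat k) * g) + (euler f - f) * g = euler (f * g) - ?c * (f * g)"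
      unfolding c by (simp add: euler_mult algebra_simps)
    ultimately show ?case by simp
  next
    case (add f g)
    have "(euler f - ?c * f) + (euler g - ?c * g) \<in> plus_ann (Suc (Suc k))" by (intro plus_ann_ideal(1) add.IH)
    moreover have "(euler f - ?c * f) + (euler g - ?c * g) = euler (f + g) - ?c * (f + g)"
      by (simp add: euler_add algebra_simps)
    ultimately show ?case by simp
  next
    case (mult f h)
    have "euler h * f \<in> plus_ann (Suc (Suc k))"
      by (intro plus_ann_ideal(3) m10_power_mult_m10 euler_m10 mult.hyps)
    then have "h * (euler f - ?c * f) + euler h * f \<in> plus_ann (Suc (Suc k))"
      by (rule plus_ann_ideal(1)[OF plus_ann_ideal(2)[OF mult.IH]])
    moreover have "h * (euler f - ?c * f) + euler h * f = euler (h * f) - ?c * (h * f)"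
      by (simp add: euler_mult algebra_simps)
    ultimately show ?case by simp
  qed
qed

text \<open>The bracket of $x_j d_j$ with $f d_i$ acts by zero for $f$ in $m_{1,0}^k$. Summing over \<open>j\<close>, the action of
  \<open>euler f\<close> along $d_i$ equals that of \<open>f\<close>; by Euler's identity it is also \<open>k\<close> times that of \<open>f\<close>.\<close>

lemma m10_power_step:
  assumes k: "k \<ge> 2" and sub: "m10_power (Suc k) \<subseteq> ann"
  shows "m10_power k \<subseteq> ann"
proof -
  obtain l where l: "k = Suc l" "l \<ge> 1" using k by (cases k) auto
  have m: "m10_power k \<subseteq> m10" unfolding l by (rule m10_power_Suc_m10)
  have ci: "commuting_ideal (m10_power k)"
  proof (rule commuting_idealI[OF m m10_power_ideal(2,3)])
    show "g * der j f \<in> m10_power k" if "f \<in> m10_power k" "g \<in> m10" for f g j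
      using that der_m10_power[of f l j] unfolding l by (intro m10_power_mult_m10)
    show "f * der j g \<in> ann" if "f \<in> m10_power k" "g \<in> m10_power k" for f g j
    proof -
      have "f * der j g \<in> m10_power (k + l)" using that der_m10_power[of g l j] unfolding l by (intro m10_power_mult)
      then show ?thesis using sub m10_power_antimono[of "Suc k" "k + l"] l(2) by auto
    qed
  qed
  have R0: "R f i v = 0" if f: "f \<in> m10_power k" and v: "v \<in> V" for f i v
  proof -
    have fm: "f \<in> m10" using f m by blast
    have "euler f - const (of_nat k) * f \<in> plus_ann (Suc k)" by (rule euler_m10_power[OF f])
    then obtain q where q: "q \<in> m10_power (Suc k)" "euler f - const (of_nat k) * f - q \<in> ann"
      by (auto simp: plus_ann_def simp del: m10_power.simps)
    have "(euler f - const (of_nat k) * f - q) + q \<in> ann" using q sub by (intro ann_ideal(2)) auto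
    then have "R (euler f - const (of_nat k) * f) i v = 0" using v by (intro annD(3)) simp_all
    then have 1: "R (euler f) i v = scale (of_nat k) (R f i v)"
      using v fm by (simp add: R_diff R_const euler_m10 m10_mult)
    have "R (xvar j * der j f) i v = (if j = i then R f i v else 0)" for j
      using ideal_commutators_vanish[OF ci f xvar_m10[of j] v, of j i] v by (simp add: der_xvar R_zero)
    then have "R (euler f) i v = R f i v"
      using R_sum[of UNIV "\<lambda>j. xvar j * der j f" v i] v by (simp add: euler_def m10_mult_right xvar_m10)
    with 1 have "scale (of_nat k - 1) (R f i v) = 0"
      by (simp add: scale_left_diff_distrib)
    then show ?thesis using k by (auto simp: of_nat_eq_1_iff)
  qed
  show ?thesis
  proof
    fix f :: "'n An" assume f: "f \<in> m10_power k"
    have "R (h * f) i v = 0" if "v \<in> V" for h i v by (rule R0[OF m10_power_ideal(3)[OF f] that])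
    then show "f \<in> ann" using f m by (auto simp: ann_def)
  qed
qed

lemma m10_squared_in_ann: "m10_power 2 \<subseteq> ann"
proof -
  obtain N where "m10_power N \<subseteq> ann" using m10_power_subset_ann by blast
  then have "m10_power (2 + N) \<subseteq> ann" using m10_power_antimono[of N "2 + N"] by auto
  then show ?thesis
  proof (induction N)
    case (Suc N)
    then show ?case using m10_power_step[of "2 + N"] by simp
  qed simp
qed

text \<open>The function $f - \sum_k \varepsilon(d_k f) x_k$ lies in the annihilator for $f$ in $m_{1,0}$: this holds for the
  generators, and passing to multiples only changes the function by elements of $m_{1,0}^2$.\<close>

theorem gl_proj_kernel_acts_trivially:
  assumes X: "X \<in> mDelta" "gl_proj X = 0" and v: "v \<in> V"
  shows "rho X v = 0"
proof (rule rho_ann[OF _ v])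
  fix i
  have e: "eval10 (der k (X $ i)) = 0" for k using X(2) by (simp add: gl_proj_def vec_eq_iff)
  define L where "L f = f - (\<Sum>k\<in>UNIV. const (eval10 (der k f)) * xvar k)" for f :: "'n An"
  have L_add: "L (f + g) = L f + L g" for f g
    by (simp add: L_def der_add eval10_add const_add ring_distribs sum.distrib)
  have m1: "f \<in> m10_power (Suc 0)" if "f \<in> m10" for f :: "'n An"
    using m10_power_mult_m10[OF that, of 1 0] by simp
  have sq: "f * g \<in> ann" if "f \<in> m10" "g \<in> m10" for f g
    using m10_power_mult_m10[OF that(1) m1[OF that(2)]] m10_squared_in_ann by (auto simp: numeral_2_eq_2 simp del: m10_power.simps)
  have "L f \<in> ann" if "f \<in> m10" for f
  proof -
    have "f \<in> An.span (range (\<lambda>i. tvar i - 1) \<union> range xvar)" using that by (simp add: m10_def)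
    then have "f \<in> m10 \<and> L f \<in> ann"
    proof (rule An.span_induct)
      show "An.subspace {f. f \<in> m10 \<and> L f \<in> ann}"
      proof (rule An.subspaceI)
        show "0 \<in> {f. f \<in> m10 \<and> L f \<in> ann}" by (simp add: L_def m10_0 ann_ideal)
        show "h * f \<in> {f. f \<in> m10 \<and> L f \<in> ann}" if "f \<in> {f. f \<in> m10 \<and> L f \<in> ann}" for h f
        proof -
          have f: "f \<in> m10" "eval10 f = 0" using that by (simp_all add: m10_eq)
          have "h - const (eval10 h) \<in> m10" by (simp add: m10_eq eval10_diff eval10_const)
          then have "(reduced h) * f + const (eval10 h) * L f \<in> ann"
            using that f by (intro ann_ideal(2) sq ann_ideal(3)) auto
          moreover have "(reduced h) * f + const (eval10 h) * L f = L (h * f)"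
            by (simp add: L_def der_mult eval10_add eval10_mult f(2) const_mult sum_distrib_left algebra_simps)
          ultimately show ?thesis using f by (simp add: m10_mult)
        qed
      qed (auto simp: L_add ann_ideal m10_add)
      have "L (xvar k) = 0" for k
        by (simp add: L_def der_xvar if_distrib[of eval10] if_distrib[of const] if_distrib[of "\<lambda>c. c * _"] cong: if_cong)
      moreover have "L (tvar k - 1) \<in> ann" for k
      proof -
        obtain q where q: "q \<in> m10_power 2" "tvar k - 1 - xvar k - q \<in> ann" using tvar_minus_xvar_in_ann by blast
        then have "(tvar k - 1 - xvar k - q) + q \<in> ann" using m10_squared_in_ann by (intro ann_ideal(2)) auto
        moreover have "L (tvar k - 1) = tvar k - 1 - xvar k"
          by (simp add: L_def der_diff der_tvar if_distrib[of eval10] eval10_tvar if_distrib[of const]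
              if_distrib[of "\<lambda>c. c * _"] cong: if_cong)
        ultimately show ?thesis by simp
      qed
      ultimately show "f \<in> m10 \<and> L f \<in> ann" if "f \<in> range (\<lambda>i. tvar i - 1) \<union> range xvar" for f
        using that by (auto simp: tvar_m10 xvar_m10 ann_ideal)
    qed
    then show ?thesis ..
  qed
  then have "L (X $ i) \<in> ann" using X(1) by (simp add: mDelta_def)
  then show "X $ i \<in> ann" by (simp add: L_def e)
qed

end

section \<open>Simple cuspidal modules\<close>

lemma AG_isomorphic_from_inverse:
  assumes bij: "bij_betw \<psi> N M"
    and add: "\<And>y z. y \<in> N \<Longrightarrow> z \<in> N \<Longrightarrow> y + z \<in> N \<and> \<psi> (y + z) = \<psi> y + \<psi> z"
    and scale: "\<And>c z. z \<in> N \<Longrightarrow> scaleN c z \<in> N \<and> \<psi> (scaleN c z) = scaleM c (\<psi> z)"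
    and A: "\<And>f z. z \<in> N \<Longrightarrow> aactN f z \<in> N \<and> \<psi> (aactN f z) = aactM f (\<psi> z)"
    and G: "\<And>X z. z \<in> N \<Longrightarrow> gactN X z \<in> N \<and> \<psi> (gactN X z) = gactM X (\<psi> z)"
  shows "AG_isomorphic scaleM M aactM gactM scaleN N aactN gactN"
proof -
  define \<phi> where "\<phi> = the_inv_into N \<psi>"
  have inj: "inj_on \<psi> N" and img: "\<psi> ` N = M" using bij by (auto simp: bij_betw_def)
  have \<phi>\<psi>: "\<phi> (\<psi> z) = z" if "z \<in> N" for z unfolding \<phi>_def by (rule the_inv_into_f_f[OF inj that])
  have \<phi>N: "\<phi> v \<in> N" and \<psi>\<phi>: "\<psi> (\<phi> v) = v" if "v \<in> M" for v
    using that img unfolding \<phi>_def by (auto simp: the_inv_into_f_f[OF inj])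
  have \<phi>I: "\<phi> v = z" if "z \<in> N" "\<psi> z = v" for v z using \<phi>\<psi>[OF that(1)] that(2) by simp
  show ?thesis
    unfolding AG_isomorphic_def
  proof (intro exI[of _ \<phi>] conjI ballI allI)
    show "bij_betw \<phi> M N" unfolding \<phi>_def by (rule bij_betw_the_inv_into[OF bij])
  qed (intro \<phi>I; use add scale A G \<phi>N \<psi>\<phi> in simp)+
qed

context AG_module
begin

text \<open>The multiplication map $p \otimes v \mapsto p \cdot \iota(v)$ respects $A_n$, the derivations and the operators \<open>th\<close>,
  hence $g_n$. Its image and kernel are submodules of simple modules.\<close>

theorem isomorphic_tensor_module:
  fixes \<iota> :: "'w::ab_group_add \<Rightarrow> 'v"
  assumes simpleM: "simple_AG_module smul M aact gact"
    and simpleV: "simple_lie_module scaleV vf_scale vf_bracket (mDelta :: 'n vf set) V rho"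
    and \<iota>M: "\<And>v. v \<in> V \<Longrightarrow> \<iota> v \<in> M"
    and \<iota>add: "\<And>u v. u \<in> V \<Longrightarrow> v \<in> V \<Longrightarrow> \<iota> (u + v) = \<iota> u + \<iota> v"
    and \<iota>scale: "\<And>c v. v \<in> V \<Longrightarrow> \<iota> (scaleV c v) = smul c (\<iota> v)"
    and \<iota>inj: "\<And>v. v \<in> V \<Longrightarrow> \<iota> v = 0 \<Longrightarrow> v = 0"
    and weight: "\<And>i v. v \<in> V \<Longrightarrow> gact (axis i 1) (\<iota> v) = smul (lam $ i) (\<iota> v)"
    and equiv: "\<And>f i v. v \<in> V \<Longrightarrow> \<iota> (rho (axis i (reduced f)) v) = th f i (\<iota> v)"
  shows "AG_isomorphic smul M aact gact
    (T_scale scaleV) (T_space V) (T_fun scaleV (*)) (T_vf scaleV (*) (Alam_d lam) rho)"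
proof -
  interpret D: Dn_mDelta_module smul M aact "ga 1" th by (rule Dn_mDelta_module_th)
  interpret L: lie_module scaleV vf_scale vf_bracket "mDelta :: 'n vf set" V rho
    using simpleV by (simp add: simple_lie_module_def)
  interpret S: tensor_setting scaleV V rho lam by unfold_locales
  let ?N = "T_space V :: ('n exponent \<Rightarrow>\<^sub>0 'w) set"
  let ?G = "T_vf scaleV (*) (Alam_d lam) rho"
  have \<iota>0: "\<iota> 0 = 0" using \<iota>add[of 0 0] S.V_cl(1) by simp
  define \<psi> where "\<psi> = S.lin_ext (\<lambda>b v. aact (single b 1) (\<iota> v))"
  have \<psi>add: "\<psi> (y + z) = \<psi> y + \<psi> z" if "y \<in> ?N" "z \<in> ?N" for y z
    unfolding \<psi>_def using that by (intro S.lin_ext_add) (simp_all add: \<iota>add aact_add_right \<iota>M)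
  have \<psi>t: "\<psi> (tensor scaleV p v) = aact p (\<iota> v)" if v: "v \<in> V" for p v
  proof -
    have e: "lookup (tensor scaleV p v) b = scaleV (lookup p b) v" for p b by simp
    have "\<psi> (tensor scaleV p v) = (\<Sum>b\<in>keys p. aact (single b 1) (\<iota> (scaleV (lookup p b) v)))"
      unfolding \<psi>_def S.lin_ext_def
      by (simp add: e) (rule sum.mono_neutral_left; auto simp: in_keys_iff \<iota>0 aact_zero)
    also have "\<dots> = (\<Sum>b\<in>keys p. aact (const (lookup p b) * single b 1) (\<iota> v))"
      using v by (simp add: \<iota>scale aact_scale \<iota>M aact_mult aact_const aact_closed)
    also have "\<dots> = aact (\<Sum>b\<in>keys p. const (lookup p b) * single b 1) (\<iota> v)"
    proof -
      have "aact (sum g T) (\<iota> v) = (\<Sum>b\<in>T. aact (g b) (\<iota> v))" for g and T :: "'n exponent set"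
        by (induction T rule: infinite_finite_induct) (simp_all add: aact_zero aact_add_left \<iota>M v)
      then show ?thesis by simp
    qed
    also have "(\<Sum>b\<in>keys p. const (lookup p b) * single b 1) = p"
      using An_sum_monomials[of p] by (simp add: mon_def)
    finally show ?thesis .
  qed
  note N_cl = S.T_space_cl S.T_ops_closed and tens = S.T_fun_on_tensor S.T_d_on_tensor S.T_th_on_tensor S.rho_aug_closed
  have \<psi>M: "\<psi> z \<in> M" if "z \<in> ?N" for z
    using that by (induction z rule: S.T_space_induct) (simp_all add: \<psi>t \<psi>add aact_closed \<iota>M M_cl)
  have \<psi>s: "\<psi> (T_scale scaleV c z) = smul c (\<psi> z)" if "z \<in> ?N" for c z
    using that
    by (induction z rule: S.T_space_induct)
      (simp_all add: L.tensor_bilinear(4)[symmetric] S.V_cl \<psi>t \<iota>scale aact_scale \<iota>M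
        S.T.scale_right_distrib \<psi>add N_cl scale_right_distrib)
  have \<psi>A: "\<psi> (T_fun scaleV (*) f z) = aact f (\<psi> z)" if "z \<in> ?N" for f z
    using that by (induction z rule: S.T_space_induct)
      (simp_all add: tens \<psi>t aact_mult \<iota>M S.T_fun_add \<psi>add N_cl aact_add_right \<psi>M)
  have \<psi>d: "\<psi> (S.T_d i z) = ga 1 i (\<psi> z)" if "z \<in> ?N" for i z
    using that
  proof (induction z rule: S.T_space_induct)
    case (tensor p v)
    have "ga 1 i (aact p (\<iota> v)) = aact p (smul (lam $ i) (\<iota> v)) + aact (der i p) (\<iota> v)"
      using ga_aact[OF \<iota>M[OF tensor], of 1 i p] weight[OF tensor] by (simp add: ga_def)
    then show ?case
      using tensor by (simp add: tens \<psi>t Alam_d_def pm_scale_const aact_add_left aact_mult aact_const aact_scale \<iota>M aact_closed)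
  qed (simp add: S.T_d_add \<psi>add N_cl ga_linear \<psi>M)
  have \<psi>th: "\<psi> (S.T_th f i z) = th f i (\<psi> z)" if "z \<in> ?N" for f i z
    using that by (induction z rule: S.T_space_induct)
      (simp_all add: tens \<psi>t equiv D.th_aact \<iota>M S.T_th_add \<psi>add N_cl D.th_add_right \<psi>M)
  have \<psi>G: "\<psi> (?G X z) = gact X (\<psi> z)" if z: "z \<in> ?N" for X z
  proof -
    have \<psi>sum: "\<psi> (\<Sum>i\<in>T. w i) = (\<Sum>i\<in>T. \<psi> (w i))" if "\<And>i. w i \<in> ?N" for w and T :: "'n set"
    proof -
      have "\<psi> 0 = 0" by (simp add: \<psi>_def S.lin_ext_def)
      then show ?thesis using that
        by (induction T rule: infinite_finite_induct) (simp_all add: \<psi>add S.T_space_sum)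
    qed
    have "\<psi> (coprod_sum f (\<lambda>x y. T_fun scaleV (*) x (S.T_th y i z))) = coprod_sum f (\<lambda>x y. aact x (th y i (\<psi> z)))" for f i
      by (subst coprod_sum_hom[where N = ?N]) (simp_all add: N_cl \<psi>add \<psi>A \<psi>th z)
    then have op: "\<psi> (S.T.op f i z) = D.op f i (\<psi> z)" for f i
      using z by (simp add: S.T.op_def D.op_def \<psi>add N_cl S.T.coprod_sum_N \<psi>A \<psi>d)
    have "\<psi> (?G X z) = D.gop X (\<psi> z)"
      using z by (simp add: S.T_vf_eq_gop S.T.gop_def D.gop_def \<psi>sum S.T.op_closed op)
    then show ?thesis using gop_eq_gact[OF \<psi>M[OF z]] by simp
  qed
  have G_cl: "?G X z \<in> ?N" if "z \<in> ?N" for X z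
    using that by (simp add: S.T_vf_eq_gop S.T.gop_def S.T_space_sum S.T.op_closed)
  obtain v where v: "v \<in> V" "v \<noteq> 0"
    using simpleV S.V_cl(1) unfolding simple_lie_module_def by blast
  have v1: "\<psi> (tensor scaleV 1 v) \<noteq> 0"
    using \<iota>inj[OF v(1)] v(2) aact_const[OF \<iota>M[OF v(1)], of 1] by (auto simp: \<psi>t v(1))
  have "\<psi> ` ?N = M"
  proof -
    have "subspace (\<psi> ` ?N)"
    proof (rule subspaceI)
      have "\<psi> 0 = 0" by (simp add: \<psi>_def S.lin_ext_def)
      then show "0 \<in> \<psi> ` ?N" by (metis S.T_space_cl(1) imageI)
      show "x + y \<in> \<psi> ` ?N" if xy: "x \<in> \<psi> ` ?N" "y \<in> \<psi> ` ?N" for x y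
      proof -
        obtain a b where "a \<in> ?N" "b \<in> ?N" "x = \<psi> a" "y = \<psi> b" using xy by blast
        then show ?thesis using \<psi>add S.T_space_cl(2) by (metis imageI)
      qed
      show "smul c x \<in> \<psi> ` ?N" if "x \<in> \<psi> ` ?N" for c x
        using that \<psi>s S.T_space_cl(3) by (metis (no_types, lifting) imageE imageI)
    qed
    moreover have "\<forall>f. \<forall>w\<in>\<psi> ` ?N. aact f w \<in> \<psi> ` ?N"
      using \<psi>A S.T_ops_closed(1) by (metis (no_types, lifting) imageE imageI)
    moreover have "\<forall>X. \<forall>w\<in>\<psi> ` ?N. gact X w \<in> \<psi> ` ?N"
      using \<psi>G G_cl by (metis (no_types, lifting) imageE imageI)
    moreover have "\<psi> ` ?N \<subseteq> M" using \<psi>M by blast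
    ultimately have "\<psi> ` ?N = {0} \<or> \<psi> ` ?N = M"
      using simpleM unfolding simple_AG_module_def by blast
    moreover have "\<psi> (tensor scaleV 1 v) \<in> \<psi> ` ?N" using v(1) by (simp add: S.T_space_cl)
    ultimately show ?thesis using v1 by blast
  qed
  moreover have "inj_on \<psi> ?N"
  proof -
    let ?K = "{z \<in> ?N. \<psi> z = 0}"
    have "\<psi> 0 = 0" by (simp add: \<psi>_def S.lin_ext_def)
    then have "S.T.subspace ?K"
      by (intro S.T.subspaceI) (simp_all add: S.T_space_cl \<psi>add \<psi>s)
    moreover have "\<forall>f. \<forall>w\<in>?K. T_fun scaleV (*) f w \<in> ?K" by (simp add: \<psi>A N_cl aact_zero)
    moreover have "\<forall>X. \<forall>w\<in>?K. ?G X w \<in> ?K" by (simp add: \<psi>G G_cl act_zero_right)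
    moreover have "?K \<subseteq> ?N" by blast
    ultimately have "?K = {0} \<or> ?K = ?N"
      using S.simple_T[OF simpleV] unfolding simple_AG_module_def by blast
    moreover have "tensor scaleV 1 v \<in> ?N" using v(1) by (rule S.T_space_cl)
    ultimately have K: "?K = {0}" using v1 by blast
    show ?thesis
    proof (rule inj_onI)
      fix y z assume yz: "y \<in> ?N" "z \<in> ?N" "\<psi> y = \<psi> z"
      have "y - z \<in> ?N" using S.T.N_cl(3)[OF yz(1,2)] .
      moreover have "\<psi> (y - z) = 0" using \<psi>add[OF \<open>y - z \<in> ?N\<close> yz(2)] yz(3) by simp
      ultimately have "y - z \<in> ?K" by simp
      then show "y = z" unfolding K by simp
    qed
  qed
  ultimately have "bij_betw \<psi> ?N M" by (simp add: bij_betw_def)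
  then show ?thesis
    by (rule AG_isomorphic_from_inverse) (simp_all add: \<psi>add \<psi>s \<psi>A \<psi>G N_cl G_cl)
qed

text \<open>The commuting operators $d_i - \lambda_i$ are locally nilpotent on a generalized weight space, so one after the other can be made to vanish on a nonzero vector.\<close>

lemma weight_vector_exists:
  assumes gen: "gen_weight_module smul M gact" and M0: "M \<noteq> {0}"
  shows "\<exists>lam \<in> supp smul M gact. weight_space smul M gact lam \<noteq> {0}"
proof -
  obtain v where v: "v \<in> M" "v \<noteq> 0" using M0 M_cl(1) by blast
  then obtain w :: "complex^'n \<Rightarrow>\<^sub>0 'v" where w: "\<And>lam. lookup w lam \<in> gen_weight_space smul M gact lam"
    "v = (\<Sum>lam \<in> keys w. lookup w lam)"
    using gen unfolding gen_weight_module_def by metis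
  then obtain lam where lam: "lam \<in> keys w" using v(2) by fastforce
  define u0 where "u0 = lookup w lam"
  have u0: "u0 \<in> gen_weight_space smul M gact lam" "u0 \<noteq> 0"
    using w(1) lam by (auto simp: u0_def in_keys_iff)
  have "lam \<in> supp smul M gact" using u0 by (auto simp: supp_def)
  define Q where "Q i w = gact (axis i 1) w - smul (lam $ i) w" for i w
  have Qga: "Q i w = ga 1 i w - smul (lam $ i) w" for i w by (simp add: Q_def ga_def)
  have QM: "Q i w \<in> M" if "w \<in> M" for i w using that by (simp add: Qga M_cl ga_closed)
  have QkM: "(Q i ^^ k) w \<in> M" if "w \<in> M" for i k w using that by (induction k) (simp_all add: QM)
  have Qcomm: "Q i (Q j w) = Q j (Q i w)" if "w \<in> M" for i j w
    using ga_ga[OF that, of 1 i 1 j] that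
    by (simp add: Qga ga_diff ga_linear ga_closed M_cl ga_0 scale_right_diff_distrib mult.commute algebra_simps)
  have Q0: "Q i 0 = 0" for i using ga_linear(4)[OF M_cl(1), of 1 i 0] by (simp add: Qga)
  have Qk0: "(Q i ^^ k) 0 = 0" for i k by (induction k) (simp_all add: Q0)
  have Qkcomm: "Q j ((Q i ^^ k) w) = (Q i ^^ k) (Q j w)" if "w \<in> M" for i j k w
    using that by (induction k) (simp_all add: Qcomm QkM)
  have Qklcomm: "(Q j ^^ l) ((Q i ^^ k) w) = (Q i ^^ k) ((Q j ^^ l) w)" if "w \<in> M" for i j k l w
    using that by (induction l) (simp_all add: Qkcomm QkM)
  have "\<exists>u\<in>M. u \<noteq> 0 \<and> (\<forall>i\<in>I. Q i u = 0) \<and> (\<forall>i. \<exists>k. (Q i ^^ k) u = 0)" if "finite I" for I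
    using that
  proof induction
    case empty
    have "u0 \<in> M" "\<forall>i. \<exists>k. (Q i ^^ k) u0 = 0"
      using u0(1) unfolding gen_weight_space_def Q_def[abs_def] by blast+
    then show ?case using u0(2) by blast
  next
    case (insert i I)
    then obtain u where u: "u \<in> M" "u \<noteq> 0" "\<forall>i\<in>I. Q i u = 0" "\<And>i. \<exists>k. (Q i ^^ k) u = 0" by blast
    obtain k where "(Q i ^^ k) u = 0" using u(4) by blast
    then obtain k where k: "(Q i ^^ k) u \<noteq> 0" "(Q i ^^ Suc k) u = 0"
      using u(2) ex_least_nat_less[of "\<lambda>k. (Q i ^^ k) u = 0" k] by auto
    have "Q j ((Q i ^^ k) u) = 0" if "j \<in> insert i I" for j
      using that k(2) u(1,3) by (auto simp: Qkcomm Qk0)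
    moreover have "\<exists>l. (Q j ^^ l) ((Q i ^^ k) u) = 0" for j
      using u(4)[of j] u(1) by (metis Qklcomm Qk0)
    ultimately show ?case using k(1) QkM[OF u(1)] by blast
  qed
  from this[of UNIV] obtain u where u: "u \<in> M" "u \<noteq> 0" "\<And>i. Q i u = 0" by auto
  then have "u \<in> weight_space smul M gact lam" by (simp add: weight_space_def Q_def)
  then show ?thesis using u(2) \<open>lam \<in> supp smul M gact\<close> by blast
qed

end

lemma (in complex_vector_space) finite_dimensional_coordinates:
  assumes fd: "fin_dim scale V" and V: "subspace V"
  shows "\<exists>(U :: (nat \<Rightarrow>\<^sub>0 complex) set) \<iota>. module.subspace pm_scale U \<and> fin_dim pm_scale U \<and> bij_betw \<iota> U V \<and>
     (\<forall>p q. \<iota> (p + q) = \<iota> p + \<iota> q) \<and> (\<forall>c p. \<iota> (pm_scale c p) = scale c (\<iota> p))"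
proof -
  interpret C: vector_space "pm_scale :: complex \<Rightarrow> (nat \<Rightarrow>\<^sub>0 complex) \<Rightarrow> _" by (rule vector_space_pm_scale)
  obtain B where B: "finite B" "V \<subseteq> span B" using fd by (auto simp: fin_dim_def)
  obtain C where C: "C \<subseteq> V" "independent C" "V \<subseteq> span C" using basis_exists[of V] by metis
  have fC: "finite C" using independent_span_bound[OF B(1) C(2)] C(1) B(2) by blast
  have VC: "V = span C" using C(3) span_minimal[OF C(1) V] by blast
  obtain e where e: "bij_betw e {..<card C} C" using ex_bij_betw_nat_finite[OF fC] by (auto simp: atLeast0LessThan)
  let ?d = "card C"
  define U where "U = {p :: nat \<Rightarrow>\<^sub>0 complex. keys p \<subseteq> {..<?d}}"
  define \<iota> where "\<iota> p = (\<Sum>k<?d. scale (lookup p k) (e k))" for p :: "nat \<Rightarrow>\<^sub>0 complex"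
  have \<iota>a: "\<iota> (p + q) = \<iota> p + \<iota> q" for p q
    by (simp add: \<iota>_def lookup_add scale_left_distrib sum.distrib)
  have \<iota>s: "\<iota> (pm_scale c p) = scale c (\<iota> p)" for c p
    by (simp add: \<iota>_def scale_sum_right)
  have U: "p \<in> U \<longleftrightarrow> (\<forall>k\<ge>?d. lookup p k = 0)" for p
    by (auto simp: U_def in_keys_iff subset_iff not_less[symmetric])
  have "C.subspace U"
    by (rule C.subspaceI) (simp_all add: U lookup_add)
  moreover have "fin_dim pm_scale U"
    unfolding fin_dim_def
  proof (intro exI[of _ "(\<lambda>k. single k 1) ` {..<?d}"] conjI subsetI)
    fix p assume p: "p \<in> U"
    have "p = (\<Sum>k<?d. pm_scale (lookup p k) (single k 1))"
      by (rule poly_mapping_eqI) (use p in \<open>auto simp: lookup_sum lookup_single when_def U not_less if_distrib[of "\<lambda>c. _ * c"] cong: if_cong\<close>)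
    moreover have "(\<Sum>k<?d. pm_scale (lookup p k) (single k 1)) \<in>
        C.span ((\<lambda>k. single k 1) ` {..<?d})"
      by (intro C.span_sum C.span_scale C.span_base) simp
    ultimately show "p \<in> C.span ((\<lambda>k. single k 1) ` {..<?d})" by simp
  qed simp
  moreover have "bij_betw \<iota> U V"
  proof (rule bij_betwI')
    fix p q assume pq: "p \<in> U" "q \<in> U"
    show "(\<iota> p = \<iota> q) = (p = q)"
    proof
      assume "\<iota> p = \<iota> q"
      define u where "u b = lookup p (the_inv_into {..<?d} e b) - lookup q (the_inv_into {..<?d} e b)" for b
      have inj: "inj_on e {..<?d}" using e by (simp add: bij_betw_def)
      have ue: "u (e k) = lookup p k - lookup q k" if "k < ?d" for k
        using that by (simp add: u_def the_inv_into_f_f[OF inj])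
      have "(\<Sum>b\<in>C. scale (u b) b) = (\<Sum>k<?d. scale (u (e k)) (e k))"
        by (rule sum.reindex_bij_betw[OF e, symmetric])
      also have "\<dots> = \<iota> p - \<iota> q"
        by (simp add: ue \<iota>_def scale_left_diff_distrib sum_subtractf)
      finally have "(\<Sum>b\<in>C. scale (u b) b) = 0" using \<open>\<iota> p = \<iota> q\<close> by simp
      then have "u b = 0" if "b \<in> C" for b
        using C(2) fC that by (auto simp: dependent_finite)
      then have "lookup p k = lookup q k" if "k < ?d" for k
        using ue[OF that] that e by (metis bij_betwE eq_iff_diff_eq_0 lessThan_iff)
      then show "p = q" using pq by (intro poly_mapping_eqI) (metis U not_less)
    qed simp
  next
    fix p
    show "\<iota> p \<in> V" unfolding \<iota>_def VC
      by (intro span_sum span_scale span_base) (use e in \<open>auto simp: bij_betw_def\<close>)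
  next
    fix v assume "v \<in> V"
    then have "v \<in> range (\<lambda>u. \<Sum>b\<in>C. scale (u b) b)" unfolding VC span_finite[OF fC] .
    then obtain u where u: "v = (\<Sum>b\<in>C. scale (u b) b)" by blast
    define p where "p = (\<Sum>k<?d. single k (u (e k)))"
    have lp: "lookup p k = (if k < ?d then u (e k) else 0)" for k
      by (simp add: p_def lookup_sum lookup_single when_def)
    have "\<iota> p = (\<Sum>k<?d. scale (u (e k)) (e k))" by (simp add: \<iota>_def lp)
    also have "\<dots> = v" unfolding u by (rule sum.reindex_bij_betw[OF e])
    finally show "\<exists>p\<in>U. v = \<iota> p" by (intro bexI[of _ p]) (simp_all add: U lp)
  qed
  ultimately show ?thesis using \<iota>a \<iota>s by blast
qed

context simple_mDelta_module
begin

text \<open>A linear right inverse of \<open>gl_proj\<close>, with $E_{k,i} \mapsto x_k d_i$.\<close>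

definition gl_section :: "complex^'n^'n \<Rightarrow> 'n vf" where
  "gl_section E = (\<chi> i. \<Sum>k\<in>UNIV. const (E $ k $ i) * xvar k)"

lemma gl_section_mDelta: "gl_section E \<in> mDelta"
proof -
  have "(\<Sum>k\<in>S. const (E $ k $ i) * xvar k) \<in> m10" for i S
    by (induction S rule: infinite_finite_induct) (simp_all add: m10_0 m10_add m10_mult xvar_m10)
  then show ?thesis by (simp add: mDelta_def gl_section_def)
qed

lemma gl_section_linear:
  "gl_section (E + F) = gl_section E + gl_section F" "gl_section (gl_scale c E) = vf_scale c (gl_section E)"
  by (simp_all add: gl_section_def gl_scale_def vf_scale_def vec_eq_iff const_add const_mult ring_distribs
      sum.distrib sum_distrib_left mult.assoc)

lemma gl_proj_section: "gl_proj (gl_section E) = E"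
  by (simp add: gl_proj_def gl_section_def vec_eq_iff der_sum der_const_mult der_xvar eval10_sum eval10_mult eval10_const
      if_distrib[of eval10] if_distrib[of "\<lambda>c. _ * c"] cong: if_cong)

lemma rho_factors:
  assumes X: "X \<in> mDelta" and v: "v \<in> V"
  shows "rho (gl_section (gl_proj X)) v = rho X v"
proof -
  have "X - gl_section (gl_proj X) \<in> mDelta"
    using X gl_section_mDelta[of "gl_proj X"] by (simp add: mDelta_def m10_diff)
  moreover have "gl_proj (X - gl_section (gl_proj X)) = 0"
  proof -
    have "gl_proj (Y - Z) = gl_proj Y - gl_proj Z" for Y Z :: "'n vf"
      using gl_proj_linear(1)[of "Y - Z" Z] by simp
    then show ?thesis by (simp add: gl_proj_section)
  qed
  ultimately have "rho (X - gl_section (gl_proj X)) v = 0" using v by (rule gl_proj_kernel_acts_trivially)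
  then show ?thesis using X v by (simp add: act_diff_left gl_section_mDelta)
qed

lemma simple_gl_module:
  "simple_lie_module scale gl_scale gl_bracket UNIV V (\<lambda>E. rho (gl_section E))"
proof -
  have "lie_module scale gl_scale gl_bracket UNIV V (\<lambda>E. rho (gl_section E))"
  proof unfold_locales
    fix E F and v assume v: "v \<in> V"
    have "vf_bracket (gl_section E) (gl_section F) \<in> mDelta"
      by (intro mDelta_subalgebra gl_section_mDelta)
    from rho_factors[OF this v]
    show "rho (gl_section (gl_bracket E F)) v =
        rho (gl_section E) (rho (gl_section F) v) - rho (gl_section F) (rho (gl_section E) v)"
      by (simp add: gl_proj_bracket gl_section_mDelta gl_proj_section act_bracket v)
  qed (simp_all add: subspace_V gl_section_linear gl_section_mDelta act_closed act_add_left act_add_right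
      act_scale_left act_scale_right)
  moreover have "(\<forall>X\<in>mDelta. \<forall>w\<in>W. rho X w \<in> W)"
    if "W \<subseteq> V" "\<forall>E\<in>UNIV. \<forall>w\<in>W. rho (gl_section E) w \<in> W" for W
    using that rho_factors by (metis UNIV_I subsetD)
  ultimately show ?thesis
    using simple unfolding simple_lie_module_def by blast
qed

end

lemma simple_mDelta_module_cong:
  assumes "simple_lie_module smul vf_scale vf_bracket (mDelta :: 'n::finite vf set) V act"
    and eq: "\<And>X v. X \<in> mDelta \<Longrightarrow> v \<in> V \<Longrightarrow> act' X v = act X v"
  shows "simple_lie_module smul vf_scale vf_bracket mDelta V act'"
proof -
  interpret L: lie_module smul vf_scale vf_bracket "mDelta :: 'n vf set" V act
    using assms(1) by (simp add: simple_lie_module_def)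
  have "lie_module smul vf_scale vf_bracket mDelta V act'"
    by unfold_locales (simp_all add: eq mDelta_subalgebra L.subspace_V L.subspace_add[OF L.subspace_V]
        L.subspace_scale[OF L.subspace_V] L.act_closed L.act_add_left
        L.act_scale_left L.act_add_right L.act_scale_right L.act_bracket)
  moreover have "(\<forall>X\<in>mDelta. \<forall>w\<in>W. act X w \<in> W)" if "W \<subseteq> V" "\<forall>X\<in>mDelta. \<forall>w\<in>W. act' X w \<in> W" for W
    using that eq by (metis subsetD)
  ultimately show ?thesis
    using assms(1) unfolding simple_lie_module_def by blast
qed

context AG_module
begin

text \<open>The weight space of a weight is stable under the operators \<open>th\<close>. A minimal submodule \<open>V1\<close> of it is
  transported along \<open>\<iota>\<close> to a space \<open>U\<close> of coordinate vectors, on which $m_{1,0}\Delta$ acts through $gl_n$.\<close>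

theorem simple_cuspidal_isomorphic_tensor_module:
  assumes simpleM: "simple_AG_module smul M aact gact" and cusp: "cuspidal smul M gact"
  shows "\<exists>(lam :: complex^'n) (V :: (nat \<Rightarrow>\<^sub>0 complex) set) rho.
    simple_lie_module pm_scale gl_scale gl_bracket (UNIV :: (complex^'n^'n) set) V rho \<and>
    fin_dim pm_scale V \<and>
    AG_isomorphic smul M aact gact (T_scale pm_scale) (T_space V) (T_fun pm_scale (*))
      (T_vf pm_scale (*) (Alam_d lam) (gl_action rho))"
proof -
  interpret D: Dn_mDelta_module smul M aact "ga 1" th by (rule Dn_mDelta_module_th)
  interpret PM: vector_space "pm_scale :: complex \<Rightarrow> (nat \<Rightarrow>\<^sub>0 complex) \<Rightarrow> _" by (rule vector_space_pm_scale)
  have "M \<noteq> {0}" using simpleM by (simp add: simple_AG_module_def)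
  then obtain lam where lam: "lam \<in> supp smul M gact" "weight_space smul M gact lam \<noteq> {0}"
    using weight_vector_exists cusp unfolding cuspidal_def by blast
  let ?V0 = "weight_space smul M gact lam"
  have V0: "w \<in> ?V0 \<longleftrightarrow> w \<in> M \<and> (\<forall>i. ga 1 i w = smul (lam $ i) w)" for w
    by (simp add: weight_space_def ga_def)
  have "fin_dim smul ?V0" using cusp lam(1) unfolding cuspidal_def by blast
  then obtain B where B: "finite B" "?V0 \<subseteq> span B" by (auto simp: fin_dim_def)
  define P where "P W \<longleftrightarrow> subspace W \<and> W \<noteq> {0} \<and> (\<forall>f i. \<forall>w\<in>W. th f i w \<in> W)" for W
  have PV0: "P ?V0"
    unfolding P_def
  proof (intro conjI allI ballI lam(2))
    show "subspace ?V0"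
      by (rule subspaceI) (auto simp: V0 M_cl ga_linear scale_right_distrib mult.commute D.op_zero)
    show "th f i w \<in> ?V0" if "w \<in> ?V0" for f i w
      using that by (auto simp: V0 th_preserves D.scale_right simp flip: D.th_D)
  qed
  have "\<exists>W\<subseteq>?V0. P W \<and> (\<forall>W'\<subseteq>W. P W' \<longrightarrow> W' = W)"
    by (rule minimal_subspace_exists[of B ?V0 P, OF B PV0]) (simp add: P_def)
  then obtain V1 where V1: "V1 \<subseteq> ?V0" "P V1" "\<forall>W\<subseteq>V1. P W \<longrightarrow> W = V1" by blast
  have sub1: "subspace V1" and th1: "\<And>f i w. w \<in> V1 \<Longrightarrow> th f i w \<in> V1" and V1_0: "V1 \<noteq> {0}"
    using V1(2) by (auto simp: P_def)
  have V1M: "v \<in> M" if "v \<in> V1" for v using V1(1) V0 that by blast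
  have fd1: "fin_dim smul V1" using B V1(1) unfolding fin_dim_def by blast
  interpret L: lie_module smul vf_scale vf_bracket "mDelta :: 'n vf set" V1 D.theta
    by (rule D.lie_module_theta[OF sub1 _ th1]) (use V1M in auto)
  obtain U :: "(nat \<Rightarrow>\<^sub>0 complex) set" and \<iota> where U: "PM.subspace U" "fin_dim pm_scale U" "bij_betw \<iota> U V1"
    and \<iota>: "\<And>p q. \<iota> (p + q) = \<iota> p + \<iota> q" "\<And>c p. \<iota> (pm_scale c p) = smul c (\<iota> p)"
    using finite_dimensional_coordinates[OF fd1 sub1] by blast
  have inj: "inj_on \<iota> U" and img: "\<iota> ` U = V1" using U(3) by (auto simp: bij_betw_def)
  have \<iota>V: "\<iota> p \<in> V1" if "p \<in> U" for p using img that by blast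
  have \<iota>0: "\<iota> 0 = 0" using \<iota>(1)[of 0 0] by simp
  have \<iota>d: "\<iota> (p - q) = \<iota> p - \<iota> q" for p q using \<iota>(1)[of "p - q" q] by simp
  have \<iota>I: "p = q" if "p \<in> U" "q \<in> U" "\<iota> p = \<iota> q" for p q using inj that by (simp add: inj_on_def)
  define r where "r X p = the_inv_into U \<iota> (D.theta X (\<iota> p))" for X p
  have \<iota>r: "\<iota> (r X p) = D.theta X (\<iota> p)" and rU: "r X p \<in> U" if "X \<in> mDelta" "p \<in> U" for X p
  proof -
    have "D.theta X (\<iota> p) \<in> \<iota> ` U" unfolding img by (rule L.act_closed[OF that(1) \<iota>V[OF that(2)]])
    then show "\<iota> (r X p) = D.theta X (\<iota> p)" "r X p \<in> U"
      unfolding r_def by (auto simp: f_the_inv_into_f[OF inj] the_inv_into_f_f[OF inj])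
  qed
  note U_cl = PM.subspace_add[OF U(1)] PM.subspace_scale[OF U(1)] PM.subspace_diff[OF U(1)]
  have lie: "lie_module pm_scale vf_scale vf_bracket (mDelta :: 'n vf set) U r"
    by unfold_locales
      (simp_all add: U(1) rU, (rule \<iota>I; simp add: rU U_cl mDelta_subalgebra \<iota>r \<iota> \<iota>d \<iota>V L.act_add_left
        L.act_scale_left L.act_add_right L.act_scale_right L.act_bracket)+)
  have aug: "axis i (reduced f) \<in> (mDelta :: 'n vf set)" for f i
    by (simp add: mDelta_def axis_def m10_0 m10_eq eval10_diff eval10_const)
  have theta_th: "D.theta (axis i (reduced f)) v = th f i v" if "v \<in> M" for f i v
  proof -
    have "th (const c) i v = 0" for c
      using D.th_scale_left[OF that, of c 1 i] D.th_one[OF that, of i] by simp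
    then show ?thesis using that by (simp add: D.theta_axis D.th_diff_left)
  qed
  have simple: "simple_lie_module pm_scale vf_scale vf_bracket (mDelta :: 'n vf set) U r"
    unfolding simple_lie_module_def
  proof (intro conjI allI impI lie)
    show "U \<noteq> {0}" using img V1_0 \<iota>0 by force
    fix W assume W: "W \<subseteq> U" "PM.subspace W" "\<forall>X\<in>mDelta. \<forall>w\<in>W. r X w \<in> W"
    have imgW_subspace: "subspace (\<iota> ` W)"
    proof (rule subspaceI)
      show "0 \<in> \<iota> ` W" using PM.subspace_0[OF W(2)] \<iota>0 by (metis imageI)
      show "x + y \<in> \<iota> ` W" if xy: "x \<in> \<iota> ` W" "y \<in> \<iota> ` W" for x y
      proof -
        obtain a b where "a \<in> W" "b \<in> W" "x = \<iota> a" "y = \<iota> b" using xy by blast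
        then show ?thesis using PM.subspace_add[OF W(2)] \<iota>(1) by (metis imageI)
      qed
      show "smul c x \<in> \<iota> ` W" if "x \<in> \<iota> ` W" for c x
        using that PM.subspace_scale[OF W(2)] \<iota>(2) by (metis (no_types, lifting) imageE imageI)
    qed
    have imgW_th: "th f i x \<in> \<iota> ` W" if "x \<in> \<iota> ` W" for f i x
    proof -
      from that obtain w where w: "w \<in> W" "x = \<iota> w" by blast
      then have wU: "w \<in> U" using W(1) by blast
      have "\<iota> (r (axis i (reduced f)) w) = th f i x"
        unfolding \<iota>r[OF aug wU] w(2) by (rule theta_th[OF V1M[OF \<iota>V[OF wU]]])
      then show ?thesis using W(3) aug w(1) by (metis imageI)
    qed
    have "P (\<iota> ` W)" if "\<iota> ` W \<noteq> {0}"
      unfolding P_def by (intro conjI allI ballI imgW_subspace imgW_th that)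
    moreover have "\<iota> ` W \<subseteq> V1" using W(1) img by blast
    ultimately have "\<iota> ` W = {0} \<or> \<iota> ` W = V1" using V1(3) by blast
    then show "W = {0} \<or> W = U"
    proof
      assume z: "\<iota> ` W = {0}"
      have "w = 0" if "w \<in> W" for w
      proof (rule \<iota>I)
        show "w \<in> U" using that W(1) by blast
        have "\<iota> w \<in> \<iota> ` W" using that by (rule imageI)
        then show "\<iota> w = \<iota> 0" unfolding z \<iota>0 by simp
      qed (rule PM.subspace_0[OF U(1)])
      then show ?thesis using PM.subspace_0[OF W(2)] by auto
    next
      assume "\<iota> ` W = V1"
      then show ?thesis using inj_on_image_eq_iff[OF inj W(1) subset_refl] img by simp
    qed
  qed
  interpret S: simple_mDelta_module pm_scale U r
    by (intro simple_mDelta_module.intro mDelta_module.intro simple_mDelta_module_axioms.intro lie U(2) simple)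
  let ?rho = "\<lambda>E. r (S.gl_section E)"
  have gl_r: "gl_action ?rho X p = r X p" if "X \<in> mDelta" "p \<in> U" for X p
    using S.rho_factors[OF that] by (simp add: gl_action_def)
  have "AG_isomorphic smul M aact gact (T_scale pm_scale) (T_space U) (T_fun pm_scale (*))
      (T_vf pm_scale (*) (Alam_d lam) (gl_action ?rho))"
  proof (rule isomorphic_tensor_module[OF simpleM simple_mDelta_module_cong[OF simple gl_r], where \<iota> = \<iota>])
    show "v = 0" if "v \<in> U" "\<iota> v = 0" for v
      using \<iota>I[OF that(1) PM.subspace_0[OF U(1)]] that(2) \<iota>0 by simp
    show "gact (axis i 1) (\<iota> v) = smul (lam $ i) (\<iota> v)" if "v \<in> U" for i v
      using V1(1) \<iota>V[OF that] by (auto simp: weight_space_def)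
    show "\<iota> (gl_action ?rho (axis i (reduced f)) v) = th f i (\<iota> v)" if "v \<in> U" for f i v
      unfolding gl_r[OF aug that] \<iota>r[OF aug that] by (rule theta_th[OF V1M[OF \<iota>V[OF that]]])
  qed (use \<iota> \<iota>V V1M in auto)
  with S.simple_gl_module U(2) show ?thesis by blast
qed

end

theorem proposition4p12:
  shows "(\<forall>(lam :: complex^'n::finite) (scaleV :: complex \<Rightarrow> 'v::ab_group_add \<Rightarrow> 'v) V rho.
      simple_lie_module scaleV vf_scale vf_bracket (mDelta :: 'n vf set) V rho \<longrightarrow>
      simple_AG_module (T_scale scaleV) (T_space V) (T_fun scaleV (*)) (T_vf scaleV (*) (Alam_d lam) rho))
    \<and>
    (\<forall>(scaleM :: complex \<Rightarrow> 'm::ab_group_add \<Rightarrow> 'm) M (aact :: 'n An \<Rightarrow> 'm \<Rightarrow> 'm) gact.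
      simple_AG_module scaleM M aact gact \<and> cuspidal scaleM M gact \<longrightarrow>
      (\<exists>(lam :: complex^'n) (V :: (nat \<Rightarrow>\<^sub>0 complex) set) rho.
        simple_lie_module pm_scale gl_scale gl_bracket (UNIV :: (complex^'n^'n) set) V rho \<and>
        fin_dim pm_scale V \<and>
        AG_isomorphic scaleM M aact gact
          (T_scale pm_scale) (T_space V) (T_fun pm_scale (*))
          (T_vf pm_scale (*) (Alam_d lam) (gl_action rho))))"
proof (intro conjI allI impI)
  fix lam :: "complex^'n" and scaleV :: "complex \<Rightarrow> 'v \<Rightarrow> 'v" and V rho
  assume simple: "simple_lie_module scaleV vf_scale vf_bracket (mDelta :: 'n vf set) V rho"
  interpret lie_module scaleV vf_scale vf_bracket "mDelta :: 'n vf set" V rho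
    using simple by (simp add: simple_lie_module_def)
  interpret tensor_setting scaleV V rho lam by unfold_locales
  show "simple_AG_module (T_scale scaleV) (T_space V) (T_fun scaleV (*)) (T_vf scaleV (*) (Alam_d lam) rho)"
    by (rule simple_T[OF simple])
next
  fix scaleM :: "complex \<Rightarrow> 'm \<Rightarrow> 'm" and M and aact :: "'n An \<Rightarrow> 'm \<Rightarrow> 'm" and gact
  assume *: "simple_AG_module scaleM M aact gact \<and> cuspidal scaleM M gact"
  interpret AG_module scaleM M aact gact
    using * by (simp add: simple_AG_module_def)
  show "\<exists>(lam :: complex^'n) (V :: (nat \<Rightarrow>\<^sub>0 complex) set) rho.
        simple_lie_module pm_scale gl_scale gl_bracket (UNIV :: (complex^'n^'n) set) V rho \<and>
        fin_dim pm_scale V \<and>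
        AG_isomorphic scaleM M aact gact
          (T_scale pm_scale) (T_space V) (T_fun pm_scale (*))
          (T_vf pm_scale (*) (Alam_d lam) (gl_action rho))"
    using * by (intro simple_cuspidal_isomorphic_tensor_module) simp_all
qed

end
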